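(* For any symmetric distribution of $X_{11}$ and any $p=p_n\to\infty$, $$\operatorname{Var}(\operatorname{tr}(\mathbf R^2))\sim\sigma_n^2:=2p^2n\,(\beta_4^2+2n^{-3}),\qquad n\to\infty.$$ Moreover, $$\sigma_n^2\sim\begin{cases}4p^2n^{-2}&\text{if }\mathbb E[X_{11}^4]<\infty\text{ or }\alpha\in(3,4),\\ 2p^2n^{-2}\big(L^2(n^{1/2})\,c_2^2(\alpha)+2\big)&\text{if }\alpha=3,\\ 2p^2n^{1-\alpha}L^2(n^{1/2})\,c_2^2(\alpha)&\text{if }\alpha\in[2,3)\text{ and }\mathbb E[X_{11}^2]=1,\\ 2p^2n^{-1}(1-\alpha/2)^2&\text{if }\alpha\in(0,2),\end{cases}$$ where $c_2(\alpha)=\Gamma(1+\alpha/2)\,\Gamma(2-\alpha/2)$, and where a condition on $\alpha$ means that $X_{11}$ is regularly varying with index $\alpha$: $\mathbb P(|X_{11}|>x)=x^{-\alpha}L(x)$, $x>0$, with $L$ slowly varying at infinity.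
   Context: For each $n$, $(X_{ij})_{1\le i\le p,1\le j\le n}$ are iid copies of a non-degenerate real random variable $X_{11}$ which is symmetric and satisfies $\mathbb P(X_{11}=0)=0$; $\mathbb E[X_{11}^2]=1$ whenever this second moment is finite. Put $Y_{ij}=X_{ij}/\sqrt{X_{i1}^2+\cdots+X_{in}^2}$, $\mathbf Y=(Y_{ij})\in\mathbb R^{p\times n}$, $\mathbf R=\mathbf Y\mathbf Y^{\top}$ (sample correlation matrix) and $\beta_4=\mathbb E[Y_{11}^4]$ (depends on $n$). The notation $a_n\sim b_n$ means $a_n/b_n\to1$. *)

theory Defs
  imports
    "HOL-Probability.Probability"
    "HOL-Library.Landau_Symbols"
    "Jordan_Normal_Form.Matrix"
begin

(* Rows and columns are indexed from 0, so the (i,j) entry of the p x n data array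
   x (1 <= i <= p, 1 <= j <= n) is x (i-1) (j-1). *)

definition self_normalized :: "nat \<Rightarrow> (nat \<Rightarrow> nat \<Rightarrow> real) \<Rightarrow> nat \<Rightarrow> nat \<Rightarrow> real" where
  "self_normalized n x i j = x i j / sqrt (\<Sum>k<n. (x i k)\<^sup>2)"

definition Y_matrix :: "nat \<Rightarrow> nat \<Rightarrow> (nat \<Rightarrow> nat \<Rightarrow> real) \<Rightarrow> real Matrix.mat" where
  "Y_matrix p n x = Matrix.mat p n (\<lambda>(i, j). self_normalized n x i j)"

definition sample_correlation :: "nat \<Rightarrow> nat \<Rightarrow> (nat \<Rightarrow> nat \<Rightarrow> real) \<Rightarrow> real Matrix.mat" where
  "sample_correlation p n x = Y_matrix p n x * transpose_mat (Y_matrix p n x)"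

definition matrix_trace :: "real Matrix.mat \<Rightarrow> real" where
  "matrix_trace A = (\<Sum>i<dim_row A. A $$ (i, i))"

definition beta4 :: "'a measure \<Rightarrow> nat \<Rightarrow> (nat \<Rightarrow> nat \<Rightarrow> 'a \<Rightarrow> real) \<Rightarrow> real" where
  "beta4 M n X = prob_space.expectation M (\<lambda>\<omega>. self_normalized n (\<lambda>i j. X i j \<omega>) 0 0 ^ 4)"

definition sigma_sq :: "nat \<Rightarrow> nat \<Rightarrow> real \<Rightarrow> real" where
  "sigma_sq p n b = 2 * real p ^ 2 * real n * (b\<^sup>2 + 2 * real n powr (-3))"

definition c2 :: "real \<Rightarrow> real" where
  "c2 \<alpha> = Gamma (1 + \<alpha> / 2) * Gamma (2 - \<alpha> / 2)"

definition slowly_varying :: "(real \<Rightarrow> real) \<Rightarrow> bool" where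
  "slowly_varying L \<longleftrightarrow>
     L \<in> borel_measurable (restrict_space borel {0<..}) \<and>
     (\<forall>\<^sub>F x in at_top. L x > 0) \<and>
     (\<forall>t>0. ((\<lambda>x. L (t * x) / L x) \<longlongrightarrow> 1) at_top)"

definition regularly_varying_rv ::
  "'b measure \<Rightarrow> ('b \<Rightarrow> real) \<Rightarrow> real \<Rightarrow> (real \<Rightarrow> real) \<Rightarrow> bool" where
  "regularly_varying_rv N \<xi> \<alpha> L \<longleftrightarrow>
     slowly_varying L \<and> (\<forall>x>0. \<P>(\<omega> in N. \<bar>\<xi> \<omega>\<bar> > x) = x powr (-\<alpha>) * L x)"

(* xi plays the role of X_11. *)
definition admissible_entry :: "'b measure \<Rightarrow> ('b \<Rightarrow> real) \<Rightarrow> bool" where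
  "admissible_entry N \<xi> \<longleftrightarrow>
     prob_space N \<and> \<xi> \<in> borel_measurable N \<and>
     \<not> (\<exists>c. AE \<omega> in N. \<xi> \<omega> = c) \<and>
     distr N borel \<xi> = distr N borel (\<lambda>\<omega>. - \<xi> \<omega>) \<and>
     \<P>(\<omega> in N. \<xi> \<omega> = 0) = 0 \<and>
     (integrable N (\<lambda>\<omega>. (\<xi> \<omega>)\<^sup>2) \<longrightarrow> prob_space.expectation N (\<lambda>\<omega>. (\<xi> \<omega>)\<^sup>2) = 1)"

definition iid_copies ::
  "'a measure \<Rightarrow> nat \<Rightarrow> nat \<Rightarrow> (nat \<Rightarrow> nat \<Rightarrow> 'a \<Rightarrow> real) \<Rightarrow> 'b measure \<Rightarrow> ('b \<Rightarrow> real) \<Rightarrow> bool" where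
  "iid_copies M p n X N \<xi> \<longleftrightarrow>
     prob_space M \<and>
     prob_space.indep_vars M (\<lambda>_. borel) (\<lambda>(i, j). X i j) ({..<p} \<times> {..<n}) \<and>
     (\<forall>i<p. \<forall>j<n. distr M borel (X i j) = distr N borel \<xi>)"

end

theory Submission
  imports Defs "HOL-Real_Asymp.Real_Asymp"
begin

text \<open>
Write \<open>u = x / |x|\<close> for a row divided by its Euclidean norm, \<open>u\<^sub>1, \<dots>, u\<^sub>p\<close> for the
normalized rows, and \<open>\<beta>\<close> for the fourth moment of a coordinate of \<open>u\<close>. Then \<open>tr(R\<^sup>2)\<close> is the sum
of \<open>\<langle>u\<^sub>i, u\<^sub>k\<rangle>\<^sup>2\<close> over all \<open>i\<close> and \<open>k\<close>, and the diagonal contributes the constant \<open>p\<close>.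

\<^bold>\<open>The variance.\<close> By symmetry and exchangeability of the entries, the second moment matrix of \<open>u\<close> is
the identity divided by \<open>n\<close>. Hence \<open>\<langle>u\<^sub>i, u\<^sub>k\<rangle>\<^sup>2 - 1/n\<close> has mean zero when one of the two rows is fixed
and the other one is averaged: the off-diagonal sum is a completely degenerate U-statistic. Its
summands are uncorrelated unless they belong to the same unordered pair, so that the variance is
exactly \<open>2p(p-1)\<close> times the second moment of the kernel (\<open>second_moment_off_diagonal_sum\<close>). Symmetry
and exchangeability also express all fourth order moments of \<open>u\<close> by \<open>\<beta>\<close>, which gives that second
moment in closed form (\<open>corr_kernel_second_moment\<close>). It differs from \<open>n\<beta>\<^sup>2 + 2/n\<^sup>2\<close> by
\<open>3/(n-1) (n\<beta>\<^sup>2 - 2\<beta> + 1/n\<^sup>2)\<close>, and \<open>2\<beta> \<le> n\<^sup>1\<^sup>/\<^sup>2 (n\<beta>\<^sup>2 + 1/n\<^sup>2)\<close> makes this a relative error of order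
\<open>n\<^sup>-\<^sup>1\<^sup>/\<^sup>2\<close>, whatever the distribution is.

\<^bold>\<open>The size of \<open>\<beta>\<close>.\<close> Let \<open>S\<close> be the sum of the squares of \<open>n - 1\<close> entries and let
\<open>h\<^sub>r(s) = E (X\<^sup>2/(X\<^sup>2 + s))\<^sup>r\<close>. Conditioning on all entries of a row but one gives \<open>\<beta> = E h\<^sub>2(S)\<close> and
\<open>1/n = E h\<^sub>1(S)\<close>. If the tail \<open>H(s) = P(X\<^sup>2 > s)\<close> is regularly varying with index \<open>-a\<close>, where
\<open>a = \<alpha>/2 < r\<close>, then \<open>h\<^sub>r(s)\<close> is asymptotic to \<open>r B(r - a, 1 + a) H(s)\<close>: the layer cake formula writes
\<open>h\<^sub>r\<close> as an integral of \<open>H\<close> over \<open>(0, 1)\<close>, and Potter bounds, which are elementary because \<open>H\<close> is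
monotone, justify passing to the limit under the integral (\<open>ratio_moment_tail_limit\<close>). The constant for
\<open>r = 2\<close> is \<open>c\<^sub>2(\<alpha>)\<close>. Since \<open>S\<close> is small only with exponentially small probability (Chernoff), three
short arguments cover all cases without any limit theorem for \<open>S\<close>.

\<^item> For \<open>\<alpha> < 2\<close> the quotient \<open>h\<^sub>2/h\<^sub>1\<close> tends to \<open>1 - a\<close> at infinity, and comparing \<open>E h\<^sub>2(S)\<close> with
  \<open>E h\<^sub>1(S) = 1/n\<close> yields \<open>n\<beta> \<longrightarrow> 1 - a\<close> (\<open>scaled_beta_limit\<close>).

\<^item> For \<open>2 \<le> \<alpha> < 4\<close> and \<open>E X\<^sup>2 = 1\<close>, convexity of \<open>h\<^sub>2\<close> gives \<open>\<beta> \<ge> h\<^sub>2(n - 1)\<close>, while monotonicity of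
  \<open>h\<^sub>2\<close> and the Chernoff bound give \<open>\<beta> \<le> h\<^sub>2(\<rho>n)\<close> up to an exponentially small term, for every
  \<open>\<rho> < 1\<close>. Thus \<open>\<beta>\<close> is asymptotic to \<open>c\<^sub>2(\<alpha>) H(n)\<close> (\<open>beta_tail_limit\<close>).

\<^item> If \<open>s\<^sup>3\<^sup>/\<^sup>2 h\<^sub>2(s)\<close> vanishes at infinity, then so does \<open>n\<^sup>3\<^sup>/\<^sup>2 \<beta>\<close> (\<open>beta_small\<close>). This is the case for
  \<open>E X\<^sup>4 < \<infinity>\<close>, where \<open>h\<^sub>2(s) \<le> E X\<^sup>4/s\<^sup>2\<close>, and for \<open>3 < \<alpha> < 4\<close>.

These rates for \<open>\<beta>\<close> decide which of the two terms of \<open>n\<beta>\<^sup>2 + 2/n\<^sup>2\<close> dominates; for \<open>\<alpha> = 3\<close> they are of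
the same order up to the slowly varying factor, which need not converge, and both stay.
\<close>

section \<open>Degenerate kernels of order two\<close>

lemma integral_PiM_insert_coordinate:
  fixes f :: "('i \<Rightarrow> 'b) \<Rightarrow> real"
  assumes "prob_space P" "finite I" "k \<in> I"
    and f: "integrable (PiM I (\<lambda>_. P)) f"
  shows "(\<integral>x. f x \<partial>PiM I (\<lambda>_. P)) =
         (\<integral>x. (\<integral>y. f (x(k := y)) \<partial>P) \<partial>PiM (I - {k}) (\<lambda>_. P))"
proof -
  interpret P: prob_space P by fact
  interpret product_sigma_finite "\<lambda>_. P" by unfold_locales
  have I: "insert k (I - {k}) = I" using assms by auto
  show ?thesis
    using product_integral_insert[of "I - {k}" k f, unfolded I] assms by simp
qed

text \<open>The form in which degeneracy is used: it is enough to integrate out one suitably chosen coordinate.\<close>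

lemma product_integral_eq_0_if_coordinate:
  fixes f :: "('i \<Rightarrow> 'b) \<Rightarrow> real"
  assumes "prob_space P" "finite I" "k \<in> I"
    and f: "integrable (PiM I (\<lambda>_. P)) f"
    and zero: "\<And>x. x \<in> space (PiM (I - {k}) (\<lambda>_. P)) \<Longrightarrow> (\<integral>y. f (x(k := y)) \<partial>P) = 0"
  shows "(\<integral>x. f x \<partial>PiM I (\<lambda>_. P)) = 0"
  by (simp add: integral_PiM_insert_coordinate[OF assms(1-4)] zero cong: Bochner_Integration.integral_cong)

text \<open>The kernel of a completely degenerate U-statistic of order two. A bounded kernel makes all products
of kernel values integrable.\<close>

locale degenerate_kernel = prob_space P for P :: "'b measure" +
  fixes a :: "'b \<Rightarrow> 'b \<Rightarrow> real" and C :: real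
  assumes kernel_measurable [measurable]: "case_prod a \<in> borel_measurable (P \<Otimes>\<^sub>M P)"
    and kernel_bounded: "\<And>x y. x \<in> space P \<Longrightarrow> y \<in> space P \<Longrightarrow> \<bar>a x y\<bar> \<le> C"
    and kernel_sym: "\<And>x y. a x y = a y x"
    and kernel_degenerate: "\<And>x. x \<in> space P \<Longrightarrow> (\<integral>y. a x y \<partial>P) = 0"
begin

definition off_diagonal :: "nat \<Rightarrow> (nat \<times> nat) set" where
  "off_diagonal p = {(i, k). i < p \<and> k < p \<and> i \<noteq> k}"

lemma off_diagonal_eq: "off_diagonal p = ({..<p} \<times> {..<p}) - (\<lambda>i. (i, i)) ` {..<p}"
  by (auto simp: off_diagonal_def)

lemma finite_off_diagonal [simp]: "finite (off_diagonal p)"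
  by (simp add: off_diagonal_eq)

lemma card_off_diagonal: "real (card (off_diagonal p)) = real p * (real p - 1)"
proof -
  have "card (off_diagonal p) = p * p - p"
    unfolding off_diagonal_eq
    by (subst card_Diff_subset) (auto simp: card_image inj_on_def)
  then show ?thesis
    by (cases p) (auto simp: algebra_simps)
qed

abbreviation sample :: "nat \<Rightarrow> (nat \<Rightarrow> 'b) measure" where
  "sample p \<equiv> PiM {..<p} (\<lambda>_. P)"

lemma prob_space_sample: "prob_space (sample p)"
  by (intro prob_space_PiM prob_space_axioms)

lemma kernel_sample_measurable [measurable]:
  assumes "i < p" "k < p"
  shows "(\<lambda>x. a (x i) (x k)) \<in> borel_measurable (sample p)"
proof -
  have [measurable]: "(\<lambda>x. x i) \<in> measurable (sample p) P" "(\<lambda>x. x k) \<in> measurable (sample p) P"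
    using assms by (auto intro: measurable_component_singleton)
  show ?thesis by measurable
qed

lemma kernel_sample_bounded:
  assumes "i < p" "k < p" "x \<in> space (sample p)"
  shows "\<bar>a (x i) (x k)\<bar> \<le> C"
  using assms by (auto simp: space_PiM intro!: kernel_bounded)

lemma kernel_sample_integrable:
  assumes "i < p" "k < p"
  shows "integrable (sample p) (\<lambda>x. a (x i) (x k))"
proof -
  interpret S: prob_space "sample p" by (rule prob_space_sample)
  show ?thesis
    using assms kernel_sample_bounded
    by (intro S.integrable_const_bound[where B = C]) auto
qed

lemma kernel_sample_product_integrable:
  assumes "i < p" "k < p" "i' < p" "k' < p"
  shows "integrable (sample p) (\<lambda>x. a (x i) (x k) * a (x i') (x k'))"
proof -
  interpret S: prob_space "sample p" by (rule prob_space_sample)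
  have "\<bar>a (x i) (x k) * a (x i') (x k')\<bar> \<le> C * C" if "x \<in> space (sample p)" for x
    unfolding abs_mult using that assms
    by (intro mult_mono kernel_sample_bounded) (auto intro: order_trans[OF abs_ge_zero kernel_sample_bounded[of i p k x]])
  with assms show ?thesis
    by (intro S.integrable_const_bound[where B = "C * C"]) auto
qed

lemma kernel_sample_mean:
  assumes "i < p" "k < p" "i \<noteq> k"
  shows "(\<integral>x. a (x i) (x k) \<partial>sample p) = 0"
proof (rule product_integral_eq_0_if_coordinate[where k = k])
  fix x assume "x \<in> space (PiM ({..<p} - {k}) (\<lambda>_. P))"
  then show "(\<integral>y. a ((x(k := y)) i) ((x(k := y)) k) \<partial>P) = 0"
    using assms by (auto simp: space_PiM intro!: kernel_degenerate)
qed (use assms kernel_sample_integrable prob_space_axioms in auto)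

text \<open>The index \<open>k\<close> occurs in the first factor only, so averaging over \<open>x k\<close> kills the product.\<close>

lemma kernel_sample_orthogonal_aux:
  assumes "i < p" "k < p" "i' < p" "k' < p" "i \<noteq> k" "k \<noteq> i'" "k \<noteq> k'"
  shows "(\<integral>x. a (x i) (x k) * a (x i') (x k') \<partial>sample p) = 0"
proof (rule product_integral_eq_0_if_coordinate[where k = k])
  fix x assume x: "x \<in> space (PiM ({..<p} - {k}) (\<lambda>_. P))"
  then have "(\<integral>y. a (x i) y \<partial>P) = 0"
    using assms by (auto simp: space_PiM intro!: kernel_degenerate)
  then show "(\<integral>y. a ((x(k := y)) i) ((x(k := y)) k) * a ((x(k := y)) i') ((x(k := y)) k') \<partial>P) = 0"
    using assms by simp
qed (use assms kernel_sample_product_integrable prob_space_axioms in auto)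

text \<open>Two different unordered pairs cannot contain each other: one of \<open>i\<close> and \<open>k\<close> is missing from the
second pair, and symmetry of the kernel lets this index play the role of \<open>k\<close>.\<close>

lemma kernel_sample_orthogonal:
  assumes "(i, k) \<in> off_diagonal p" "(i', k') \<in> off_diagonal p"
    and "(i', k') \<noteq> (i, k)" "(i', k') \<noteq> (k, i)"
  shows "(\<integral>x. a (x i) (x k) * a (x i') (x k') \<partial>sample p) = 0"
proof (cases "k \<noteq> i' \<and> k \<noteq> k'")
  case True
  then show ?thesis
    using assms by (intro kernel_sample_orthogonal_aux) (auto simp: off_diagonal_def)
next
  case False
  then have "i \<noteq> i' \<and> i \<noteq> k'"
    using assms by (auto simp: off_diagonal_def)
  then have "(\<integral>x. a (x k) (x i) * a (x i') (x k') \<partial>sample p) = 0"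
    using assms by (intro kernel_sample_orthogonal_aux) (auto simp: off_diagonal_def)
  then show ?thesis by (simp add: kernel_sym)
qed

lemma kernel_sample_square:
  assumes "i < p" "k < p" "i \<noteq> k"
  shows "(\<integral>x. (a (x i) (x k))\<^sup>2 \<partial>sample p) = (\<integral>x. (\<integral>y. (a x y)\<^sup>2 \<partial>P) \<partial>P)"
proof -
  let ?g = "\<lambda>x. (\<integral>y. (a x y)\<^sup>2 \<partial>P)"
  have "(\<integral>x. (a (x i) (x k))\<^sup>2 \<partial>sample p) =
        (\<integral>x. (\<integral>y. (a (x i) y)\<^sup>2 \<partial>P) \<partial>PiM ({..<p} - {k}) (\<lambda>_. P))"
    using assms kernel_sample_product_integrable[of i p k i k]
    by (subst integral_PiM_insert_coordinate[where k = k])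
       (auto simp: power2_eq_square prob_space_axioms)
  also have "\<dots> = (\<integral>x. ?g x \<partial>distr (PiM ({..<p} - {k}) (\<lambda>_. P)) P (\<lambda>x. x i))"
    using assms by (subst integral_distr) auto
  also have "distr (PiM ({..<p} - {k}) (\<lambda>_. P)) P (\<lambda>x. x i) = P"
    using assms by (intro distr_PiM_component) (auto simp: prob_space_axioms)
  finally show ?thesis .
qed

text \<open>Expanding the square, an ordered pair correlates only with itself and with its swap. Hence each of
the \<open>p (p - 1)\<close> ordered pairs contributes twice the second moment of the kernel.\<close>

theorem second_moment_off_diagonal_sum:
  "(\<integral>x. (\<Sum>(i, k)\<in>off_diagonal p. a (x i) (x k))\<^sup>2 \<partial>sample p) =
     2 * real p * (real p - 1) * (\<integral>x. (\<integral>y. (a x y)\<^sup>2 \<partial>P) \<partial>P)"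
proof -
  let ?D = "off_diagonal p"
  define V where "V = (\<integral>x. (\<integral>y. (a x y)\<^sup>2 \<partial>P) \<partial>P)"
  define A where "A = (\<lambda>(q :: nat \<times> nat) x. a (x (fst q)) (x (snd q)))"
  have int: "integrable (sample p) (\<lambda>x. A q x * A r x)" if "q \<in> ?D" "r \<in> ?D" for q r
    using that unfolding A_def
    by (intro kernel_sample_product_integrable) (auto simp: off_diagonal_def)
  have cov: "(\<integral>x. A q x * A r x \<partial>sample p) = (if r \<in> {q, prod.swap q} then V else 0)"
    if q: "q \<in> ?D" and r: "r \<in> ?D" for q r
  proof (cases "r \<in> {q, prod.swap q}")
    case True
    then have "A r x = A q x" for x
      by (auto simp: A_def kernel_sym)
    then have "(\<integral>x. A q x * A r x \<partial>sample p) = V"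
      using q kernel_sample_square[of "fst q" p "snd q"]
      by (auto simp: A_def V_def off_diagonal_def power2_eq_square)
    then show ?thesis using True by simp
  next
    case False
    then show ?thesis
      using q r kernel_sample_orthogonal[of "fst q" "snd q" p "fst r" "snd r"]
      by (auto simp: A_def prod_eq_iff)
  qed
  have pair: "(\<Sum>r\<in>?D. if r \<in> {q, prod.swap q} then V else 0) = 2 * V" if q: "q \<in> ?D" for q
  proof -
    have "(\<Sum>r\<in>?D. if r \<in> {q, prod.swap q} then V else 0) = (\<Sum>r\<in>?D \<inter> {q, prod.swap q}. V)"
      by (rule sum.inter_restrict[symmetric]) simp
    also have "?D \<inter> {q, prod.swap q} = {q, prod.swap q}"
      using q by (auto simp: off_diagonal_def)
    also have "card {q, prod.swap q} = 2"
      using q by (cases q) (auto simp: off_diagonal_def)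
    then have "(\<Sum>r\<in>{q, prod.swap q}. V) = 2 * V"
      by simp
    finally show ?thesis .
  qed
  have "(\<integral>x. (\<Sum>(i, k)\<in>?D. a (x i) (x k))\<^sup>2 \<partial>sample p) =
        (\<integral>x. (\<Sum>q\<in>?D. \<Sum>r\<in>?D. A q x * A r x) \<partial>sample p)"
    by (simp add: power2_eq_square sum_product A_def case_prod_beta)
  also have "\<dots> = (\<Sum>q\<in>?D. \<Sum>r\<in>?D. (\<integral>x. A q x * A r x \<partial>sample p))"
    using int by (simp add: Bochner_Integration.integral_sum)
  also have "\<dots> = (\<Sum>q\<in>?D. 2 * V)"
    using cov pair by (simp cong: sum.cong)
  also have "\<dots> = 2 * real p * (real p - 1) * V"
    by (simp add: card_off_diagonal)
  finally show ?thesis by (simp add: V_def)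
qed

lemma mean_off_diagonal_sum:
  "(\<integral>x. (\<Sum>(i, k)\<in>off_diagonal p. a (x i) (x k)) \<partial>sample p) = 0"
proof -
  have "(\<integral>x. (\<Sum>(i, k)\<in>off_diagonal p. a (x i) (x k)) \<partial>sample p) =
        (\<Sum>(i, k)\<in>off_diagonal p. (\<integral>x. a (x i) (x k) \<partial>sample p))"
    unfolding case_prod_beta
    by (intro Bochner_Integration.integral_sum) (auto simp: off_diagonal_def intro: kernel_sample_integrable)
  also have "\<dots> = 0"
    by (intro sum.neutral) (auto simp: off_diagonal_def kernel_sample_mean)
  finally show ?thesis .
qed

end

section \<open>Moments of a self-normalized row\<close>

definition normalized :: "nat \<Rightarrow> (nat \<Rightarrow> real) \<Rightarrow> nat \<Rightarrow> real" where
  "normalized n x j = x j / sqrt (\<Sum>k<n. (x k)\<^sup>2)"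

text \<open>The value \<open>0\<close> for the zero row comes from division by zero; such rows form a null set below.\<close>

lemma sum_normalized_squares:
  "(\<Sum>j<n. (normalized n x j)\<^sup>2) = (if (\<Sum>k<n. (x k)\<^sup>2) = 0 then 0 else 1)"
proof -
  have "(\<Sum>j<n. (normalized n x j)\<^sup>2) = (\<Sum>j<n. (x j)\<^sup>2 / (\<Sum>k<n. (x k)\<^sup>2))"
    by (simp add: normalized_def power_divide sum_nonneg)
  then show ?thesis
    by (simp flip: sum_divide_distrib)
qed

lemma abs_normalized_le_1:
  assumes "j < n"
  shows "\<bar>normalized n x j\<bar> \<le> 1"
proof -
  have "(normalized n x j)\<^sup>2 \<le> (\<Sum>j<n. (normalized n x j)\<^sup>2)"
    using assms by (intro member_le_sum) auto
  also have "\<dots> \<le> 1"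
    by (simp add: sum_normalized_squares)
  finally show ?thesis
    by (simp add: abs_square_le_1)
qed

lemma abs_sum_normalized_le: "\<bar>\<Sum>j<n. normalized n x j * normalized n y j\<bar> \<le> real n"
proof -
  have "\<bar>\<Sum>j<n. normalized n x j * normalized n y j\<bar> \<le> (\<Sum>j<n. 1)"
    by (rule order_trans[OF sum_abs], intro sum_mono)
       (auto simp: abs_mult abs_normalized_le_1 intro!: mult_le_one)
  then show ?thesis by simp
qed

lemma bij_betw_transpose:
  "i < n \<Longrightarrow> j < n \<Longrightarrow> bij_betw (Transposition.transpose i j) {..<n} {..<(n :: nat)}"
  by (intro bij_betw_byWitness[where f' = "Transposition.transpose i j"])
     (auto simp: Transposition.transpose_def)

lemma normalized_reindex:
  assumes "bij_betw \<pi> {..<n} {..<n}" "j < n"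
  shows "normalized n (\<lambda>j\<in>{..<n}. x (\<pi> j)) j = normalized n x (\<pi> j)"
  using sum.reindex_bij_betw[OF assms(1), of "\<lambda>k. (x k)\<^sup>2"] assms(2)
  by (simp add: normalized_def)

lemma normalized_flip:
  "normalized n (x(c := - x c)) j = (if j = c then - 1 else 1) * normalized n x j"
proof -
  have "(\<Sum>k<n. ((x(c := - x c)) k)\<^sup>2) = (\<Sum>k<n. (x k)\<^sup>2)"
    by (intro sum.cong) auto
  then show ?thesis
    by (simp add: normalized_def)
qed

lemma integral_double_sum:
  fixes f :: "'i \<Rightarrow> 'j \<Rightarrow> 'b \<Rightarrow> real"
  assumes "\<And>i j. i \<in> A \<Longrightarrow> j \<in> B \<Longrightarrow> integrable M (f i j)"
  shows "(\<integral>x. (\<Sum>i\<in>A. \<Sum>j\<in>B. f i j x) \<partial>M) = (\<Sum>i\<in>A. \<Sum>j\<in>B. (\<integral>x. f i j x \<partial>M))"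
proof -
  have "(\<integral>x. (\<Sum>i\<in>A. \<Sum>j\<in>B. f i j x) \<partial>M) = (\<Sum>i\<in>A. (\<integral>x. (\<Sum>j\<in>B. f i j x) \<partial>M))"
    using assms by (intro Bochner_Integration.integral_sum Bochner_Integration.integrable_sum)
  also have "\<dots> = (\<Sum>i\<in>A. \<Sum>j\<in>B. (\<integral>x. f i j x \<partial>M))"
    using assms by (intro sum.cong refl Bochner_Integration.integral_sum)
  finally show ?thesis .
qed

lemma integral_quadruple_sum:
  fixes f :: "'i \<Rightarrow> 'i \<Rightarrow> 'i \<Rightarrow> 'i \<Rightarrow> 'b \<Rightarrow> real"
  assumes "\<And>i j k l. i \<in> A \<Longrightarrow> j \<in> A \<Longrightarrow> k \<in> A \<Longrightarrow> l \<in> A \<Longrightarrow> integrable M (f i j k l)"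
  shows "(\<integral>x. (\<Sum>i\<in>A. \<Sum>j\<in>A. \<Sum>k\<in>A. \<Sum>l\<in>A. f i j k l x) \<partial>M) =
         (\<Sum>i\<in>A. \<Sum>j\<in>A. \<Sum>k\<in>A. \<Sum>l\<in>A. (\<integral>x. f i j k l x \<partial>M))"
proof -
  have "(\<integral>x. (\<Sum>i\<in>A. \<Sum>j\<in>A. \<Sum>k\<in>A. \<Sum>l\<in>A. f i j k l x) \<partial>M) =
        (\<Sum>i\<in>A. \<Sum>j\<in>A. (\<integral>x. (\<Sum>k\<in>A. \<Sum>l\<in>A. f i j k l x) \<partial>M))"
    using assms by (intro integral_double_sum Bochner_Integration.integrable_sum)
  also have "\<dots> = (\<Sum>i\<in>A. \<Sum>j\<in>A. \<Sum>k\<in>A. \<Sum>l\<in>A. (\<integral>x. f i j k l x \<partial>M))"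
    using assms by (intro sum.cong refl integral_double_sum)
  finally show ?thesis .
qed

locale entry_law = prob_space Q for Q :: "real measure" +
  assumes sets_Q [measurable_cong]: "sets Q = sets borel"
    and nonzero: "AE x in Q. x \<noteq> 0"
begin

abbreviation row :: "nat \<Rightarrow> (nat \<Rightarrow> real) measure" where
  "row n \<equiv> PiM {..<n} (\<lambda>_. Q)"

definition beta :: "nat \<Rightarrow> real" where
  "beta n = (\<integral>x. (normalized n x 0) ^ 4 \<partial>row n)"

lemma space_Q [simp]: "space Q = UNIV"
  using sets_eq_imp_space_eq[OF sets_Q] by simp

lemma prob_space_row: "prob_space (row n)"
  by (intro prob_space_PiM prob_space_axioms)

lemma component_measurable:
  "j < n \<Longrightarrow> (\<lambda>x. x j) \<in> borel_measurable (row n)"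
  using measurable_component_singleton[of j "{..<n}" "\<lambda>_. Q"] by (simp cong: measurable_cong_sets add: sets_Q)

lemma sum_squares_measurable [measurable]:
  "(\<lambda>x. \<Sum>k<n. (x k)\<^sup>2) \<in> borel_measurable (row n)"
  by (intro borel_measurable_sum borel_measurable_power component_measurable) auto

lemma normalized_measurable:
  "j < n \<Longrightarrow> (\<lambda>x. normalized n x j) \<in> borel_measurable (row n)"
  unfolding normalized_def using component_measurable[of j n] by measurable

lemma AE_row_sum_squares_pos:
  assumes "0 < n"
  shows "AE x in row n. 0 < (\<Sum>k<n. (x k)\<^sup>2)"
proof -
  have "AE x in row n. x 0 \<noteq> 0"
    using AE_PiM_component[of "{..<n}" "\<lambda>_. Q" 0 "\<lambda>x. x \<noteq> 0"] assms nonzero prob_space_axioms by auto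
  then show ?thesis
  proof eventually_elim
    case (elim x)
    then show ?case using assms by (intro sum_pos2[of _ 0]) auto
  qed
qed

lemma AE_row_sum_normalized_squares:
  "0 < n \<Longrightarrow> AE x in row n. (\<Sum>j<n. (normalized n x j)\<^sup>2) = 1"
  using AE_row_sum_squares_pos[of n] by (auto simp: sum_normalized_squares elim: eventually_mono)

lemma integrable_row_bounded:
  fixes f :: "_ \<Rightarrow> real"
  assumes "f \<in> borel_measurable (row n)" "\<And>x. \<bar>f x\<bar> \<le> B"
  shows "integrable (row n) f"
proof -
  interpret row: prob_space "row n" by (rule prob_space_row)
  show ?thesis using assms by (intro row.integrable_const_bound[where B = B]) auto
qed

text \<open>Exchangeability of the entries of a row.\<close>

lemma integral_row_reindex:
  fixes f :: "_ \<Rightarrow> real"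
  assumes "bij_betw \<pi> {..<n} {..<n}" and [measurable]: "f \<in> borel_measurable (row n)"
  shows "(\<integral>x. f (\<lambda>j\<in>{..<n}. x (\<pi> j)) \<partial>row n) = (\<integral>x. f x \<partial>row n)"
proof -
  have "distr (row n) (row n) (\<lambda>x. \<lambda>j\<in>{..<n}. x (\<pi> j)) = row n"
    using assms(1) by (intro distr_PiM_reindex) (auto simp: bij_betw_def prob_space_axioms)
  moreover have "(\<lambda>x. \<lambda>j\<in>{..<n}. x (\<pi> j)) \<in> measurable (row n) (row n)"
    using assms(1)
    by (intro measurable_restrict measurable_component_singleton) (auto simp: bij_betw_def)
  ultimately show ?thesis
    using integral_distr[of "\<lambda>x. \<lambda>j\<in>{..<n}. x (\<pi> j)" "row n" "row n" f] assms(2) by simp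
qed

text \<open>The \<open>n\<close> squares have the same mean by exchangeability and add up to one.\<close>

lemma integral_normalized_square:
  assumes "j < n"
  shows "(\<integral>x. (normalized n x j)\<^sup>2 \<partial>row n) = 1 / real n"
proof -
  interpret row: prob_space "row n" by (rule prob_space_row)
  have sq_int: "integrable (row n) (\<lambda>x. (normalized n x l)\<^sup>2)" if "l < n" for l
    using that abs_normalized_le_1[OF that] normalized_measurable[OF that]
    by (intro integrable_row_bounded[where B = 1]) (auto simp: abs_square_le_1)
  have eq: "(\<integral>x. (normalized n x l)\<^sup>2 \<partial>row n) = (\<integral>x. (normalized n x j)\<^sup>2 \<partial>row n)" if "l < n" for l
  proof -
    have bij: "bij_betw (Transposition.transpose l j) {..<n} {..<n}"
    using that assms by (intro bij_betw_transpose) auto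
    show ?thesis
      using integral_row_reindex[OF bij, of "\<lambda>x. (normalized n x j)\<^sup>2"] normalized_measurable[OF assms]
      by (simp add: normalized_reindex[OF bij assms])
  qed
  have "real n * (\<integral>x. (normalized n x j)\<^sup>2 \<partial>row n) = (\<Sum>l<n. (\<integral>x. (normalized n x l)\<^sup>2 \<partial>row n))"
    by (simp add: eq)
  also have "\<dots> = (\<integral>x. (\<Sum>l<n. (normalized n x l)\<^sup>2) \<partial>row n)"
    using sq_int by (intro Bochner_Integration.integral_sum[symmetric]) auto
  also have "\<dots> = (\<integral>x. 1 \<partial>row n)"
    using AE_row_sum_normalized_squares[of n] assms normalized_measurable
    by (intro integral_cong_AE) auto
  finally show ?thesis using assms by (simp add: row.prob_space field_simps)
qed

lemma integral_normalized_fourth: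
  assumes "j < n"
  shows "(\<integral>x. (normalized n x j) ^ 4 \<partial>row n) = beta n"
proof -
  have n: "0 < n" using assms by simp
  have bij: "bij_betw (Transposition.transpose 0 j) {..<n} {..<n}"
    using assms by (intro bij_betw_transpose) auto
  show ?thesis
    using integral_row_reindex[OF bij, of "\<lambda>x. (normalized n x j) ^ 4"] normalized_measurable[OF assms]
    by (simp add: normalized_reindex[OF bij assms] beta_def)
qed

text \<open>The common value of the mixed moments \<open>E u\<^sub>j\<^sup>2 u\<^sub>l\<^sup>2\<close> for \<open>j \<noteq> l\<close>.\<close>

definition mixed :: "nat \<Rightarrow> real" where
  "mixed n = (1 / real n - beta n) / (real n - 1)"

text \<open>Multiplying \<open>\<Sum>k u\<^sub>k\<^sup>2 = 1\<close> by \<open>u\<^sub>j\<^sup>2\<close> and taking means gives \<open>1/n\<close> as the sum of \<open>\<beta>\<close> and of \<open>n - 1\<close> mixed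
moments, which are equal because transpositions that fix \<open>j\<close> preserve the law of the row.\<close>

lemma integral_normalized_mixed:
  assumes "j < n" "l < n" "j \<noteq> l"
  shows "(\<integral>x. (normalized n x j)\<^sup>2 * (normalized n x l)\<^sup>2 \<partial>row n) = mixed n"
proof -
  interpret row: prob_space "row n" by (rule prob_space_row)
  define g where "g k = (\<integral>x. (normalized n x j)\<^sup>2 * (normalized n x k)\<^sup>2 \<partial>row n)" for k
  have meas: "(\<lambda>x. (normalized n x j)\<^sup>2 * (normalized n x k)\<^sup>2) \<in> borel_measurable (row n)" if "k < n" for k
    using that assms(1) normalized_measurable by auto
  have int: "integrable (row n) (\<lambda>x. (normalized n x j)\<^sup>2 * (normalized n x k)\<^sup>2)" if "k < n" for k
    using that assms(1) meas[OF that] abs_normalized_le_1[of j n] abs_normalized_le_1[of k n]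
    by (intro integrable_row_bounded[where B = 1]) (auto simp: abs_mult abs_square_le_1 intro!: mult_le_one)
  have eq: "g k = g l" if "k \<in> {..<n} - {j}" for k
  proof -
    have bij: "bij_betw (Transposition.transpose k l) {..<n} {..<n}"
    using that assms by (intro bij_betw_transpose) auto
    have "Transposition.transpose k l j = j"
      using that assms by (auto simp: Transposition.transpose_def)
    then show ?thesis
      using integral_row_reindex[OF bij, OF meas[OF assms(2)]] assms
      by (simp add: normalized_reindex[OF bij] g_def)
  qed
  have gj: "g j = beta n"
    using integral_normalized_fourth[OF assms(1)] by (simp add: g_def flip: power_add)
  have "(\<Sum>k\<in>{..<n} - {j}. g k) = (\<Sum>k\<in>{..<n} - {j}. g l)"
    by (intro sum.cong refl eq)
  then have "beta n + (real n - 1) * g l = g j + (\<Sum>k\<in>{..<n} - {j}. g k)"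
    using assms by (simp add: gj of_nat_diff)
  also have "\<dots> = (\<Sum>k<n. g k)"
    using assms by (intro sum.remove[symmetric]) auto
  also have "\<dots> = (\<integral>x. (\<Sum>k<n. (normalized n x j)\<^sup>2 * (normalized n x k)\<^sup>2) \<partial>row n)"
    using int by (auto simp: g_def intro!: Bochner_Integration.integral_sum[symmetric])
  also have "\<dots> = (\<integral>x. (normalized n x j)\<^sup>2 \<partial>row n)"
    using AE_row_sum_normalized_squares[of n] assms normalized_measurable
    by (intro integral_cong_AE) (auto simp flip: sum_distrib_left)
  also have "\<dots> = 1 / real n"
    by (rule integral_normalized_square) fact
  finally have "(real n - 1) * g l = 1 / real n - beta n" by simp
  moreover have "real n - 1 \<noteq> 0"
    using assms by auto
  ultimately have "g l = mixed n"
    by (simp add: mixed_def nonzero_eq_divide_eq mult.commute)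
  then show ?thesis by (simp add: g_def)
qed

end

locale symmetric_entry_law = entry_law +
  assumes symmetric: "distr Q borel uminus = Q"
begin

text \<open>Symmetry of the entry law allows to change the sign of a single coordinate. This is what makes all
moments vanish in which some coordinate has an odd exponent.\<close>

lemma integral_row_flip:
  fixes f :: "_ \<Rightarrow> real"
  assumes c: "c < n" and [measurable]: "f \<in> borel_measurable (row n)"
  shows "(\<integral>x. f (x(c := - x c)) \<partial>row n) = (\<integral>x. f x \<partial>row n)"
proof -
  interpret product_sigma_finite "\<lambda>_. Q" by unfold_locales
  have meas_minus: "(\<lambda>x. - x c) \<in> measurable (row n) Q"
    using component_measurable[OF c] by (simp cong: measurable_cong_sets add: sets_Q)
  have flip [measurable]: "(\<lambda>x. x(c := - x c)) \<in> measurable (row n) (row n)"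
    using c meas_minus by (intro measurable_fun_upd[where J = "{..<n}"]) auto
  have "distr (row n) (row n) (\<lambda>x. x(c := - x c)) = row n"
  proof (rule PiM_eqI)
    fix A :: "nat \<Rightarrow> real set" assume A: "\<And>i. i \<in> {..<n} \<Longrightarrow> A i \<in> sets Q"
    define A' where "A' = A(c := uminus -` A c)"
    have Ac: "A c \<in> sets borel" using A c sets_Q by auto
    have "uminus -` A c \<in> sets borel"
      using measurable_sets[of uminus borel borel "A c"] Ac by simp
    then have A': "A' i \<in> sets Q" if "i < n" for i
      using A that by (auto simp: A'_def sets_Q)
    have "emeasure Q (uminus -` A c) = emeasure (distr Q borel uminus) (A c)"
      using Ac by (subst emeasure_distr) auto
    then have same: "emeasure Q (A' i) = emeasure Q (A i)" for i
      by (simp add: A'_def symmetric)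
    have "(\<lambda>x. x(c := - x c)) -` (Pi\<^sub>E {..<n} A) \<inter> space (row n) = Pi\<^sub>E {..<n} A'"
    proof (rule Set.set_eqI)
      fix x
      have "(x(c := - x c)) i \<in> A i \<longleftrightarrow> x i \<in> A' i" for i
        by (simp add: A'_def)
      moreover have "x(c := - x c) \<in> extensional {..<n}" if "x \<in> extensional {..<n}"
        unfolding extensional_def mem_Collect_eq
      proof (intro allI impI)
        fix i assume "i \<notin> {..<n}"
        then show "(x(c := - x c)) i = undefined"
          using c extensional_arb[OF that, of i] by (cases "i = c") simp_all
      qed
      ultimately show "x \<in> (\<lambda>x. x(c := - x c)) -` (Pi\<^sub>E {..<n} A) \<inter> space (row n) \<longleftrightarrow>
          x \<in> Pi\<^sub>E {..<n} A'"
        by (simp only: PiE_iff space_PiM space_Q vimage_eq Int_iff) blast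
    qed
    then have "emeasure (distr (row n) (row n) (\<lambda>x. x(c := - x c))) (Pi\<^sub>E {..<n} A) =
               emeasure (row n) (Pi\<^sub>E {..<n} A')"
      using A by (subst emeasure_distr) (auto intro!: sets_PiM_I_finite)
    also have "\<dots> = (\<Prod>i<n. emeasure Q (A' i))"
      using A' by (subst emeasure_PiM) auto
    finally show "emeasure (distr (row n) (row n) (\<lambda>x. x(c := - x c))) (Pi\<^sub>E {..<n} A) =
                  (\<Prod>i<n. emeasure Q (A i))"
      by (simp add: same)
  qed auto
  then show ?thesis
    using integral_distr[OF flip assms(2)] by simp
qed

lemma integral_normalized_mult:
  assumes "j < n" "l < n"
  shows "(\<integral>x. normalized n x j * normalized n x l \<partial>row n) = (if j = l then 1 / real n else 0)"
proof (cases "j = l")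
  case True
  then show ?thesis
    using integral_normalized_square[OF assms(1)] by (simp add: power2_eq_square)
next
  case False
  have "(\<lambda>x. normalized n x j * normalized n x l) \<in> borel_measurable (row n)"
    using assms normalized_measurable by auto
  from integral_row_flip[OF assms(1) this] False
  have "- (\<integral>x. normalized n x j * normalized n x l \<partial>row n) =
        (\<integral>x. normalized n x j * normalized n x l \<partial>row n)"
    by (simp only: normalized_flip) simp
  then show ?thesis using False by simp
qed

definition delta :: "nat \<Rightarrow> nat \<Rightarrow> real" where
  "delta i j = (if i = j then 1 else 0)"

text \<open>All fourth order moments in one formula. The three products of Kronecker symbols count the ways to
pair the four indices; all three of them are one when the indices coincide, which the last term
corrects.\<close>

lemma integral_normalized_four:
  assumes "i < n" "j < n" "k < n" "l < n"
  shows "(\<integral>x. normalized n x i * normalized n x j * normalized n x k * normalized n x l \<partial>row n) =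
     mixed n * (delta i j * delta k l + delta i k * delta j l + delta i l * delta j k)
     + (beta n - 3 * mixed n) * (delta i j * delta j k * delta k l)"
    (is "?E = ?R")
proof -
  let ?u = "normalized n"
  have meas: "(\<lambda>x. ?u x i * ?u x j * ?u x k * ?u x l) \<in> borel_measurable (row n)"
    using assms normalized_measurable by auto
  have flip: "(if i = c then - 1 else 1) * (if j = c then - 1 else 1) *
      (if k = c then - 1 else 1) * (if l = c then - 1 else 1) * ?E = ?E" if "c < n" for c
  proof -
    have "?E = (\<integral>x. (if i = c then - 1 else 1) * (if j = c then - 1 else 1) *
      (if k = c then - 1 else 1) * (if l = c then - 1 else 1) *
      (?u x i * ?u x j * ?u x k * ?u x l) \<partial>row n)"
      by (subst integral_row_flip[OF that meas, symmetric])
         (simp only: normalized_flip ac_simps)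
    then show ?thesis
      by (simp only: integral_mult_right_zero)
  qed
  consider "i = j \<and> j = k \<and> k = l" | "i = j \<and> k = l \<and> i \<noteq> k" | "i = k \<and> j = l \<and> i \<noteq> j"
    | "i = l \<and> j = k \<and> i \<noteq> j"
    | "\<not> (i = j \<and> k = l)" "\<not> (i = k \<and> j = l)" "\<not> (i = l \<and> j = k)"
    by blast
  then show ?thesis
  proof cases
    case 1
    then show ?thesis
      using integral_normalized_fourth[OF assms(1)]
      by (simp add: delta_def power4_eq_xxxx algebra_simps)
  next
    case 2
    then show ?thesis
      using integral_normalized_mixed[of i n k] assms
      by (simp add: delta_def power2_eq_square algebra_simps)
  next
    case 3
    then show ?thesis
      using integral_normalized_mixed[of i n j] assms
      by (simp add: delta_def power2_eq_square algebra_simps)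
  next
    case 4
    then show ?thesis
      using integral_normalized_mixed[of i n j] assms
      by (simp add: delta_def power2_eq_square algebra_simps)
  next
    case 5
    \<comment> \<open>an index that occurs an odd number of times among \<open>i, j, k, l\<close>\<close>
    define c where "c = (if i = j then if k = i then l else k else if i = k \<or> i = l then j else i)"
    have "c < n"
      using assms by (simp add: c_def)
    moreover have "(if i = c then - 1 else 1) * (if j = c then - 1 else 1) *
        (if k = c then - 1 else 1) * (if l = c then - 1 else 1) = (- 1 :: real)"
    proof (cases "i = j")
      case True
      then show ?thesis using 5 by (cases "k = i") (simp_all add: c_def)
    next
      case False
      then show ?thesis using 5 by (cases "i = k"; cases "i = l") (auto simp: c_def)
    qed
    ultimately have "- 1 * ?E = ?E"
      using flip[of c] by (simp only:)
    then have "?E = 0" by simp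
    moreover have "?R = 0"
      using 5 by (auto simp: delta_def)
    ultimately show ?thesis by simp
  qed
qed

text \<open>Squaring keeps the shape of the formula for the fourth moments: distinct pairings of the indices
overlap only if all indices are equal.\<close>

lemma sum_delta_squares:
  fixes g b :: real
  shows "(\<Sum>i<n. \<Sum>j<n. \<Sum>k<n. \<Sum>l<n.
      (g * (delta i j * delta k l + delta i k * delta j l + delta i l * delta j k)
       + (b - 3 * g) * (delta i j * delta j k * delta k l))\<^sup>2) =
     real n * b\<^sup>2 + 3 * real n * (real n - 1) * g\<^sup>2"
proof -
  have d1: "(\<Sum>j<n. delta i j) = 1" if "i < n" for i
    using that by (simp add: delta_def)
  have pw: "(g * (delta i j * delta k l + delta i k * delta j l + delta i l * delta j k)
       + (b - 3 * g) * (delta i j * delta j k * delta k l))\<^sup>2 =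
      g\<^sup>2 * (delta i j * delta k l) + g\<^sup>2 * (delta i k * delta j l) + g\<^sup>2 * (delta i l * delta j k)
       + (b\<^sup>2 - 3 * g\<^sup>2) * (delta i j * (delta j k * delta k l))" for i j k l
  proof -
    consider "i = j \<and> j = k \<and> k = l" | "i = j \<and> k = l \<and> i \<noteq> k" | "i = k \<and> j = l \<and> i \<noteq> j"
      | "i = l \<and> j = k \<and> i \<noteq> j"
      | "\<not> (i = j \<and> k = l)" "\<not> (i = k \<and> j = l)" "\<not> (i = l \<and> j = k)"
      by blast
    then show ?thesis
    proof cases
      case 5
      then have z: "delta i j * delta k l = 0" "delta i k * delta j l = 0" "delta i l * delta j k = 0"
        "delta i j * delta j k * delta k l = 0" "delta i j * (delta j k * delta k l) = 0"
        by (auto simp: delta_def)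
      show ?thesis by (simp only: z) simp
    qed (simp_all add: delta_def algebra_simps power2_eq_square)
  qed
  have s1: "(\<Sum>i<n. \<Sum>j<n. \<Sum>k<n. \<Sum>l<n. delta i j * delta k l) = real n * real n"
    by (simp add: d1 flip: sum_distrib_left)
  have s2: "(\<Sum>i<n. \<Sum>j<n. \<Sum>k<n. \<Sum>l<n. delta i k * delta j l) = real n * real n"
    by (simp add: d1 flip: sum_distrib_left)
  have s3: "(\<Sum>i<n. \<Sum>j<n. \<Sum>k<n. \<Sum>l<n. delta i l * delta j k) = real n * real n"
    by (simp add: d1 flip: sum_distrib_left sum_distrib_right)
  have s4: "(\<Sum>i<n. \<Sum>j<n. \<Sum>k<n. \<Sum>l<n. delta i j * (delta j k * delta k l)) = real n"
    by (simp add: d1 flip: sum_distrib_left)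
  have factor: "(\<Sum>i<n. \<Sum>j<n. \<Sum>k<n. \<Sum>l<n. c * f i j k l) =
      c * (\<Sum>i<n. \<Sum>j<n. \<Sum>k<n. \<Sum>l<n. f i j k l)" for c :: real and f
    by (simp add: sum_distrib_left)
  show ?thesis
    unfolding pw sum.distrib factor s1 s2 s3 s4 by (simp add: algebra_simps power2_eq_square)
qed

text \<open>Outside a null set this is the squared correlation of two rows minus its mean \<open>1/n\<close>. Multiplying
\<open>1/n\<close> by the squared norms, which are zero or one, makes the kernel degenerate at every point and
not only almost everywhere.\<close>

definition corr_kernel :: "nat \<Rightarrow> (nat \<Rightarrow> real) \<Rightarrow> (nat \<Rightarrow> real) \<Rightarrow> real" where
  "corr_kernel n x y = (\<Sum>j<n. normalized n x j * normalized n y j)\<^sup>2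
     - (\<Sum>j<n. (normalized n x j)\<^sup>2) * (\<Sum>j<n. (normalized n y j)\<^sup>2) / real n"

text \<open>The coordinates of a normalized row are uncorrelated with variance \<open>1/n\<close>.\<close>

lemma integral_squared_correlation:
  assumes "0 < n"
  shows "(\<integral>y. (\<Sum>j<n. c j * normalized n y j)\<^sup>2 \<partial>row n) = (\<Sum>j<n. (c j)\<^sup>2) / real n"
proof -
  let ?u = "normalized n"
  have int: "integrable (row n) (\<lambda>y. ?u y i * ?u y j)" if "i < n" "j < n" for i j
    using that abs_normalized_le_1[of i n] abs_normalized_le_1[of j n] normalized_measurable
    by (intro integrable_row_bounded[where B = 1]) (auto simp: abs_mult intro!: mult_le_one)
  have "(\<integral>y. (\<Sum>j<n. c j * ?u y j)\<^sup>2 \<partial>row n) =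
        (\<integral>y. (\<Sum>i<n. \<Sum>j<n. c i * c j * (?u y i * ?u y j)) \<partial>row n)"
    by (simp add: power2_eq_square sum_product ac_simps)
  also have "\<dots> = (\<Sum>i<n. \<Sum>j<n. c i * c j * (\<integral>y. ?u y i * ?u y j \<partial>row n))"
    using int by (subst integral_double_sum) auto
  also have "\<dots> = (\<Sum>i<n. \<Sum>j<n. if i = j then c i * c j / real n else 0)"
    by (intro sum.cong refl) (simp add: integral_normalized_mult)
  also have "\<dots> = (\<Sum>j<n. (c j)\<^sup>2) / real n"
    by (simp add: power2_eq_square sum_divide_distrib)
  finally show ?thesis .
qed

text \<open>Expanding the fourth power and averaging over the two independent rows turns every term into the
square of a fourth order moment of one row.\<close>

lemma integral_fourth_correlation:
  shows "(\<integral>x. (\<integral>y. (\<Sum>j<n. normalized n x j * normalized n y j) ^ 4 \<partial>row n) \<partial>row n) =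
         real n * (beta n)\<^sup>2 + 3 * real n * (real n - 1) * (mixed n)\<^sup>2"
proof -
  let ?u = "normalized n"
  let ?m = "\<lambda>i j k l. (\<integral>y. ?u y i * ?u y j * ?u y k * ?u y l \<partial>row n)"
  have int: "integrable (row n) (\<lambda>y. ?u y i * ?u y j * ?u y k * ?u y l)"
    if "i < n" "j < n" "k < n" "l < n" for i j k l
    using that abs_normalized_le_1[of i n] abs_normalized_le_1[of j n]
      abs_normalized_le_1[of k n] abs_normalized_le_1[of l n] normalized_measurable
    by (intro integrable_row_bounded[where B = 1]) (auto simp: abs_mult intro!: mult_le_one)
  have expand: "(\<Sum>j<n. c j) ^ 4 = (\<Sum>i<n. \<Sum>j<n. \<Sum>k<n. \<Sum>l<n. c i * c j * c k * c l)" for c :: "nat \<Rightarrow> real"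
  proof -
    have "(\<Sum>j<n. c j) ^ 4 = (\<Sum>i<n. c i) * ((\<Sum>i<n. c i) * ((\<Sum>i<n. c i) * (\<Sum>i<n. c i)))"
      by (simp add: power4_eq_xxxx ac_simps)
    also have "\<dots> = (\<Sum>i<n. c i * (\<Sum>j<n. c j * (\<Sum>k<n. c k * (\<Sum>l<n. c l))))"
      by (simp only: sum_distrib_right)
    finally show ?thesis
      by (simp only: sum_distrib_left mult.assoc)
  qed
  have "(\<integral>y. (\<Sum>j<n. ?u x j * ?u y j) ^ 4 \<partial>row n) =
      (\<Sum>i<n. \<Sum>j<n. \<Sum>k<n. \<Sum>l<n. ?m i j k l * (?u x i * ?u x j * ?u x k * ?u x l))" for x
  proof -
    have "(\<integral>y. (\<Sum>j<n. ?u x j * ?u y j) ^ 4 \<partial>row n) = (\<integral>y. (\<Sum>i<n. \<Sum>j<n. \<Sum>k<n. \<Sum>l<n.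
        (?u x i * ?u x j * ?u x k * ?u x l) * (?u y i * ?u y j * ?u y k * ?u y l)) \<partial>row n)"
      unfolding expand by (simp only: ac_simps)
    also have "\<dots> = (\<Sum>i<n. \<Sum>j<n. \<Sum>k<n. \<Sum>l<n. (?u x i * ?u x j * ?u x k * ?u x l) * ?m i j k l)"
      using int by (subst integral_quadruple_sum) auto
    finally show ?thesis by (simp only: mult.commute)
  qed
  then have "(\<integral>x. (\<integral>y. (\<Sum>j<n. ?u x j * ?u y j) ^ 4 \<partial>row n) \<partial>row n) =
      (\<integral>x. (\<Sum>i<n. \<Sum>j<n. \<Sum>k<n. \<Sum>l<n. ?m i j k l * (?u x i * ?u x j * ?u x k * ?u x l)) \<partial>row n)"
    by simp
  also have "\<dots> = (\<Sum>i<n. \<Sum>j<n. \<Sum>k<n. \<Sum>l<n. ?m i j k l * ?m i j k l)"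
    using int by (subst integral_quadruple_sum) auto
  also have "\<dots> = (\<Sum>i<n. \<Sum>j<n. \<Sum>k<n. \<Sum>l<n.
      (mixed n * (delta i j * delta k l + delta i k * delta j l + delta i l * delta j k)
       + (beta n - 3 * mixed n) * (delta i j * delta j k * delta k l))\<^sup>2)"
    by (intro sum.cong refl) (simp add: integral_normalized_four power2_eq_square)
  finally show ?thesis
    by (simp only: sum_delta_squares)
qed

lemma degenerate_corr_kernel:
  assumes n: "0 < n"
  shows "degenerate_kernel (row n) (corr_kernel n) ((real n)\<^sup>2 + 1)"
proof -
  interpret row: prob_space "row n" by (rule prob_space_row)
  let ?u = "normalized n"
  note [measurable] = normalized_measurable
  show ?thesis
  proof
    show "case_prod (corr_kernel n) \<in> borel_measurable (row n \<Otimes>\<^sub>M row n)"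
      unfolding corr_kernel_def case_prod_beta
      by (intro borel_measurable_diff borel_measurable_power borel_measurable_sum
          borel_measurable_times borel_measurable_divide borel_measurable_const
          measurable_compose[OF measurable_fst] measurable_compose[OF measurable_snd] normalized_measurable) auto
    show "\<bar>corr_kernel n x y\<bar> \<le> (real n)\<^sup>2 + 1" for x y
    proof -
      have "(\<Sum>j<n. ?u x j * ?u y j)\<^sup>2 \<le> (real n)\<^sup>2"
        using abs_sum_normalized_le[of n x y] by (simp flip: abs_le_square_iff)
      moreover have "(\<Sum>j<n. (?u x j)\<^sup>2) * (\<Sum>j<n. (?u y j)\<^sup>2) / real n \<in> {0..1}"
        using n by (auto simp: sum_normalized_squares)
      ultimately show ?thesis
        unfolding corr_kernel_def by (smt (verit) atLeastAtMost_iff zero_le_power2)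
    qed
    show "corr_kernel n x y = corr_kernel n y x" for x y
      by (simp add: corr_kernel_def mult.commute)
    show "(\<integral>y. corr_kernel n x y \<partial>row n) = 0" for x
    proof -
      have int1: "integrable (row n) (\<lambda>y. (\<Sum>j<n. ?u x j * ?u y j)\<^sup>2)"
      proof (rule integrable_row_bounded[where B = "(real n)\<^sup>2"])
        show "(\<lambda>y. (\<Sum>j<n. ?u x j * ?u y j)\<^sup>2) \<in> borel_measurable (row n)"
          by (intro borel_measurable_power borel_measurable_sum borel_measurable_times
              borel_measurable_const normalized_measurable) auto
        show "\<bar>(\<Sum>j<n. ?u x j * ?u y j)\<^sup>2\<bar> \<le> (real n)\<^sup>2" for y
          using abs_sum_normalized_le[of n x y] by (simp flip: abs_le_square_iff)
      qed
      have int2: "integrable (row n) (\<lambda>y. \<Sum>j<n. (?u y j)\<^sup>2)"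
        by (rule integrable_row_bounded[where B = 1])
           (auto intro!: borel_measurable_sum borel_measurable_power normalized_measurable
             simp: sum_normalized_squares)
      have "(\<integral>y. (\<Sum>j<n. (?u y j)\<^sup>2) \<partial>row n) = (\<integral>y. 1 \<partial>row n)"
        using AE_row_sum_normalized_squares[OF n]
        by (intro integral_cong_AE) (auto intro!: borel_measurable_sum borel_measurable_power normalized_measurable)
      then have "(\<integral>y. (\<Sum>j<n. (?u y j)\<^sup>2) \<partial>row n) = 1"
        by (simp add: row.prob_space)
      then show ?thesis
        using int1 int2 by (simp add: corr_kernel_def integral_squared_correlation[OF n])
    qed
  qed
qed

text \<open>For normalized rows the kernel is \<open>t\<^sup>2 - 1/n\<close> with \<open>t\<close> the scalar product, whose second moment is
\<open>1/n\<close>.\<close>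

lemma corr_kernel_second_moment:
  assumes n: "0 < n"
  shows "(\<integral>x. (\<integral>y. (corr_kernel n x y)\<^sup>2 \<partial>row n) \<partial>row n) =
         real n * (beta n)\<^sup>2 + 3 * real n * (real n - 1) * (mixed n)\<^sup>2 - 1 / (real n)\<^sup>2"
proof -
  interpret row: prob_space "row n" by (rule prob_space_row)
  let ?u = "normalized n"
  note bound = abs_sum_normalized_le[of n]
  have meas [measurable]: "(\<lambda>y. \<Sum>j<n. ?u x j * ?u y j) \<in> borel_measurable (row n)" for x
    by (intro borel_measurable_sum borel_measurable_times borel_measurable_const normalized_measurable) auto
  have int: "integrable (row n) (\<lambda>y. (\<Sum>j<n. ?u x j * ?u y j) ^ k)" for x k
    using bound[of x] by (intro integrable_row_bounded[where B = "real n ^ k"])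
      (auto simp: power_abs intro!: power_mono)
  have AE_one: "AE x in row n. (\<Sum>j<n. (?u x j)\<^sup>2) = 1"
    by (rule AE_row_sum_normalized_squares[OF n])
  have inner: "(\<integral>y. (corr_kernel n x y)\<^sup>2 \<partial>row n) =
      (\<integral>y. (\<Sum>j<n. ?u x j * ?u y j) ^ 4 \<partial>row n) - 1 / (real n)\<^sup>2"
    if x: "(\<Sum>j<n. (?u x j)\<^sup>2) = 1" for x
  proof -
    have "(\<integral>y. (corr_kernel n x y)\<^sup>2 \<partial>row n) =
        (\<integral>y. (\<Sum>j<n. ?u x j * ?u y j) ^ 4 - 2 / real n * (\<Sum>j<n. ?u x j * ?u y j)\<^sup>2 + 1 / (real n)\<^sup>2 \<partial>row n)"
    proof (rule integral_cong_AE)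
      show "AE y in row n. (corr_kernel n x y)\<^sup>2 =
          (\<Sum>j<n. ?u x j * ?u y j) ^ 4 - 2 / real n * (\<Sum>j<n. ?u x j * ?u y j)\<^sup>2 + 1 / (real n)\<^sup>2"
        using AE_one
      proof eventually_elim
        case (elim y)
        have "t ^ 4 - 2 / N * t\<^sup>2 + 1 / N\<^sup>2 = (t\<^sup>2 - 1 / N)\<^sup>2" for t N :: real
          by (simp add: power2_eq_square power4_eq_xxxx algebra_simps)
        then show ?case
          by (simp add: corr_kernel_def x elim)
      qed
    qed (auto simp: corr_kernel_def intro!: borel_measurable_sum borel_measurable_power normalized_measurable
          borel_measurable_diff borel_measurable_times borel_measurable_divide meas borel_measurable_const)
    also have "\<dots> = (\<integral>y. (\<Sum>j<n. ?u x j * ?u y j) ^ 4 \<partial>row n)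
        - 2 / real n * (\<integral>y. (\<Sum>j<n. ?u x j * ?u y j)\<^sup>2 \<partial>row n) + 1 / (real n)\<^sup>2"
      using int[of x 4] int[of x 2] by (simp add: row.prob_space)
    also have "(\<integral>y. (\<Sum>j<n. ?u x j * ?u y j)\<^sup>2 \<partial>row n) = 1 / real n"
      by (simp add: integral_squared_correlation[OF n] x)
    finally show ?thesis by (simp add: power2_eq_square)
  qed
  have meas4 [measurable]: "(\<lambda>x. \<integral>y. (\<Sum>j<n. ?u x j * ?u y j) ^ 4 \<partial>row n) \<in> borel_measurable (row n)"
    by (intro row.borel_measurable_lebesgue_integral, unfold case_prod_beta,
        intro borel_measurable_power borel_measurable_sum borel_measurable_times
          measurable_compose[OF measurable_fst] measurable_compose[OF measurable_snd] normalized_measurable) auto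
  interpret K: degenerate_kernel "row n" "corr_kernel n" "(real n)\<^sup>2 + 1"
    by (rule degenerate_corr_kernel[OF n])
  have "(\<integral>x. (\<integral>y. (corr_kernel n x y)\<^sup>2 \<partial>row n) \<partial>row n) =
        (\<integral>x. (\<integral>y. (\<Sum>j<n. ?u x j * ?u y j) ^ 4 \<partial>row n) - 1 / (real n)\<^sup>2 \<partial>row n)"
    using AE_one by (intro integral_cong_AE) (auto elim!: eventually_mono simp: inner)
  also have "\<dots> = (\<integral>x. (\<integral>y. (\<Sum>j<n. ?u x j * ?u y j) ^ 4 \<partial>row n) \<partial>row n) - 1 / (real n)\<^sup>2"
  proof -
    have "\<bar>\<integral>y. (\<Sum>j<n. ?u x j * ?u y j) ^ 4 \<partial>row n\<bar> \<le> real n ^ 4" for x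
    proof -
      have "\<bar>\<integral>y. (\<Sum>j<n. ?u x j * ?u y j) ^ 4 \<partial>row n\<bar> \<le> (\<integral>y. \<bar>(\<Sum>j<n. ?u x j * ?u y j) ^ 4\<bar> \<partial>row n)"
        by (rule integral_abs_bound)
      also have "\<dots> \<le> (\<integral>y. real n ^ 4 \<partial>row n)"
      proof (rule integral_mono)
        show "\<bar>(\<Sum>j<n. ?u x j * ?u y j) ^ 4\<bar> \<le> real n ^ 4" for y
          unfolding power_abs by (intro power_mono bound) auto
      qed (use int[of x 4] in auto)
      finally show ?thesis by (simp add: row.prob_space)
    qed
    then have "integrable (row n) (\<lambda>x. \<integral>y. (\<Sum>j<n. ?u x j * ?u y j) ^ 4 \<partial>row n)"
      by (intro integrable_row_bounded[where B = "real n ^ 4"]) auto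
    then show ?thesis by (simp add: row.prob_space)
  qed
  finally show ?thesis by (simp add: integral_fourth_correlation)
qed

end

section \<open>Conditioning on the other entries of a row\<close>

context entry_law
begin

text \<open>The function \<open>h\<^sub>r\<close> of the introduction.\<close>

definition ratio_moment :: "nat \<Rightarrow> real \<Rightarrow> real" where
  "ratio_moment r s = (\<integral>x. (x\<^sup>2 / (x\<^sup>2 + s)) ^ r \<partial>Q)"

definition laplace :: "real \<Rightarrow> real" where
  "laplace t = (\<integral>x. exp (- t * x\<^sup>2) \<partial>Q)"

lemma prob_UNIV [simp]: "prob UNIV = 1"
  using prob_space by simp

lemma measurable_Q_iff: "f \<in> measurable Q N \<longleftrightarrow> f \<in> measurable borel N"
  by (simp cong: measurable_cong_sets add: sets_Q)

lemma integrable_Q_bounded: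
  fixes f :: "real \<Rightarrow> real"
  assumes "f \<in> borel_measurable borel" "\<And>x. \<bar>f x\<bar> \<le> B"
  shows "integrable Q f"
  using assms by (intro integrable_const_bound[where B = B]) (auto simp: measurable_Q_iff)

lemma ratio_bounds:
  fixes x s :: real
  assumes "0 \<le> s"
  shows "0 \<le> x\<^sup>2 / (x\<^sup>2 + s)" "x\<^sup>2 / (x\<^sup>2 + s) \<le> 1"
proof -
  have nonneg: "0 \<le> x\<^sup>2 + s" using assms by simp
  then show "0 \<le> x\<^sup>2 / (x\<^sup>2 + s)" by simp
  show "x\<^sup>2 / (x\<^sup>2 + s) \<le> 1"
  proof (cases "x\<^sup>2 + s = 0")
    case False
    with nonneg have "0 < x\<^sup>2 + s" by linarith
    with assms show ?thesis by simp
  qed simp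
qed

lemma ratio_power_integrable:
  "0 \<le> s \<Longrightarrow> integrable Q (\<lambda>x. (x\<^sup>2 / (x\<^sup>2 + s)) ^ r)"
  using ratio_bounds[of s]
  by (intro integrable_Q_bounded[where B = 1]) (auto simp: abs_of_nonneg intro!: power_le_one)

lemma ratio_moment_nonneg: "0 \<le> s \<Longrightarrow> 0 \<le> ratio_moment r s"
  unfolding ratio_moment_def using ratio_bounds(1)[of s] by (intro Bochner_Integration.integral_nonneg) auto

lemma ratio_moment_le_1: "0 \<le> s \<Longrightarrow> ratio_moment r s \<le> 1"
proof -
  assume s: "0 \<le> s"
  have "ratio_moment r s \<le> (\<integral>x. 1 \<partial>Q)"
    unfolding ratio_moment_def using ratio_bounds[OF s] s
    by (intro integral_mono ratio_power_integrable) (auto intro!: power_le_one)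
  then show ?thesis by (simp add: prob_space)
qed

lemma ratio_moment_antimono:
  assumes "0 \<le> s" "s \<le> s'"
  shows "ratio_moment r s' \<le> ratio_moment r s"
  unfolding ratio_moment_def
proof (rule integral_mono)
  fix x :: real
  show "(x\<^sup>2 / (x\<^sup>2 + s')) ^ r \<le> (x\<^sup>2 / (x\<^sup>2 + s)) ^ r"
  proof (cases "x = 0")
    case False
    then have "x\<^sup>2 / (x\<^sup>2 + s') \<le> x\<^sup>2 / (x\<^sup>2 + s)"
      using assms by (intro divide_left_mono mult_pos_pos) (auto intro: add_pos_nonneg)
    then show ?thesis
      using assms ratio_bounds(1)[of s' x] by (intro power_mono) auto
  qed (simp add: power_0_left)
qed (use assms ratio_power_integrable in auto)

lemma sum_squares_nonneg: "0 \<le> (\<Sum>k<(m :: nat). (x k :: real)\<^sup>2)"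
  by (simp add: sum_nonneg)

lemma ratio_moment_row_measurable:
  "(\<lambda>x. ratio_moment r (\<Sum>k<m. (x k)\<^sup>2)) \<in> borel_measurable (row m)"
proof -
  have [measurable]: "(\<lambda>z. snd z) \<in> borel_measurable (row m \<Otimes>\<^sub>M Q)"
    using measurable_snd[of "row m" Q] by (simp cong: measurable_cong_sets add: sets_Q)
  have [measurable]: "(\<lambda>z. \<Sum>k<m. (fst z k)\<^sup>2) \<in> borel_measurable (row m \<Otimes>\<^sub>M Q)"
    by (rule measurable_compose[OF measurable_fst sum_squares_measurable])
  show ?thesis
    unfolding ratio_moment_def
    by (intro borel_measurable_lebesgue_integral) (simp add: case_prod_beta)
qed

lemma integrable_row_ratio_moment:
  "integrable (row m) (\<lambda>x. ratio_moment r (\<Sum>k<m. (x k)\<^sup>2))"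
  using ratio_moment_nonneg[OF sum_squares_nonneg] ratio_moment_le_1[OF sum_squares_nonneg]
  by (intro integrable_row_bounded[where B = 1] ratio_moment_row_measurable) (auto simp: abs_of_nonneg)

text \<open>Integrating the last coordinate first, with the others fixed, produces \<open>ratio_moment r\<close> at the sum
of the other squares.\<close>

lemma integral_normalized_even_power:
  "(\<integral>x. (normalized (Suc m) x m) ^ (2 * r) \<partial>row (Suc m)) =
   (\<integral>x. ratio_moment r (\<Sum>k<m. (x k)\<^sup>2) \<partial>row m)"
proof -
  have meas: "(\<lambda>x. (normalized (Suc m) x m) ^ (2 * r)) \<in> borel_measurable (row (Suc m))"
    using normalized_measurable[of m "Suc m"] by auto
  have "\<bar>(normalized (Suc m) x m) ^ (2 * r)\<bar> \<le> 1" for x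
    using abs_normalized_le_1[of m "Suc m" x] by (simp add: power_abs power_le_one)
  then have int: "integrable (row (Suc m)) (\<lambda>x. (normalized (Suc m) x m) ^ (2 * r))"
    by (rule integrable_row_bounded[OF meas])
  have eq: "(normalized (Suc m) (x(m := y)) m) ^ (2 * r) = (y\<^sup>2 / (y\<^sup>2 + (\<Sum>k<m. (x k)\<^sup>2))) ^ r" for x y
  proof -
    have "(\<Sum>k<Suc m. ((x(m := y)) k)\<^sup>2) = y\<^sup>2 + (\<Sum>k<m. (x k)\<^sup>2)"
      by (simp add: sum.lessThan_Suc)
    moreover have "0 \<le> y\<^sup>2 + (\<Sum>k<m. (x k)\<^sup>2)"
      by (simp add: sum_nonneg)
    ultimately have "(normalized (Suc m) (x(m := y)) m)\<^sup>2 = y\<^sup>2 / (y\<^sup>2 + (\<Sum>k<m. (x k)\<^sup>2))"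
      unfolding normalized_def by (simp only: power_divide real_sqrt_pow2) simp
    then show ?thesis by (simp add: power_mult)
  qed
  have "{..<Suc m} - {m} = {..<m}" by auto
  then show ?thesis
    using integral_PiM_insert_coordinate[OF prob_space_axioms _ _ int, of m]
    by (simp add: eq ratio_moment_def)
qed

lemma beta_eq_ratio_moment:
  "beta (Suc m) = (\<integral>x. ratio_moment 2 (\<Sum>k<m. (x k)\<^sup>2) \<partial>row m)"
  using integral_normalized_even_power[of m 2] integral_normalized_fourth[of m "Suc m"] by simp

lemma integral_ratio_moment_1:
  "(\<integral>x. ratio_moment 1 (\<Sum>k<m. (x k)\<^sup>2) \<partial>row m) = 1 / real (Suc m)"
  using integral_normalized_even_power[of m 1] integral_normalized_square[of m "Suc m"] by simp

lemma beta_nonneg: "0 \<le> beta n"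
  unfolding beta_def by (intro Bochner_Integration.integral_nonneg) auto

section \<open>Lower tail of the sum of squares\<close>

lemma laplace_integrable: "0 \<le> t \<Longrightarrow> integrable Q (\<lambda>x. exp (- t * x\<^sup>2))"
  by (intro integrable_Q_bounded[where B = 1]) auto

text \<open>The integrand is smaller than one almost surely, because an entry vanishes with probability zero only.\<close>

lemma laplace_less_1:
  assumes "0 < t"
  shows "laplace t < 1"
proof -
  have int: "integrable Q (\<lambda>x. 1 - exp (- t * x\<^sup>2))"
    using assms laplace_integrable[of t] by simp
  have nonneg: "0 \<le> (\<integral>x. 1 - exp (- t * x\<^sup>2) \<partial>Q)"
    using assms by (intro Bochner_Integration.integral_nonneg) auto
  have "(\<integral>x. 1 - exp (- t * x\<^sup>2) \<partial>Q) \<noteq> 0"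
  proof
    assume "(\<integral>x. 1 - exp (- t * x\<^sup>2) \<partial>Q) = 0"
    then have "AE x in Q. 1 - exp (- t * x\<^sup>2) = 0"
      using integral_nonneg_eq_0_iff_AE[OF int] assms by auto
    with nonzero have "AE x in Q. False"
      by eventually_elim (use assms in auto)
    then show False using AE_False by simp
  qed
  with nonneg have "0 < (\<integral>x. 1 - exp (- t * x\<^sup>2) \<partial>Q)" by simp
  also have "\<dots> = 1 - laplace t"
    using assms laplace_integrable[of t] by (simp add: laplace_def prob_space)
  finally show ?thesis by simp
qed

lemma laplace_pos: "0 \<le> t \<Longrightarrow> 0 < laplace t"
proof -
  assume t: "0 \<le> t"
  have "0 \<le> laplace t" unfolding laplace_def by (intro Bochner_Integration.integral_nonneg) auto
  moreover have "laplace t \<noteq> 0"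
  proof
    assume "laplace t = 0"
    then have "AE x in Q. exp (- t * x\<^sup>2) = 0"
      using integral_nonneg_eq_0_iff_AE[OF laplace_integrable[OF t]] by (auto simp: laplace_def)
    then show False using AE_False by simp
  qed
  ultimately show ?thesis by simp
qed

lemma integral_exp_sum_squares:
  assumes "0 \<le> t"
  shows "(\<integral>x. exp (- t * (\<Sum>k<m. (x k)\<^sup>2)) \<partial>row m) = laplace t ^ m"
proof -
  interpret product_sigma_finite "\<lambda>_. Q" by unfold_locales
  have "(\<integral>x. exp (- t * (\<Sum>k<m. (x k)\<^sup>2)) \<partial>row m) = (\<integral>x. (\<Prod>k<m. exp (- t * (x k)\<^sup>2)) \<partial>row m)"
    by (simp add: sum_distrib_left exp_sum flip: sum_negf)
  also have "\<dots> = (\<Prod>k<m. laplace t)"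
    unfolding laplace_def using laplace_integrable[OF assms] by (intro product_integral_prod) auto
  finally show ?thesis by simp
qed

text \<open>Chernoff bound: compare the indicator of the event with \<open>exp (t (c - S))\<close>.\<close>

lemma prob_sum_squares_le:
  assumes t: "0 \<le> t"
  shows "measure (row m) {x \<in> space (row m). (\<Sum>k<m. (x k)\<^sup>2) \<le> c} \<le> exp (t * c) * laplace t ^ m"
proof -
  interpret row: prob_space "row m" by (rule prob_space_row)
  let ?A = "{x \<in> space (row m). (\<Sum>k<m. (x k)\<^sup>2) \<le> c}"
  have A [measurable]: "?A \<in> sets (row m)" by measurable
  have le_1: "exp (- t * (\<Sum>k<m. (x k)\<^sup>2)) \<le> 1" for x :: "nat \<Rightarrow> real"
    using t sum_squares_nonneg[of x m] by simp
  have int: "integrable (row m) (\<lambda>x. exp (t * c) * exp (- t * (\<Sum>k<m. (x k)\<^sup>2)))"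
    using le_1 by (intro integrable_mult_right integrable_row_bounded[where B = 1]) auto
  have "measure (row m) ?A = (\<integral>x. indicator ?A x \<partial>row m)"
    using A by simp
  also have "\<dots> \<le> (\<integral>x. exp (t * c) * exp (- t * (\<Sum>k<m. (x k)\<^sup>2)) \<partial>row m)"
  proof (intro integral_mono int)
    show "integrable (row m) (indicator ?A :: _ \<Rightarrow> real)"
      by (rule integrable_row_bounded[where B = 1]) (auto simp: indicator_def)
    fix x
    have "1 \<le> exp (t * (c - (\<Sum>k<m. (x k)\<^sup>2)))" if "(\<Sum>k<m. (x k)\<^sup>2) \<le> c"
      using that t by simp
    then show "indicator ?A x \<le> exp (t * c) * exp (- t * (\<Sum>k<m. (x k)\<^sup>2))"
      by (auto simp: indicator_def algebra_simps simp flip: exp_add)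
  qed
  also have "\<dots> = exp (t * c) * laplace t ^ m"
    using integral_exp_sum_squares[OF t, of m] by simp
  finally show ?thesis .
qed

lemma beta_le_ratio_moment_plus_prob:
  assumes "0 \<le> c"
  shows "beta (Suc m) \<le> ratio_moment 2 c + measure (row m) {x \<in> space (row m). (\<Sum>k<m. (x k)\<^sup>2) \<le> c}"
proof -
  interpret row: prob_space "row m" by (rule prob_space_row)
  let ?A = "{x \<in> space (row m). (\<Sum>k<m. (x k)\<^sup>2) \<le> c}"
  have A [measurable]: "?A \<in> sets (row m)" by measurable
  have indA: "integrable (row m) (indicator ?A :: _ \<Rightarrow> real)"
    by (rule integrable_row_bounded[where B = 1]) (auto simp: indicator_def)
  have "beta (Suc m) \<le> (\<integral>x. ratio_moment 2 c + indicator ?A x \<partial>row m)"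
    unfolding beta_eq_ratio_moment
  proof (intro integral_mono integrable_row_ratio_moment Bochner_Integration.integrable_add indA)
    fix x assume "x \<in> space (row m)"
    then show "ratio_moment 2 (\<Sum>k<m. (x k)\<^sup>2) \<le> ratio_moment 2 c + indicator ?A x"
      using ratio_moment_antimono[OF assms, of "\<Sum>k<m. (x k)\<^sup>2" 2]
        ratio_moment_le_1[OF sum_squares_nonneg[of x m], of 2] ratio_moment_nonneg[OF assms, of 2]
      by (auto simp: indicator_def not_le)
  qed auto
  also have "\<dots> = ratio_moment 2 c + measure (row m) ?A"
    using indA A by (simp add: row.prob_space)
  finally show ?thesis .
qed

text \<open>The ratio moments are decreasing, so \<open>h\<^sub>2(S) \<le> h\<^sub>2(r n)\<close> unless \<open>S \<le> r n\<close>, where \<open>h\<^sub>2 \<le> 1\<close> suffices.\<close>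

lemma beta_le_ratio_moment_plus_geometric:
  assumes t: "0 < t" and r: "0 < r"
  shows "beta (Suc m) \<le> ratio_moment 2 (r * real (Suc m)) + exp (t * r) * (exp (t * r) * laplace t) ^ m"
proof -
  have "exp (t * (r * real (Suc m))) * laplace t ^ m = exp (t * r) * (exp (t * r) * laplace t) ^ m"
    by (simp add: power_mult_distrib algebra_simps flip: exp_of_nat_mult exp_add)
  then show ?thesis
    using beta_le_ratio_moment_plus_prob[of "r * real (Suc m)" m]
      prob_sum_squares_le[of t m "r * real (Suc m)"] t r by simp
qed

text \<open>Jensen's inequality for the convex function \<open>s \<mapsto> h\<^sub>2(s)\<close> at the mean \<open>m\<close> of the sum of squares. It is
obtained by integrating a tangent line, since for fixed \<open>z\<close> the function \<open>s \<mapsto> (z/(z + s))\<^sup>2\<close> is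
convex.\<close>

lemma ratio_moment_le_beta:
  assumes int: "integrable Q (\<lambda>x. x\<^sup>2)" and mean: "(\<integral>x. x\<^sup>2 \<partial>Q) = 1" and m: "0 < m"
  shows "ratio_moment 2 (real m) \<le> beta (Suc m)"
proof -
  interpret row: prob_space "row m" by (rule prob_space_row)
  define g where "g = (\<lambda>x :: real. 2 * (x\<^sup>2)\<^sup>2 / (x\<^sup>2 + real m) ^ 3)"
  define D where "D = (\<integral>x. g x \<partial>Q)"
  have tangent: "(z / (z + \<mu>))\<^sup>2 - 2 * z\<^sup>2 / (z + \<mu>) ^ 3 * (s - \<mu>) \<le> (z / (z + s))\<^sup>2"
    if "0 \<le> z" "0 < \<mu>" "0 \<le> s" for z \<mu> s :: real
  proof (cases "z = 0")
    case False
    define A B where "A = z + s" and "B = z + \<mu>"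
    have pos: "0 < A" "0 < B" "0 < z"
      using that False by (auto simp: A_def B_def)
    \<comment> \<open>the tangent inequality \<open>1/A\<^sup>2 \<ge> 3/B\<^sup>2 - 2A/B\<^sup>3\<close> after clearing denominators\<close>
    have "0 \<le> (B - A)\<^sup>2 * (B + 2 * A)"
      using pos by simp
    also have "\<dots> = B ^ 3 - (3 * B - 2 * A) * A\<^sup>2"
      by (simp add: algebra_simps power2_eq_square power3_eq_cube)
    finally have "(3 * B - 2 * A) / B ^ 3 \<le> 1 / A\<^sup>2"
      using pos by (simp add: divide_simps mult.commute)
    then have "z\<^sup>2 * ((3 * B - 2 * A) / B ^ 3) \<le> z\<^sup>2 * (1 / A\<^sup>2)"
      by (intro mult_left_mono) auto
    moreover have "z\<^sup>2 * ((3 * B - 2 * A) / B ^ 3) = (z / B)\<^sup>2 - 2 * z\<^sup>2 / B ^ 3 * (A - B)"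
      using pos by (simp add: field_simps power2_eq_square power3_eq_cube)
    ultimately show ?thesis
      by (simp add: A_def B_def power_divide)
  qed simp
  have bound: "\<bar>g x\<bar> \<le> 2" for x :: real
  proof -
    have "(x\<^sup>2)\<^sup>2 / (x\<^sup>2 + real m) ^ 3 = (x\<^sup>2 / (x\<^sup>2 + real m))\<^sup>2 * (1 / (x\<^sup>2 + real m))"
      by (simp add: power2_eq_square power3_eq_cube)
    also have "\<dots> \<le> 1 * 1"
      using m ratio_bounds[of "real m" x]
      by (intro mult_mono power_le_one) (auto simp: divide_le_eq_1 add_increasing)
    finally show ?thesis using m by (simp add: g_def abs_of_nonneg)
  qed
  have "g \<in> borel_measurable borel" unfolding g_def by measurable
  then have g_int: "integrable Q g"
    using bound by (rule integrable_Q_bounded)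
  have below: "ratio_moment 2 (real m) - D * (s - real m) \<le> ratio_moment 2 s" if s: "0 \<le> s" for s
  proof -
    have "ratio_moment 2 (real m) - D * (s - real m) =
        (\<integral>x. (x\<^sup>2 / (x\<^sup>2 + real m))\<^sup>2 - g x * (s - real m) \<partial>Q)"
      unfolding ratio_moment_def D_def
      using g_int ratio_power_integrable[of "real m" 2] by simp
    also have "\<dots> \<le> ratio_moment 2 s"
      unfolding ratio_moment_def
    proof (rule integral_mono)
      show "(x\<^sup>2 / (x\<^sup>2 + real m))\<^sup>2 - g x * (s - real m) \<le> (x\<^sup>2 / (x\<^sup>2 + s))\<^sup>2" for x
        using tangent[of "x\<^sup>2" "real m" s] m s by (simp add: g_def)
    qed (use g_int s ratio_power_integrable in auto)
    finally show ?thesis .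
  qed
  have comp_int: "integrable (row m) (\<lambda>x. (x k)\<^sup>2)" and comp_mean: "(\<integral>x. (x k)\<^sup>2 \<partial>row m) = 1" if "k < m" for k
  proof -
    have dist: "distr (row m) Q (\<lambda>x. x k) = Q"
      using that prob_space_axioms by (intro distr_PiM_component) auto
    have meas: "(\<lambda>x. x k) \<in> measurable (row m) Q"
      using that by (intro measurable_component_singleton) auto
    have sq: "(\<lambda>x. x\<^sup>2) \<in> borel_measurable Q" by (simp add: measurable_Q_iff)
    show "integrable (row m) (\<lambda>x. (x k)\<^sup>2)"
      using integrable_distr[OF meas, of "\<lambda>x. x\<^sup>2"] int dist by simp
    show "(\<integral>x. (x k)\<^sup>2 \<partial>row m) = 1"
      using integral_distr[OF meas sq] mean dist by simp
  qed
  have sum_int: "integrable (row m) (\<lambda>x. \<Sum>k<m. (x k)\<^sup>2)"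
    using comp_int by (intro Bochner_Integration.integrable_sum) auto
  have "(\<integral>x. (\<Sum>k<m. (x k)\<^sup>2) \<partial>row m) = real m"
    using comp_int comp_mean by (subst Bochner_Integration.integral_sum) auto
  then have "ratio_moment 2 (real m) =
      (\<integral>x. ratio_moment 2 (real m) - D * ((\<Sum>k<m. (x k)\<^sup>2) - real m) \<partial>row m)"
    using sum_int by (simp add: row.prob_space)
  also have "\<dots> \<le> beta (Suc m)"
    unfolding beta_eq_ratio_moment
    using sum_int below[OF sum_squares_nonneg]
    by (intro integral_mono integrable_row_ratio_moment Bochner_Integration.integrable_diff
        integrable_mult_right) auto
  finally show ?thesis .
qed

text \<open>The Laplace transform of the squared entry has slope \<open>-1\<close> at zero, and \<open>exp (- t r)\<close> has the larger
slope \<open>- r\<close>. Together with the Chernoff bound this makes \<open>S \<le> r n\<close> exponentially unlikely.\<close>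

lemma laplace_less_exp:
  assumes int: "integrable Q (\<lambda>x. x\<^sup>2)" and mean: "(\<integral>x. x\<^sup>2 \<partial>Q) = 1" and r: "r < 1"
  obtains t where "0 < t" "laplace t < exp (- t * r)"
proof -
  have "((\<lambda>t. \<integral>x. (1 - exp (- t * x\<^sup>2)) / t \<partial>Q) \<longlongrightarrow> (\<integral>x. x\<^sup>2 \<partial>Q)) (at_right 0)"
  proof (rule tendsto_at_right_sequentially[where b = 1])
    fix S :: "nat \<Rightarrow> real"
    assume S: "\<And>n. 0 < S n" "\<And>n. S n < 1" "decseq S" "S \<longlonglongrightarrow> 0"
    show "(\<lambda>n. \<integral>x. (1 - exp (- S n * x\<^sup>2)) / S n \<partial>Q) \<longlonglongrightarrow> (\<integral>x. x\<^sup>2 \<partial>Q)"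
    proof (rule integral_dominated_convergence[where w = "\<lambda>x. x\<^sup>2"])
      show "AE x in Q. (\<lambda>n. (1 - exp (- S n * x\<^sup>2)) / S n) \<longlonglongrightarrow> x\<^sup>2"
      proof (rule AE_I2)
        fix x :: real
        have "((\<lambda>t. (1 - exp (- t * x\<^sup>2)) / t) \<longlongrightarrow> x\<^sup>2) (at_right 0)"
          by real_asymp
        moreover have "filterlim S (at_right 0) sequentially"
          using S by (intro tendsto_imp_filterlim_at_right always_eventually) auto
        ultimately show "(\<lambda>n. (1 - exp (- S n * x\<^sup>2)) / S n) \<longlonglongrightarrow> x\<^sup>2"
          by (rule filterlim_compose)
      qed
      show "AE x in Q. norm ((1 - exp (- S n * x\<^sup>2)) / S n) \<le> x\<^sup>2" for n
      proof (rule AE_I2)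
        fix x :: real
        have "1 - S n * x\<^sup>2 \<le> exp (- S n * x\<^sup>2)"
          using exp_ge_add_one_self[of "- S n * x\<^sup>2"] by simp
        then show "norm ((1 - exp (- S n * x\<^sup>2)) / S n) \<le> x\<^sup>2"
          using S(1)[of n] by (simp add: abs_of_nonneg divide_simps mult.commute)
      qed
    qed (use int in \<open>auto simp: measurable_Q_iff\<close>)
  qed simp
  moreover have "((\<lambda>t. (1 - exp (- t * r)) / t) \<longlongrightarrow> r) (at_right 0)"
    by real_asymp
  ultimately have "((\<lambda>t. (\<integral>x. (1 - exp (- t * x\<^sup>2)) / t \<partial>Q) - (1 - exp (- t * r)) / t) \<longlongrightarrow> 1 - r) (at_right 0)"
    unfolding mean by (intro tendsto_diff)
  then have "\<forall>\<^sub>F t in at_right 0. 0 < (\<integral>x. (1 - exp (- t * x\<^sup>2)) / t \<partial>Q) - (1 - exp (- t * r)) / t"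
    using r by (intro order_tendstoD) auto
  moreover have "\<forall>\<^sub>F t in at_right 0. 0 < (t :: real)"
    by (rule eventually_at_right_less)
  ultimately obtain t where t: "0 < t"
      and less: "0 < (\<integral>x. (1 - exp (- t * x\<^sup>2)) / t \<partial>Q) - (1 - exp (- t * r)) / t"
    by (metis (mono_tags, lifting) eventually_conj eventually_happens' trivial_limit_at_right_real)
  have "(\<integral>x. (1 - exp (- t * x\<^sup>2)) / t \<partial>Q) = (1 - laplace t) / t"
    using t laplace_integrable[of t] by (simp add: laplace_def prob_space)
  with less t have "laplace t < exp (- t * r)"
    by (simp add: divide_simps)
  with t show thesis by (rule that)
qed

end

section \<open>Monotone functions of regular variation\<close>

text \<open>Doubling the argument \<open>k\<close> times, with \<open>k\<close> the least number such that \<open>2\<^sup>k y \<ge> 1\<close>, leads from \<open>s y\<close> past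
\<open>s\<close>; monotonicity bridges the remaining gap at the price of one more factor \<open>2\<^sup>q\<close>.\<close>

lemma potter_lower:
  fixes H :: "real \<Rightarrow> real"
  assumes mono: "\<And>x y. x \<le> y \<Longrightarrow> H y \<le> H x"
    and H_nonneg: "\<And>x. 0 \<le> H x"
    and s0: "0 < s0" and q: "0 \<le> q"
    and step: "\<And>s. s0 \<le> s \<Longrightarrow> H s \<le> 2 powr q * H (2 * s)"
    and y: "0 < y" "y \<le> 1" "s0 \<le> s * y"
  shows "H (s * y) \<le> 2 powr q * y powr (- q) * H s"
proof -
  have iter: "H x \<le> 2 powr (q * real k) * H (2 ^ k * x)" if "s0 \<le> x" for k x
  proof (induction k)
    case (Suc k)
    have "s0 \<le> 2 ^ k * x"
      using that s0 mult_mono[of 1 "2 ^ k" s0 x] by simp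
    then have "H (2 ^ k * x) \<le> 2 powr q * H (2 ^ Suc k * x)"
      using step[of "2 ^ k * x"] by (simp add: mult.assoc)
    then have "2 powr (q * real k) * H (2 ^ k * x) \<le> 2 powr (q * real k) * (2 powr q * H (2 ^ Suc k * x))"
      by (intro mult_left_mono) auto
    with Suc have "H x \<le> 2 powr (q * real k) * (2 powr q * H (2 ^ Suc k * x))"
      by (rule order_trans)
    then show ?case by (simp add: powr_add algebra_simps)
  qed simp
  define k where "k = nat \<lceil>log 2 (1 / y)\<rceil>"
  have log_nonneg: "0 \<le> log 2 (1 / y)"
    using y by (simp add: divide_simps)
  have k: "log 2 (1 / y) \<le> real k" "real k \<le> log 2 (1 / y) + 1"
    using log_nonneg by (auto simp: k_def)
  have "1 / y = 2 powr (log 2 (1 / y))"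
    using y by simp
  also have "\<dots> \<le> 2 powr real k"
    using k by (intro powr_mono) auto
  finally have "1 \<le> 2 ^ k * y"
    using y by (simp add: powr_realpow divide_simps)
  moreover have "0 < s"
    using s0 y by (metis less_le_trans zero_less_mult_pos2)
  ultimately have "s \<le> 2 ^ k * (s * y)"
    using mult_left_mono[of 1 "2 ^ k * y" s] by (simp add: ac_simps)
  then have "H (2 ^ k * (s * y)) \<le> H s"
    by (rule mono)
  have "2 powr (q * real k) \<le> 2 powr (q * (log 2 (1 / y) + 1))"
    using k q by (intro powr_mono mult_left_mono) auto
  also have "\<dots> = (2 powr log 2 (1 / y)) powr q * 2 powr q"
    by (simp add: powr_powr powr_add algebra_simps)
  also have "2 powr log 2 (1 / y) = 1 / y"
    using y by simp
  also have "(1 / y) powr q * 2 powr q = 2 powr q * y powr (- q)"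
    using y by (simp add: powr_divide powr_minus divide_simps)
  finally have k_le: "2 powr (q * real k) \<le> 2 powr q * y powr (- q)" .
  have "H (s * y) \<le> 2 powr (q * real k) * H (2 ^ k * (s * y))"
    using iter y by simp
  also have "\<dots> \<le> (2 powr q * y powr (- q)) * H s"
    using k_le \<open>H (2 ^ k * (s * y)) \<le> H s\<close> H_nonneg
    by (intro mult_mono) auto
  finally show ?thesis by simp
qed

text \<open>The counterpart of the preceding bound, with the largest \<open>k\<close> such that \<open>2\<^sup>k s0 \<le> s\<close>.\<close>

lemma potter_upper:
  fixes H :: "real \<Rightarrow> real"
  assumes mono: "\<And>x y. x \<le> y \<Longrightarrow> H y \<le> H x"
    and H_nonneg: "\<And>x. 0 \<le> H x"
    and s0: "0 < s0" and q: "0 \<le> q"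
    and step: "\<And>s. s0 \<le> s \<Longrightarrow> H (2 * s) \<le> 2 powr (- q) * H s"
    and s: "s0 \<le> s"
  shows "H s \<le> 2 powr q * (s / s0) powr (- q) * H s0"
proof -
  have iter: "H (2 ^ k * s0) \<le> 2 powr (- q * real k) * H s0" for k
  proof (induction k)
    case (Suc k)
    have "s0 \<le> 2 ^ k * s0"
      using s0 by simp
    then have "H (2 ^ Suc k * s0) \<le> 2 powr (- q) * H (2 ^ k * s0)"
      using step[of "2 ^ k * s0"] by (simp add: mult.assoc)
    also have "\<dots> \<le> 2 powr (- q) * (2 powr (- q * real k) * H s0)"
      using Suc by (intro mult_left_mono) auto
    finally show ?case by (simp add: algebra_simps flip: powr_add)
  qed simp
  define k where "k = nat \<lfloor>log 2 (s / s0)\<rfloor>"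
  have log_nonneg: "0 \<le> log 2 (s / s0)"
    using s s0 by simp
  have k: "real k \<le> log 2 (s / s0)" "log 2 (s / s0) - 1 \<le> real k"
    using log_nonneg by (auto simp: k_def)
  have "2 ^ k \<le> s / s0"
  proof -
    have "2 ^ k = 2 powr real k" by (simp add: powr_realpow)
    also have "\<dots> \<le> 2 powr log 2 (s / s0)" using k by (intro powr_mono) auto
    finally show ?thesis using s s0 by simp
  qed
  then have "H s \<le> H (2 ^ k * s0)"
    using s0 by (intro mono) (simp add: divide_simps)
  also have "\<dots> \<le> 2 powr (- q * real k) * H s0"
    by (rule iter)
  finally have H_le: "H s \<le> 2 powr (- q * real k) * H s0" .
  have "2 powr (- q * real k) \<le> 2 powr (- q * (log 2 (s / s0) - 1))"
    using k q by (intro powr_mono) (auto intro: mult_left_mono)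
  also have "\<dots> = (2 powr log 2 (s / s0)) powr (- q) * 2 powr q"
    by (simp add: powr_powr algebra_simps flip: powr_add)
  also have "2 powr log 2 (s / s0) = s / s0"
    using s s0 by simp
  finally have "2 powr (- q * real k) * H s0 \<le> (s / s0) powr (- q) * 2 powr q * H s0"
    using H_nonneg[of s0] by (rule mult_right_mono)
  with H_le show ?thesis by (simp add: ac_simps)
qed

section \<open>Ratio moments and regularly varying tails\<close>

context entry_law
begin

definition tail :: "real \<Rightarrow> real" where
  "tail s = prob {x. s < x\<^sup>2}"

lemma tail_antimono: "s \<le> s' \<Longrightarrow> tail s' \<le> tail s"
  unfolding tail_def by (intro finite_measure_mono) (auto simp: sets_Q)

lemma tail_nonneg: "0 \<le> tail s"
  by (simp add: tail_def)

lemma tail_le_1: "tail s \<le> 1"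
  by (simp add: tail_def)

lemma tail_measurable [measurable]: "tail \<in> borel_measurable borel"
proof -
  have "(\<lambda>s. - tail s) \<in> borel_measurable borel"
    by (intro borel_measurable_mono) (auto simp: mono_def tail_antimono)
  then show ?thesis by simp
qed

text \<open>For \<open>V = x\<^sup>2/(x\<^sup>2 + s)\<close>, which lies in \<open>[0, 1)\<close>, write \<open>V\<^sup>r\<close> as the integral of \<open>r u\<^sup>r\<^sup>-\<^sup>1\<close> over \<open>0 < u < V\<close>
and exchange the integrals; the condition \<open>u < V\<close> means \<open>s u/(1 - u) < x\<^sup>2\<close>. The variable \<open>u\<close> in the unit
interval makes the limit below a Beta integral without any substitution.\<close>

lemma ratio_moment_layer_cake:
  assumes s: "0 < s" and r: "0 < r"
  shows "ratio_moment r s =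
    (\<integral>u. indicator {0<..<1} u * (real r * u ^ (r - 1) * tail (s * (u / (1 - u)))) \<partial>lborel)"
proof -
  define V where "V = (\<lambda>x :: real. x\<^sup>2 / (x\<^sup>2 + s))"
  define f where "f = (\<lambda>x u :: real. indicator {0<..<1} u * (real r * u ^ (r - 1)) * indicator {v. v < V x} u)"
  interpret pair_sigma_finite Q lborel by unfold_locales
  have V: "0 \<le> V x" "V x < 1" for x
    using s by (auto simp: V_def divide_less_eq add_nonneg_pos add_pos_nonneg)
  have V_meas [measurable]: "V \<in> borel_measurable borel"
    unfolding V_def by measurable
  have f_meas: "case_prod f \<in> borel_measurable (Q \<Otimes>\<^sub>M lborel)"
  proof -
    have [measurable]: "fst \<in> borel_measurable (Q \<Otimes>\<^sub>M (lborel :: real measure))"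
      using measurable_fst[of Q "lborel :: real measure"] by (simp cong: measurable_cong_sets add: sets_Q)
    have [measurable]: "snd \<in> borel_measurable (Q \<Otimes>\<^sub>M (lborel :: real measure))"
      using measurable_snd[of Q "lborel :: real measure"] by (simp cong: measurable_cong_sets)
    have "case_prod f = (\<lambda>z. indicator {0<..<1} (snd z) * (real r * snd z ^ (r - 1)) *
        (if snd z < V (fst z) then 1 else 0))"
      by (auto simp: f_def fun_eq_iff indicator_def)
    then show ?thesis by simp
  qed
  have f_int: "integrable (Q \<Otimes>\<^sub>M lborel) (case_prod f)"
  proof (rule integrableI_bounded_set[where A = "UNIV \<times> {0<..<1}" and B = "real r"])
    show "UNIV \<times> {0<..<1} \<in> sets (Q \<Otimes>\<^sub>M (lborel :: real measure))"
      by (intro pair_measureI) (auto simp: sets_Q)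
    show "emeasure (Q \<Otimes>\<^sub>M (lborel :: real measure)) (UNIV \<times> {0<..<1}) < \<infinity>"
      by (subst lborel.emeasure_pair_measure_Times) (auto simp: sets_Q emeasure_eq_measure)
    have "\<bar>u ^ (r - 1)\<bar> \<le> 1" if "0 < u" "u < 1" for u :: real
      using that by (simp add: power_abs power_le_one)
    then show "AE z in Q \<Otimes>\<^sub>M lborel. z \<in> UNIV \<times> {0<..<1} \<longrightarrow> norm (case_prod f z) \<le> real r"
      using r by (auto simp: f_def indicator_def abs_mult intro!: mult_left_le)
    show "AE z in Q \<Otimes>\<^sub>M lborel. z \<notin> UNIV \<times> {0<..<1} \<longrightarrow> case_prod f z = 0"
      by (auto simp: f_def case_prod_beta)
  qed (rule f_meas)
  have inner_u: "(\<integral>u. f x u \<partial>lborel) = V x ^ r" for x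
  proof -
    have "(\<integral>u. f x u \<partial>lborel) = (\<integral>u. real r * (u ^ (r - 1) * indicator {0..V x} u) \<partial>lborel)"
    proof (rule integral_cong_AE)
      show "AE u in lborel. f x u = real r * (u ^ (r - 1) * indicator {0..V x} u)"
        using AE_lborel_singleton[of 0] AE_lborel_singleton[of "V x"]
        by eventually_elim (use V[of x] in \<open>auto simp: f_def indicator_def\<close>)
    qed (auto simp: f_def)
    also have "\<dots> = V x ^ r"
      using V(1)[of x] r by (simp add: integral_power)
    finally show ?thesis .
  qed
  have inner_x: "(\<integral>x. f x u \<partial>Q) = indicator {0<..<1} u * (real r * u ^ (r - 1) * tail (s * (u / (1 - u))))" for u
  proof (cases "u \<in> {0<..<1}")
    case True
    have "u < V x \<longleftrightarrow> s * (u / (1 - u)) < x\<^sup>2" for x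
    proof -
      have "0 < x\<^sup>2 + s" using s by (simp add: add_nonneg_pos)
      then show ?thesis
        using True by (simp add: V_def divide_simps) (simp add: algebra_simps)
    qed
    then have "(\<integral>x. f x u \<partial>Q) = (\<integral>x. (real r * u ^ (r - 1)) * indicator {x. s * (u / (1 - u)) < x\<^sup>2} x \<partial>Q)"
      using True by (intro Bochner_Integration.integral_cong) (auto simp: f_def indicator_def)
    also have "\<dots> = real r * u ^ (r - 1) * tail (s * (u / (1 - u)))"
      by (simp add: tail_def)
    finally show ?thesis using True by simp
  qed (simp add: f_def)
  have "ratio_moment r s = (\<integral>x. (\<integral>u. f x u \<partial>lborel) \<partial>Q)"
    by (simp add: ratio_moment_def inner_u V_def)
  also have "\<dots> = (\<integral>u. (\<integral>x. f x u \<partial>Q) \<partial>lborel)"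
    by (rule Fubini_integral[symmetric]) (rule f_int)
  finally show ?thesis by (simp add: inner_x)
qed

end

text \<open>The tail of the squared entry is regularly varying with index \<open>-a\<close>; in terms of the entry itself the
index is \<open>\<alpha> = 2a\<close>.\<close>

locale regularly_varying_law = entry_law +
  fixes a :: real
  assumes index_pos: "0 < a"
    and tail_pos: "\<And>s. 0 < tail s"
    and tail_regularly_varying: "\<And>t. 0 < t \<Longrightarrow> ((\<lambda>s. tail (t * s) / tail s) \<longlongrightarrow> t powr (- a)) at_top"
begin

text \<open>Regular variation along the factor \<open>2\<close> supplies the hypothesis of \<open>potter_lower\<close> beyond some \<open>s0\<close>. For
\<open>s y < s0\<close> the tail at \<open>s y\<close> is bounded by one, which costs the constant \<open>1 / tail s0\<close>.\<close>

lemma tail_potter: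
  assumes q: "a < q"
  obtains C s0 where "0 < C" "0 < s0"
    "\<And>s y. s0 \<le> s \<Longrightarrow> 0 < y \<Longrightarrow> y \<le> 1 \<Longrightarrow> tail (s * y) \<le> C * y powr (- q) * tail s"
proof -
  have "2 powr (- q) < 2 powr (- a)"
    using q by simp
  then have "\<forall>\<^sub>F s in at_top. 2 powr (- q) < tail (2 * s) / tail s"
    using tail_regularly_varying[of 2] by (intro order_tendstoD) auto
  then obtain s1 where s1: "\<And>s. s1 \<le> s \<Longrightarrow> 2 powr (- q) < tail (2 * s) / tail s"
    by (auto simp: eventually_at_top_linorder)
  define s0 where "s0 = max 1 s1"
  have s0: "0 < s0" by (simp add: s0_def)
  have step: "tail s \<le> 2 powr q * tail (2 * s)" if "s0 \<le> s" for s
    using s1[of s] that tail_pos[of s] by (simp add: s0_def powr_minus divide_simps mult.commute)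
  have q0: "0 \<le> q" using q index_pos by simp
  note potter = potter_lower[where H = tail, OF tail_antimono tail_nonneg s0 q0 step]
  define C where "C = 2 powr q / tail s0"
  have C: "2 powr q \<le> C"
    using tail_pos[of s0] tail_le_1[of s0] by (simp add: C_def divide_simps)
  show thesis
  proof (rule that[of C s0])
    show "0 < C" using tail_pos by (simp add: C_def)
    fix s y :: real assume sy: "s0 \<le> s" "0 < y" "y \<le> 1"
    show "tail (s * y) \<le> C * y powr (- q) * tail s"
    proof (cases "s0 \<le> s * y")
      case True
      have "tail (s * y) \<le> 2 powr q * y powr (- q) * tail s"
        using potter[of y s] sy True by simp
      also have "\<dots> \<le> C * y powr (- q) * tail s"
        using C tail_nonneg by (intro mult_right_mono) auto
      finally show ?thesis .
    next
      case False
      have "tail s0 \<le> 2 powr q * (s0 / s) powr (- q) * tail s"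
        using potter[of "s0 / s" s] sy s0 by simp
      also have "\<dots> \<le> 2 powr q * y powr (- q) * tail s"
        using False sy s0 q0 tail_nonneg
        by (intro mult_right_mono mult_left_mono powr_mono2') (auto simp: divide_simps mult.commute)
      finally have "1 \<le> C * y powr (- q) * tail s"
        using tail_pos[of s0] by (simp add: C_def divide_simps)
      then show ?thesis
        using tail_le_1[of "s * y"] by linarith
    qed
  qed (rule s0)
qed

text \<open>Apply the Potter bound with \<open>y = s0/s\<close>, so that its left-hand side is constant.\<close>

lemma tail_ge_power:
  assumes q: "a < q"
  obtains c where "0 < c" "\<forall>\<^sub>F s in at_top. c * s powr (- q) \<le> tail s"
proof -
  obtain C s0 where C: "0 < C" "0 < s0"
    and potter: "\<And>s y. s0 \<le> s \<Longrightarrow> 0 < y \<Longrightarrow> y \<le> 1 \<Longrightarrow> tail (s * y) \<le> C * y powr (- q) * tail s"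
    using tail_potter[OF q] by blast
  show thesis
  proof (rule that[of "tail s0 / C * s0 powr q"])
    show "0 < tail s0 / C * s0 powr q"
      using C tail_pos[of s0] by simp
    show "\<forall>\<^sub>F s in at_top. tail s0 / C * s0 powr q * s powr (- q) \<le> tail s"
      using eventually_ge_at_top[of s0]
    proof eventually_elim
      case (elim s)
      then have "tail s0 \<le> C * (s0 / s) powr (- q) * tail s"
        using potter[of s "s0 / s"] C by simp
      then show ?case
        using C elim by (simp add: powr_divide powr_minus divide_simps mult_ac)
    qed
  qed
qed

text \<open>For \<open>q'\<close> strictly between \<open>q\<close> and \<open>a\<close>, the bound \<open>potter_upper\<close> shows that the tail is at most a constant
times \<open>s\<^sup>-\<^sup>q\<^sup>'\<close>.\<close>

lemma tail_le_power:
  assumes q: "0 \<le> q" "q < a"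
  shows "((\<lambda>s. s powr q * tail s) \<longlongrightarrow> 0) at_top"
proof -
  define q' where "q' = (q + a) / 2"
  have q': "0 \<le> q'" "q < q'" "q' < a" using q by (auto simp: q'_def)
  then have "2 powr (- a) < 2 powr (- q')"
    by simp
  then have "\<forall>\<^sub>F s in at_top. tail (2 * s) / tail s < 2 powr (- q')"
    using tail_regularly_varying[of 2] by (intro order_tendstoD) auto
  then obtain s1 where s1: "\<And>s. s1 \<le> s \<Longrightarrow> tail (2 * s) / tail s < 2 powr (- q')"
    by (auto simp: eventually_at_top_linorder)
  define s0 where "s0 = max 1 s1"
  have s0: "0 < s0" by (simp add: s0_def)
  have step: "tail (2 * s) \<le> 2 powr (- q') * tail s" if "s0 \<le> s" for s
    using s1[of s] that tail_pos[of s] by (simp add: s0_def divide_simps)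
  define K where "K = 2 powr q' * s0 powr q' * tail s0"
  have le: "s powr q * tail s \<le> K * s powr (q - q')" if "s0 \<le> s" for s
  proof -
    have "tail s \<le> 2 powr q' * (s / s0) powr (- q') * tail s0"
      by (rule potter_upper[where H = tail, OF tail_antimono tail_nonneg s0 q'(1) step that])
    also have "\<dots> = K * s powr (- q')"
      using s0 that by (simp add: K_def powr_divide powr_minus divide_simps)
    finally have "s powr q * tail s \<le> s powr q * (K * s powr (- q'))"
      by (intro mult_left_mono) auto
    then show ?thesis by (simp add: powr_diff powr_minus divide_simps mult_ac)
  qed
  have "((\<lambda>s. K * s powr (q - q')) \<longlongrightarrow> K * 0) at_top"
    using q' by (intro tendsto_mult tendsto_const tendsto_neg_powr filterlim_ident) auto
  then have "((\<lambda>s. K * s powr (q - q')) \<longlongrightarrow> 0) at_top" by simp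
  then show ?thesis
  proof (rule tendsto_sandwich[rotated 3, OF _ , where f = "\<lambda>_. 0"])
    show "\<forall>\<^sub>F s in at_top. s powr q * tail s \<le> K * s powr (q - q')"
      using eventually_ge_at_top[of s0] by eventually_elim (rule le)
  qed (auto simp: tail_nonneg)
qed

text \<open>The number of integers \<open>n \<ge> 0\<close> below \<open>x\<^sup>2\<close> is at least \<open>x\<^sup>2\<close>, so the second moment is bounded by the
series of \<open>tail n\<close>, which converges like the series of \<open>n\<^sup>-\<^sup>q\<close> for some \<open>q > 1\<close>.\<close>

lemma second_moment_finite:
  assumes "1 < a"
  shows "integrable Q (\<lambda>x. x\<^sup>2)"
proof -
  obtain q where q: "1 < q" "q < a" using dense assms by blast
  have "((\<lambda>s. s powr q * tail s) \<longlongrightarrow> 0) at_top"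
    using q by (intro tail_le_power) auto
  then have "(\<lambda>n. real n powr q * tail (real n)) \<longlonglongrightarrow> 0"
    by (rule filterlim_compose[OF _ filterlim_real_sequentially])
  then have "\<forall>\<^sub>F n in sequentially. real n powr q * tail (real n) < 1"
    by (rule order_tendstoD) simp
  then have "\<forall>\<^sub>F n in sequentially. norm (tail (real n)) \<le> real n powr (- q)"
    using eventually_gt_at_top[of 0]
    by eventually_elim (simp add: tail_nonneg powr_minus divide_simps mult.commute)
  then have "summable (\<lambda>n. tail (real n))"
    by (rule summable_comparison_test_ev) (use q in \<open>simp add: summable_real_powr_iff\<close>)
  then have fin: "(\<Sum>n. ennreal (tail (real n))) < \<infinity>"
    by (simp add: suminf_ennreal2 tail_nonneg)
  have pointwise: "ennreal (x\<^sup>2) \<le> (\<Sum>n. indicator {x. real n < x\<^sup>2} x)" for x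
  proof -
    define k where "k = nat \<lceil>x\<^sup>2\<rceil>"
    have "x\<^sup>2 \<le> real k" by (simp add: k_def)
    then have "ennreal (x\<^sup>2) \<le> ennreal (real k)" by (rule ennreal_leI)
    also have "\<dots> = (\<Sum>n<k. indicator {x. real n < x\<^sup>2} x)"
    proof -
      have "real n < x\<^sup>2" if "n < k" for n
        using that unfolding k_def by linarith
      then have "(\<Sum>n<k. indicator {x. real n < x\<^sup>2} x) = (\<Sum>n<k. 1 :: ennreal)"
        by (intro sum.cong) auto
      then show ?thesis by (simp add: ennreal_of_nat_eq_real_of_nat)
    qed
    also have "\<dots> \<le> (\<Sum>n. indicator {x. real n < x\<^sup>2} x)"
      by (rule sum_le_suminf) auto
    finally show ?thesis .
  qed
  have "(\<integral>\<^sup>+x. ennreal (x\<^sup>2) \<partial>Q) \<le> (\<integral>\<^sup>+x. (\<Sum>n. indicator {x. real n < x\<^sup>2} x) \<partial>Q)"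
    using pointwise by (intro nn_integral_mono) auto
  also have "\<dots> = (\<Sum>n. ennreal (tail (real n)))"
    by (subst nn_integral_suminf)
      (auto simp: tail_def emeasure_eq_measure measurable_Q_iff sets_Q nn_integral_indicator)
  finally show ?thesis
    using fin by (intro integrableI_bounded) (auto simp: measurable_Q_iff)
qed

text \<open>Divide the layer cake formula by \<open>tail s\<close> and let \<open>s\<close> tend to infinity under the integral. For
\<open>y = u/(1 - u) > 1\<close> the quotient of tails is at most one by monotonicity, and for \<open>y \<le> 1\<close> it is at most
\<open>C y\<^sup>-\<^sup>q \<le> C u\<^sup>-\<^sup>q\<close> by the Potter bound; the latter is integrable against \<open>u\<^sup>r\<^sup>-\<^sup>1\<close> if \<open>q < r\<close>.\<close>

lemma ratio_moment_tail_limit: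
  assumes r: "a < real r"
  shows "((\<lambda>s. ratio_moment r s / tail s) \<longlongrightarrow> real r * Beta (real r - a) (1 + a)) at_top"
proof -
  have r0: "0 < r" using r index_pos by (cases r) auto
  obtain q where q: "a < q" "q < real r" using dense r by blast
  obtain C s0 where C: "0 < C" "0 < s0"
    and potter: "\<And>s y. s0 \<le> s \<Longrightarrow> 0 < y \<Longrightarrow> y \<le> 1 \<Longrightarrow> tail (s * y) \<le> C * y powr (- q) * tail s"
    using tail_potter[OF q(1)] by blast
  define F where "F = (\<lambda>s u. indicator {0<..<1} u *
     (real r * u ^ (r - 1) * (tail (s * (u / (1 - u))) / tail s)) :: real)"
  define G where "G = (\<lambda>u :: real. indicator {0<..<1} u * (real r * u ^ (r - 1) * (u / (1 - u)) powr (- a)))"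
  \<comment> \<open>the factor \<open>(1 - u) powr 0\<close> puts the integrable majorant in the form of a Beta integrand\<close>
  define w where "w = (\<lambda>u :: real. indicator {0<..<1} u *
     (real r * (1 + C * (u powr (real r - q - 1) * (1 - u) powr (1 - 1)))))"
  have pow: "u ^ (r - 1) = u powr (real r - 1)" if "0 < u" for u :: real
    using that r0 by (simp add: powr_realpow[symmetric] of_nat_diff)
  have beta_restrict: "integrable lborel (\<lambda>u. indicator {0<..<1} u * (u powr (x - 1) * (1 - u) powr (y - 1)))"
       "(\<integral>u. indicator {0<..<1} u * (u powr (x - 1) * (1 - u) powr (y - 1)) \<partial>lborel) = Beta x y"
    if xy: "0 < x" "0 < y" for x y :: real
  proof -
    let ?b = "\<lambda>u :: real. u powr (x - 1) * (1 - u) powr (y - 1)"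
    have int: "set_integrable lborel {0..1} ?b"
      by (rule integrable_Beta[OF xy])
    have AE: "AE u in lborel. indicator {0..1} u *\<^sub>R ?b u = indicator {0<..<1} u * ?b u"
      using AE_lborel_singleton[of 0] AE_lborel_singleton[of 1]
      by eventually_elim (auto simp: indicator_def)
    show "integrable lborel (\<lambda>u. indicator {0<..<1} u * ?b u)"
      using int unfolding set_integrable_def
      by (rule integrable_cong_AE_imp) (use AE in auto)
    have "(\<integral>u. indicator {0<..<1} u * ?b u \<partial>lborel) = (LBINT u:{0..1}. ?b u)"
      unfolding set_lebesgue_integral_def using AE by (intro integral_cong_AE) auto
    also have "\<dots> = integral {0..1} ?b"
      using int by (rule set_borel_integral_eq_integral(2))
    also have "\<dots> = Beta x y"
      by (rule integral_unique[OF has_integral_Beta_real[OF xy]])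
    finally show "(\<integral>u. indicator {0<..<1} u * ?b u \<partial>lborel) = Beta x y" .
  qed
  have "((\<lambda>s. \<integral>u. F s u \<partial>lborel) \<longlongrightarrow> (\<integral>u. G u \<partial>lborel)) at_top"
  proof (rule integral_dominated_convergence_at_top[where w = w])
    show "G \<in> borel_measurable lborel" unfolding G_def by measurable
    show "F s \<in> borel_measurable lborel" for s unfolding F_def by measurable
    have "integrable lborel (indicator {0<..<1} :: real \<Rightarrow> real)"
      by (rule integrable_real_indicator) (auto simp: emeasure_lborel_Ioo)
    then have "integrable lborel (\<lambda>u. real r * indicator {0<..<1} u +
        real r * C * (indicator {0<..<1} u * (u powr (real r - q - 1) * (1 - u) powr (1 - 1))))"
      using beta_restrict(1)[of "real r - q" 1] q by simp
    moreover have "w = (\<lambda>u. real r * indicator {0<..<1} u +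
        real r * C * (indicator {0<..<1} u * (u powr (real r - q - 1) * (1 - u) powr (1 - 1))))"
      by (auto simp: w_def fun_eq_iff indicator_def algebra_simps)
    ultimately show "integrable lborel w" by simp
    show "AE u in lborel. ((\<lambda>s. F s u) \<longlongrightarrow> G u) at_top"
    proof (rule AE_I2)
      fix u :: real
      show "((\<lambda>s. F s u) \<longlongrightarrow> G u) at_top"
      proof (cases "u \<in> {0<..<1}")
        case True
        then have "((\<lambda>s. tail (u / (1 - u) * s) / tail s) \<longlongrightarrow> (u / (1 - u)) powr (- a)) at_top"
          by (intro tail_regularly_varying) auto
        then show ?thesis
          unfolding F_def G_def by (intro tendsto_mult tendsto_const) (simp add: mult.commute)
      qed (simp add: F_def G_def)
    qed
    show "\<forall>\<^sub>F s in at_top. AE u in lborel. norm (F s u) \<le> w u"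
      using eventually_ge_at_top[of s0]
    proof eventually_elim
      case (elim s)
      have s: "0 < s" using elim C by simp
      have "norm (F s u) \<le> w u" for u
      proof (cases "u \<in> {0<..<1}")
        case True
        then have u: "0 < u" "u < 1" by auto
        define y where "y = u / (1 - u)"
        have y: "0 < y" using u by (simp add: y_def)
        have u1: "u ^ (r - 1) \<le> 1" using u by (intro power_le_one) auto
        have "u ^ (r - 1) * (tail (s * y) / tail s) \<le> 1 + C * u powr (real r - q - 1)"
        proof (cases "y \<le> 1")
          case True
          have "tail (s * y) / tail s \<le> C * y powr (- q)"
            using potter[OF elim y True] tail_pos[of s] by (simp add: divide_simps)
          also have "\<dots> \<le> C * u powr (- q)"
            using C u y q index_pos
            by (intro mult_left_mono powr_mono2') (auto simp: y_def divide_simps)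
          finally have "u ^ (r - 1) * (tail (s * y) / tail s) \<le> u ^ (r - 1) * (C * u powr (- q))"
            using u by (intro mult_left_mono) auto
          also have "\<dots> = C * (u powr (real r - 1) * u powr (- q))"
            unfolding pow[OF u(1)] by simp
          also have "u powr (real r - 1) * u powr (- q) = u powr (real r - q - 1)"
            by (simp add: algebra_simps flip: powr_add)
          finally show ?thesis by simp
        next
          case False
          then have "tail (s * y) \<le> tail s"
            using s by (intro tail_antimono) simp
          then have "tail (s * y) / tail s \<le> 1"
            using tail_pos[of s] by simp
          then have "u ^ (r - 1) * (tail (s * y) / tail s) \<le> 1 * 1"
            using u1 u tail_nonneg by (intro mult_mono) auto
          moreover have "0 \<le> C * u powr (real r - q - 1)" using C by simp
          ultimately show ?thesis by simp
        qed
        then have "real r * (u ^ (r - 1) * (tail (s * y) / tail s)) \<le> real r * (1 + C * u powr (real r - q - 1))"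
          by (intro mult_left_mono) auto
        then show ?thesis
          using u tail_nonneg[of "s * y"] tail_nonneg[of s]
          by (simp add: F_def w_def y_def abs_mult mult.assoc)
      qed (simp add: F_def w_def)
      then show ?case by simp
    qed
  qed
  also have "(\<integral>u. G u \<partial>lborel) = real r * Beta (real r - a) (1 + a)"
  proof -
    have "G u = real r * (indicator {0<..<1} u * (u powr (real r - a - 1) * (1 - u) powr (1 + a - 1)))" for u
    proof (cases "u \<in> {0<..<1}")
      case True
      then have "u ^ (r - 1) * (u / (1 - u)) powr (- a) = (u powr (real r - 1) * u powr (- a)) * (1 - u) powr a"
        using pow[of u] by (simp add: powr_divide powr_minus divide_simps)
      also have "u powr (real r - 1) * u powr (- a) = u powr (real r - a - 1)"
        by (simp add: algebra_simps flip: powr_add)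
      finally show ?thesis using True by (simp add: G_def)
    qed (simp add: G_def)
    then show ?thesis
      using beta_restrict(2)[of "real r - a" "1 + a"] r index_pos by simp
  qed
  finally have lim: "((\<lambda>s. \<integral>u. F s u \<partial>lborel) \<longlongrightarrow> real r * Beta (real r - a) (1 + a)) at_top" .
  have "(\<integral>u. F s u \<partial>lborel) = ratio_moment r s / tail s" if "0 < s" for s
  proof -
    have "F s u = (indicator {0<..<1} u * (real r * u ^ (r - 1) * tail (s * (u / (1 - u))))) / tail s" for u
      by (simp add: F_def)
    then show ?thesis
      using ratio_moment_layer_cake[OF that r0] by simp
  qed
  then have "\<forall>\<^sub>F s in at_top. (\<integral>u. F s u \<partial>lborel) = ratio_moment r s / tail s"
    by (intro eventually_mono[OF eventually_gt_at_top[of 0]])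
  with lim show ?thesis by (rule Lim_transform_eventually)
qed

end

section \<open>Asymptotics of the fourth moment of a self-normalized entry\<close>

lemma geometric_times_linear_tendsto_0:
  fixes \<rho> C :: real
  assumes "0 \<le> \<rho>" "\<rho> < 1"
  shows "(\<lambda>m. real (Suc m) * (C * \<rho> ^ m)) \<longlonglongrightarrow> 0"
proof (cases "\<rho> = 0")
  case True
  then show ?thesis
    by (auto intro!: tendsto_eventually eventually_at_top_linorderI[of 1])
next
  case False
  then have "0 < \<rho>" using assms by simp
  then show ?thesis using assms by real_asymp
qed

context entry_law
begin

lemma ratio_moment_2_le_1: "0 \<le> s \<Longrightarrow> ratio_moment 2 s \<le> ratio_moment 1 s"
  unfolding ratio_moment_def
  using ratio_bounds[of s] by (intro integral_mono ratio_power_integrable power_decreasing) auto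

text \<open>Beyond \<open>K\<close> the integrands of \<open>\<beta> = E h\<^sub>2(S)\<close> and of \<open>c/n = E c h\<^sub>1(S)\<close> are close relative to \<open>h\<^sub>1\<close>, and
below \<open>K\<close> their difference is at most one.\<close>

lemma scaled_beta_close:
  assumes c: "0 \<le> c" "c \<le> 1" and K: "0 \<le> K" and eps: "0 \<le> \<epsilon>"
    and close: "\<And>s. K \<le> s \<Longrightarrow> \<bar>ratio_moment 2 s - c * ratio_moment 1 s\<bar> \<le> \<epsilon> * ratio_moment 1 s"
  shows "\<bar>real (Suc m) * beta (Suc m) - c\<bar> \<le> \<epsilon> + real (Suc m) * (exp K * laplace 1 ^ m)"
proof -
  interpret row: prob_space "row m" by (rule prob_space_row)
  define S where "S = (\<lambda>x. \<Sum>k<m. (x k :: real)\<^sup>2)"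
  let ?A = "{x \<in> space (row m). S x \<le> K}"
  have [measurable]: "S \<in> borel_measurable (row m)" unfolding S_def by measurable
  have A [measurable]: "?A \<in> sets (row m)" by measurable
  have indA: "integrable (row m) (indicator ?A :: _ \<Rightarrow> real)"
    by (rule integrable_row_bounded[where B = 1]) (auto simp: indicator_def)
  have int: "integrable (row m) (\<lambda>x. ratio_moment r (S x))" for r
    unfolding S_def by (rule integrable_row_ratio_moment)
  have S0: "0 \<le> S x" for x by (simp add: S_def sum_nonneg)
  have one: "(\<integral>x. ratio_moment 1 (S x) \<partial>row m) = 1 / real (Suc m)"
    using integral_ratio_moment_1[of m] by (simp add: S_def)
  have "beta (Suc m) - c * (1 / real (Suc m)) = (\<integral>x. ratio_moment 2 (S x) - c * ratio_moment 1 (S x) \<partial>row m)"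
    using int[of 1] int[of 2] one beta_eq_ratio_moment[of m] by (simp add: S_def)
  also have "\<bar>\<dots>\<bar> \<le> (\<integral>x. \<bar>ratio_moment 2 (S x) - c * ratio_moment 1 (S x)\<bar> \<partial>row m)"
    by (rule integral_abs_bound)
  also have "\<dots> \<le> (\<integral>x. \<epsilon> * ratio_moment 1 (S x) + indicator ?A x \<partial>row m)"
  proof (rule integral_mono)
    fix x assume x: "x \<in> space (row m)"
    show "\<bar>ratio_moment 2 (S x) - c * ratio_moment 1 (S x)\<bar> \<le> \<epsilon> * ratio_moment 1 (S x) + indicator ?A x"
    proof (cases "K \<le> S x")
      case True
      then show ?thesis using close[OF True] indicator_pos_le[of ?A x, where 'a = real] by linarith
    next
      case False
      have "c * ratio_moment 1 (S x) \<le> 1 * 1"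
        using c ratio_moment_le_1[OF S0, of 1 x] ratio_moment_nonneg[OF S0, of 1 x] by (intro mult_mono) auto
      moreover have "0 \<le> c * ratio_moment 1 (S x)" "0 \<le> \<epsilon> * ratio_moment 1 (S x)"
        using c eps ratio_moment_nonneg[OF S0, of 1 x] by auto
      ultimately show ?thesis
        using False x ratio_moment_le_1[OF S0, of 2 x] ratio_moment_nonneg[OF S0, of 2 x]
        by (simp add: indicator_def abs_le_iff)
    qed
  qed (use int indA in auto)
  also have "\<dots> = \<epsilon> * (1 / real (Suc m)) + measure (row m) ?A"
    using int indA one by simp
  also have "measure (row m) ?A \<le> exp K * laplace 1 ^ m"
    using prob_sum_squares_le[of 1 m K] by (simp add: S_def)
  finally have main: "\<bar>beta (Suc m) - c * (1 / real (Suc m))\<bar> \<le> \<epsilon> * (1 / real (Suc m)) + exp K * laplace 1 ^ m"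
    by simp
  have "\<bar>real (Suc m) * beta (Suc m) - c\<bar> = real (Suc m) * \<bar>beta (Suc m) - c * (1 / real (Suc m))\<bar>"
  proof -
    have "real (Suc m) * beta (Suc m) - c = real (Suc m) * (beta (Suc m) - c * (1 / real (Suc m)))"
      by (simp add: right_diff_distrib del: of_nat_Suc)
    then show ?thesis by (simp only: abs_mult)
  qed
  also have "\<dots> \<le> real (Suc m) * (\<epsilon> * (1 / real (Suc m)) + exp K * laplace 1 ^ m)"
    by (intro mult_left_mono main) simp
  also have "\<dots> = \<epsilon> + real (Suc m) * (exp K * laplace 1 ^ m)"
    by (simp add: distrib_left del: of_nat_Suc)
  finally show ?thesis .
qed

proposition scaled_beta_limit:
  assumes lim: "((\<lambda>s. ratio_moment 2 s / ratio_moment 1 s) \<longlongrightarrow> c) at_top"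
    and c: "0 \<le> c" "c \<le> 1"
  shows "(\<lambda>n. real n * beta n) \<longlonglongrightarrow> c"
proof -
  have "(\<lambda>m. real (Suc m) * beta (Suc m)) \<longlonglongrightarrow> c"
  proof (rule tendstoI)
    fix e :: real assume e: "0 < e"
    have "\<forall>\<^sub>F s in at_top. dist (ratio_moment 2 s / ratio_moment 1 s) c < e / 2"
      using lim e by (intro tendstoD) auto
    then obtain K0 where K0: "\<And>s. K0 \<le> s \<Longrightarrow> \<bar>ratio_moment 2 s / ratio_moment 1 s - c\<bar> < e / 2"
      by (auto simp: eventually_at_top_linorder dist_real_def)
    define K where "K = max 0 K0"
    have close: "\<bar>ratio_moment 2 s - c * ratio_moment 1 s\<bar> \<le> e / 2 * ratio_moment 1 s" if "K \<le> s" for s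
    proof (cases "ratio_moment 1 s = 0")
      case True
      then show ?thesis
        using ratio_moment_2_le_1[of s] ratio_moment_nonneg[of s 2] that by (simp add: K_def)
    next
      case False
      then have pos: "0 < ratio_moment 1 s"
        using ratio_moment_nonneg[of s 1] that by (simp add: K_def)
      have "\<bar>ratio_moment 2 s - c * ratio_moment 1 s\<bar> = \<bar>ratio_moment 2 s / ratio_moment 1 s - c\<bar> * ratio_moment 1 s"
      proof -
        have "ratio_moment 2 s - c * ratio_moment 1 s = (ratio_moment 2 s / ratio_moment 1 s - c) * ratio_moment 1 s"
          using pos by (simp add: left_diff_distrib)
        then show ?thesis using pos by (simp only: abs_mult abs_of_pos)
      qed
      also have "\<dots> \<le> e / 2 * ratio_moment 1 s"
        using K0[of s] that pos by (intro mult_right_mono) (auto simp: K_def)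
      finally show ?thesis .
    qed
    have "(\<lambda>m. real (Suc m) * (exp K * laplace 1 ^ m)) \<longlonglongrightarrow> 0"
      using laplace_less_1[of 1] laplace_pos[of 1] by (intro geometric_times_linear_tendsto_0) auto
    then have "\<forall>\<^sub>F m in sequentially. real (Suc m) * (exp K * laplace 1 ^ m) < e / 2"
      using e by (intro order_tendstoD) auto
    then show "\<forall>\<^sub>F m in sequentially. dist (real (Suc m) * beta (Suc m)) c < e"
    proof eventually_elim
      case (elim m)
      have "\<bar>real (Suc m) * beta (Suc m) - c\<bar> \<le> e / 2 + real (Suc m) * (exp K * laplace 1 ^ m)"
        using e close by (intro scaled_beta_close c) (auto simp: K_def)
      with elim show ?case unfolding dist_real_def by linarith
    qed
  qed
  then show ?thesis by (rule filterlim_sequentially_Suc[THEN iffD1])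
qed

text \<open>For \<open>r = - ln (laplace 1) / 2\<close>, the Chernoff bound with parameter one decays like \<open>exp (- r n)\<close> on the
event \<open>S \<le> r n\<close>, and off this event \<open>h\<^sub>2(S)\<close> is at most \<open>h\<^sub>2(r n)\<close>.\<close>

proposition beta_small:
  assumes lim: "((\<lambda>s. s powr (3 / 2) * ratio_moment 2 s) \<longlongrightarrow> 0) at_top"
  shows "(\<lambda>n. real n powr (3 / 2) * beta n) \<longlonglongrightarrow> 0"
proof -
  define r where "r = - ln (laplace 1) / 2"
  have L: "0 < laplace 1" "laplace 1 < 1"
    using laplace_pos[of 1] laplace_less_1[of 1] by auto
  have r: "0 < r" using L by (simp add: r_def)
  define \<rho> where "\<rho> = exp (1 * r) * laplace 1"
  have "\<rho> = exp (- r)"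
  proof -
    have "laplace 1 = exp (- 2 * r)" using L by (simp add: r_def)
    then show ?thesis by (simp add: \<rho>_def flip: exp_add)
  qed
  then have \<rho>: "0 < \<rho>" "\<rho> < 1" using r by auto
  have "(\<lambda>m. real (Suc m) powr (3 / 2) * beta (Suc m)) \<longlonglongrightarrow> 0"
  proof (rule tendsto_sandwich[where f = "\<lambda>_. 0"])
    have "filterlim (\<lambda>m. r * real (Suc m)) at_top sequentially"
      using r by real_asymp
    then have "(\<lambda>m. (r * real (Suc m)) powr (3 / 2) * ratio_moment 2 (r * real (Suc m))) \<longlonglongrightarrow> 0"
      by (rule filterlim_compose[OF lim])
    then have "(\<lambda>m. r powr (- 3 / 2) * ((r * real (Suc m)) powr (3 / 2) * ratio_moment 2 (r * real (Suc m)))) \<longlonglongrightarrow> r powr (- 3 / 2) * 0"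
      by (intro tendsto_mult tendsto_const)
    moreover have "r powr (- 3 / 2) * ((r * real (Suc m)) powr (3 / 2) * h) = real (Suc m) powr (3 / 2) * h" for m h
    proof -
      have "(r * real (Suc m)) powr (3 / 2) = r powr (3 / 2) * real (Suc m) powr (3 / 2)"
        using r by (simp add: powr_mult)
      moreover have "r powr (- 3 / 2) * r powr (3 / 2) = 1"
        using r by (simp flip: powr_add)
      ultimately show ?thesis by (simp add: mult.assoc[symmetric])
    qed
    ultimately have "(\<lambda>m. real (Suc m) powr (3 / 2) * ratio_moment 2 (r * real (Suc m))) \<longlonglongrightarrow> 0"
      by (simp only: mult_zero_right)
    moreover have "(\<lambda>m. real (Suc m) powr (3 / 2) * (exp (1 * r) * \<rho> ^ m)) \<longlonglongrightarrow> 0"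
      using \<rho> by real_asymp
    ultimately show "(\<lambda>m. real (Suc m) powr (3 / 2) * ratio_moment 2 (r * real (Suc m))
        + real (Suc m) powr (3 / 2) * (exp (1 * r) * \<rho> ^ m)) \<longlonglongrightarrow> 0"
      by (rule tendsto_add_zero)
    show "\<forall>\<^sub>F m in sequentially. real (Suc m) powr (3 / 2) * beta (Suc m) \<le>
        real (Suc m) powr (3 / 2) * ratio_moment 2 (r * real (Suc m))
        + real (Suc m) powr (3 / 2) * (exp (1 * r) * \<rho> ^ m)"
    proof (intro always_eventually allI)
      fix m
      have "beta (Suc m) \<le> ratio_moment 2 (r * real (Suc m)) + exp (1 * r) * \<rho> ^ m"
        unfolding \<rho>_def using r by (intro beta_le_ratio_moment_plus_geometric) auto
      then show "real (Suc m) powr (3 / 2) * beta (Suc m) \<le>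
        real (Suc m) powr (3 / 2) * ratio_moment 2 (r * real (Suc m))
        + real (Suc m) powr (3 / 2) * (exp (1 * r) * \<rho> ^ m)"
        unfolding distrib_left[symmetric] by (intro mult_left_mono) auto
    qed
  qed (auto simp: beta_nonneg)
  then show ?thesis by (rule filterlim_sequentially_Suc[THEN iffD1])
qed

lemma beta_small_of_fourth_moment:
  assumes int: "integrable Q (\<lambda>x. x ^ 4)"
  shows "(\<lambda>n. real n powr (3 / 2) * beta n) \<longlonglongrightarrow> 0"
proof (rule beta_small)
  define E where "E = (\<integral>x. x ^ 4 \<partial>Q)"
  have le: "ratio_moment 2 s \<le> E / s\<^sup>2" if s: "0 < s" for s
  proof -
    have "ratio_moment 2 s \<le> (\<integral>x. x ^ 4 / s\<^sup>2 \<partial>Q)"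
      unfolding ratio_moment_def
    proof (rule integral_mono)
      fix x :: real
      have "(x\<^sup>2 / (x\<^sup>2 + s))\<^sup>2 \<le> (x\<^sup>2 / s)\<^sup>2"
        using s by (intro power_mono divide_left_mono mult_pos_pos add_nonneg_pos) auto
      then show "(x\<^sup>2 / (x\<^sup>2 + s))\<^sup>2 \<le> x ^ 4 / s\<^sup>2"
        by (simp add: power_divide)
    qed (use s int ratio_power_integrable[of s 2] in auto)
    then show ?thesis by (simp add: E_def)
  qed
  show "((\<lambda>s. s powr (3 / 2) * ratio_moment 2 s) \<longlongrightarrow> 0) at_top"
  proof (rule tendsto_sandwich[where f = "\<lambda>_. 0"])
    show "((\<lambda>s. s powr (3 / 2) * (E / s\<^sup>2)) \<longlongrightarrow> 0) at_top"
      by real_asymp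
    show "\<forall>\<^sub>F s in at_top. s powr (3 / 2) * ratio_moment 2 s \<le> s powr (3 / 2) * (E / s\<^sup>2)"
      using eventually_gt_at_top[of 0] by eventually_elim (intro mult_left_mono le; simp)
    show "\<forall>\<^sub>F s in at_top. 0 \<le> s powr (3 / 2) * ratio_moment 2 s"
      using eventually_gt_at_top[of 0] by eventually_elim (simp add: ratio_moment_nonneg)
  qed auto
qed

end

lemma two_Beta_eq_c2: "2 * Beta (2 - a) (1 + a) = c2 (2 * a)"
proof -
  have "Gamma (3 :: real) = 2"
    using Gamma_fact[of 2, where 'a = real] by (simp add: fact_numeral)
  then show ?thesis
    by (simp add: Beta_def c2_def)
qed

lemma c2_pos:
  assumes "0 < \<alpha>" "\<alpha> < 4"
  shows "0 < c2 \<alpha>"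
  using assms by (simp add: c2_def)

context regularly_varying_law
begin

lemma ratio_moment_2_tail_limit:
  "a < 2 \<Longrightarrow> ((\<lambda>s. ratio_moment 2 s / tail s) \<longlongrightarrow> c2 (2 * a)) at_top"
  using ratio_moment_tail_limit[of 2] by (simp add: two_Beta_eq_c2)

text \<open>The tail cancels from the quotient of the two ratio moments, and the functional equation of the Beta
function evaluates what remains.\<close>

proposition scaled_beta_limit_heavy:
  assumes "a < 1"
  shows "(\<lambda>n. real n * beta n) \<longlonglongrightarrow> 1 - a"
proof (rule scaled_beta_limit)
  have pos: "Beta (1 - a) (1 + a) \<noteq> 0"
  proof -
    have Gamma_pos: "0 < Gamma (1 - a)" "0 < Gamma (1 + a)" "0 < Gamma (2 :: real)"
      using assms index_pos by simp_all
    have "Beta (1 - a) (1 + a) = Gamma (1 - a) * Gamma (1 + a) / Gamma 2"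
      by (simp add: Beta_def)
    also have "\<dots> > 0"
      by (intro divide_pos_pos mult_pos_pos Gamma_pos)
    finally show ?thesis by simp
  qed
  have "((\<lambda>s. ratio_moment 1 s / tail s) \<longlongrightarrow> Beta (1 - a) (1 + a)) at_top"
    using ratio_moment_tail_limit[of 1] assms by simp
  moreover have "((\<lambda>s. ratio_moment 2 s / tail s) \<longlongrightarrow> 2 * Beta (2 - a) (1 + a)) at_top"
    using ratio_moment_tail_limit[of 2] assms by simp
  ultimately have "((\<lambda>s. (ratio_moment 2 s / tail s) / (ratio_moment 1 s / tail s)) \<longlongrightarrow>
      2 * Beta (2 - a) (1 + a) / Beta (1 - a) (1 + a)) at_top"
    using pos by (intro tendsto_divide)
  moreover have "(ratio_moment 2 s / tail s) / (ratio_moment 1 s / tail s) = ratio_moment 2 s / ratio_moment 1 s" for s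
    using tail_pos[of s] by simp
  moreover have "2 * Beta (2 - a) (1 + a) / Beta (1 - a) (1 + a) = 1 - a"
  proof -
    have "(1 - a) \<notin> \<int>\<^sub>\<le>\<^sub>0" using assms by (auto elim!: nonpos_Ints_cases)
    from Beta_plus1_left[OF this, of "1 + a"] have "2 * Beta (2 - a) (1 + a) = (1 - a) * Beta (1 - a) (1 + a)"
      by (simp add: algebra_simps)
    then show ?thesis using pos by simp
  qed
  ultimately show "((\<lambda>s. ratio_moment 2 s / ratio_moment 1 s) \<longlongrightarrow> 1 - a) at_top"
    by (simp only:)
qed (use assms index_pos in auto)

lemma beta_small_of_index:
  assumes "3 / 2 < a" "a < 2"
  shows "(\<lambda>n. real n powr (3 / 2) * beta n) \<longlonglongrightarrow> 0"
proof (rule beta_small)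
  have "((\<lambda>s. (ratio_moment 2 s / tail s) * (s powr (3 / 2) * tail s)) \<longlongrightarrow> c2 (2 * a) * 0) at_top"
    using assms by (intro tendsto_mult ratio_moment_2_tail_limit tail_le_power) auto
  moreover have "(ratio_moment 2 s / tail s) * (s powr (3 / 2) * tail s) = s powr (3 / 2) * ratio_moment 2 s" for s
    using tail_pos[of s] by simp
  ultimately show "((\<lambda>s. s powr (3 / 2) * ratio_moment 2 s) \<longlongrightarrow> 0) at_top"
    by simp
qed

text \<open>The lower bound is Jensen's inequality. The upper bound holds with the constant \<open>c\<^sub>2(\<alpha>) r\<^sup>-\<^sup>a\<close> for every
\<open>r < 1\<close>, and \<open>r\<close> may be taken arbitrarily close to one; the exponential error is negligible since the tail
decays at most polynomially.\<close>

proposition beta_tail_limit: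
  assumes a: "a < 2"
    and int: "integrable Q (\<lambda>x. x\<^sup>2)" and mean: "(\<integral>x. x\<^sup>2 \<partial>Q) = 1"
  shows "(\<lambda>n. beta n / tail (real n)) \<longlonglongrightarrow> c2 (2 * a)"
proof -
  define K where "K = c2 (2 * a)"
  have lim: "((\<lambda>s. ratio_moment 2 s / tail s) \<longlongrightarrow> K) at_top"
    unfolding K_def using a by (rule ratio_moment_2_tail_limit)
  have Suc_top: "filterlim (\<lambda>m. real (Suc m)) at_top sequentially"
    by real_asymp
  have "(\<lambda>m. beta (Suc m) / tail (real (Suc m))) \<longlonglongrightarrow> K"
  proof (rule order_tendstoI)
    fix y assume y: "y < K"
    have "\<forall>\<^sub>F m in sequentially. y < ratio_moment 2 (real (Suc m)) / tail (real (Suc m))"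
      using order_tendstoD(1)[OF filterlim_compose[OF lim Suc_top] y] .
    then show "\<forall>\<^sub>F m in sequentially. y < beta (Suc m) / tail (real (Suc m))"
      using eventually_gt_at_top[of 0]
    proof eventually_elim
      case (elim m)
      have "ratio_moment 2 (real (Suc m)) \<le> ratio_moment 2 (real m)"
        by (intro ratio_moment_antimono) auto
      also have "\<dots> \<le> beta (Suc m)"
        using elim by (intro ratio_moment_le_beta int mean)
      finally have "ratio_moment 2 (real (Suc m)) / tail (real (Suc m)) \<le> beta (Suc m) / tail (real (Suc m))"
        using tail_nonneg by (intro divide_right_mono)
      with elim show ?case by linarith
    qed
  next
    fix y assume y: "K < y"
    have "((\<lambda>r. K * r powr (- a)) \<longlongrightarrow> K * 1 powr (- a)) (at_left 1)"
      by (intro tendsto_intros) auto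
    then have "((\<lambda>r. K * r powr (- a)) \<longlongrightarrow> K) (at_left 1)" by simp
    from order_tendstoD(2)[OF this y] have "\<forall>\<^sub>F r in at_left 1. K * r powr (- a) < y" .
    moreover have "\<forall>\<^sub>F r in at_left (1 :: real). 0 < r \<and> r < 1"
      using eventually_at_left_real[of 0 "1 :: real"] by simp
    ultimately have "\<forall>\<^sub>F r in at_left 1. K * r powr (- a) < y \<and> 0 < r \<and> r < 1"
      by eventually_elim auto
    then obtain r where r: "K * r powr (- a) < y" "0 < r" "r < 1"
      by (metis (mono_tags, lifting) eventually_happens' trivial_limit_at_left_real)
    obtain t where t: "0 < t" "laplace t < exp (- t * r)"
      using laplace_less_exp[OF int mean r(3)] .
    define \<rho> where "\<rho> = exp (t * r) * laplace t"
    have \<rho>: "0 < \<rho>" "\<rho> < 1"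
      using t laplace_pos[of t] by (auto simp: \<rho>_def exp_minus divide_simps mult.commute)
    obtain c where c: "0 < c" and ge: "\<forall>\<^sub>F s in at_top. c * s powr (- (a + 1)) \<le> tail s"
      by (rule tail_ge_power[of "a + 1"]) auto
    have geometric: "(\<lambda>m. exp (t * r) * \<rho> ^ m / tail (real (Suc m))) \<longlonglongrightarrow> 0"
    proof (rule tendsto_sandwich[where f = "\<lambda>_. 0"])
      show "(\<lambda>m. exp (t * r) * \<rho> ^ m / (c * real (Suc m) powr (- (a + 1)))) \<longlonglongrightarrow> 0"
        using \<rho> c by real_asymp
      show "\<forall>\<^sub>F m in sequentially. exp (t * r) * \<rho> ^ m / tail (real (Suc m)) \<le>
          exp (t * r) * \<rho> ^ m / (c * real (Suc m) powr (- (a + 1)))"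
        using filterlim_iff[THEN iffD1, OF Suc_top, rule_format, OF ge]
      proof eventually_elim
        case (elim m)
        have "0 < c * real (Suc m) powr (- (a + 1))" using c by simp
        then show ?case using elim \<rho> tail_pos c by (intro divide_left_mono mult_pos_pos) auto
      qed
    qed (use \<rho> tail_nonneg in auto)
    have rn: "filterlim (\<lambda>m. r * real (Suc m)) at_top sequentially"
      using r by real_asymp
    have "(\<lambda>m. ratio_moment 2 (r * real (Suc m)) / tail (r * real (Suc m)) *
        (tail (r * real (Suc m)) / tail (real (Suc m)))
        + exp (t * r) * \<rho> ^ m / tail (real (Suc m))) \<longlonglongrightarrow> K * r powr (- a) + 0"
      by (intro tendsto_add tendsto_mult geometric filterlim_compose[OF lim rn]
          filterlim_compose[OF tail_regularly_varying[OF r(2)] Suc_top])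
    moreover have "ratio_moment 2 (r * real (Suc m)) / tail (r * real (Suc m)) *
        (tail (r * real (Suc m)) / tail (real (Suc m))) = ratio_moment 2 (r * real (Suc m)) / tail (real (Suc m))" for m
      using tail_pos[of "r * real (Suc m)"] by simp
    ultimately have "(\<lambda>m. ratio_moment 2 (r * real (Suc m)) / tail (real (Suc m))
        + exp (t * r) * \<rho> ^ m / tail (real (Suc m))) \<longlonglongrightarrow> K * r powr (- a)"
      by (simp only: add_0_right)
    from order_tendstoD(2)[OF this r(1)]
    show "\<forall>\<^sub>F m in sequentially. beta (Suc m) / tail (real (Suc m)) < y"
    proof eventually_elim
      case (elim m)
      have "beta (Suc m) \<le> ratio_moment 2 (r * real (Suc m)) + exp (t * r) * \<rho> ^ m"
        unfolding \<rho>_def using r t by (intro beta_le_ratio_moment_plus_geometric) auto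
      then have "beta (Suc m) / tail (real (Suc m)) \<le>
          (ratio_moment 2 (r * real (Suc m)) + exp (t * r) * \<rho> ^ m) / tail (real (Suc m))"
        using tail_nonneg by (intro divide_right_mono)
      with elim show ?case by (simp add: add_divide_distrib)
    qed
  qed
  then show ?thesis
    unfolding K_def by (rule filterlim_sequentially_Suc[THEN iffD1])
qed

end

section \<open>The trace as a function of the rows\<close>

lemma trace_sample_correlation_squared:
  "matrix_trace (sample_correlation p n x ^\<^sub>m 2) =
     (\<Sum>i<p. \<Sum>k<p. (\<Sum>j<n. self_normalized n x i j * self_normalized n x k j)\<^sup>2)"
proof -
  let ?R = "sample_correlation p n x"
  have R: "?R \<in> carrier_mat p p"
    by (intro carrier_matI) (simp_all add: sample_correlation_def Y_matrix_def)
  have entry: "?R $$ (i, k) = (\<Sum>j<n. self_normalized n x i j * self_normalized n x k j)"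
    if "i < p" "k < p" for i k
    using that by (simp add: sample_correlation_def Y_matrix_def scalar_prod_def lessThan_atLeast0)
  have "?R ^\<^sub>m 2 = ?R * ?R"
    using R by (simp add: numeral_2_eq_2)
  moreover have "(?R * ?R) $$ (i, i) = (\<Sum>k<p. (?R $$ (i, k))\<^sup>2)" if "i < p" for i
  proof -
    have "(?R * ?R) $$ (i, i) = (\<Sum>k<p. ?R $$ (i, k) * ?R $$ (k, i))"
      using R that by (simp add: scalar_prod_def lessThan_atLeast0)
    also have "\<dots> = (\<Sum>k<p. (?R $$ (i, k))\<^sup>2)"
      using that by (intro sum.cong refl) (simp add: entry power2_eq_square mult.commute)
    finally show ?thesis .
  qed
  ultimately show ?thesis
    using R by (simp add: matrix_trace_def entry)
qed

lemma normalized_restrict: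
  "j < n \<Longrightarrow> normalized n (\<lambda>j\<in>{..<n}. x j) j = normalized n x j"
  by (simp add: normalized_def)

lemma self_normalized_eq_normalized: "self_normalized n x i j = normalized n (x i) j"
  by (simp add: self_normalized_def normalized_def)

definition squared_correlation_sum :: "nat \<Rightarrow> nat \<Rightarrow> (nat \<Rightarrow> nat \<Rightarrow> real) \<Rightarrow> real" where
  "squared_correlation_sum p n y = (\<Sum>i<p. \<Sum>k<p. (\<Sum>j<n. normalized n (y i) j * normalized n (y k) j)\<^sup>2)"

lemma trace_eq_squared_correlation_sum:
  "matrix_trace (sample_correlation p n x ^\<^sub>m 2) =
     squared_correlation_sum p n (\<lambda>i\<in>{..<p}. \<lambda>j\<in>{..<n}. x i j)"
  unfolding trace_sample_correlation_squared squared_correlation_sum_def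
  by (intro sum.cong refl arg_cong[where f = "\<lambda>t. t\<^sup>2"])
     (simp add: self_normalized_eq_normalized normalized_restrict)

lemma indep_vars_single_out:
  assumes "prob_space M"
    and indep: "prob_space.indep_vars M (\<lambda>_. borel) Z (I \<times> J)" and i: "i \<in> I"
  shows "prob_space.indep_vars M (\<lambda>_. borel) (\<lambda>j. Z (i, j)) J"
proof -
  interpret prob_space M by fact
  have "indep_vars (\<lambda>j. PiM {(i, j)} (\<lambda>_. borel)) (\<lambda>j \<omega>. restrict (\<lambda>q. Z q \<omega>) {(i, j)}) J"
    using i by (intro indep_vars_restrict[OF indep]) (auto simp: disjoint_family_on_def)
  then have "indep_vars (\<lambda>_. borel) (\<lambda>j \<omega>. restrict (\<lambda>q. Z q \<omega>) {(i, j)} (i, j)) J"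
    by (rule indep_vars_compose2) (auto intro: measurable_component_singleton)
  then show ?thesis by simp
qed

lemma indep_vars_rows:
  assumes "prob_space M"
    and indep: "prob_space.indep_vars M (\<lambda>_. borel) Z (I \<times> J)"
  shows "prob_space.indep_vars M (\<lambda>_. PiM J (\<lambda>_. borel)) (\<lambda>i \<omega>. \<lambda>j\<in>J. Z (i, j) \<omega>) I"
proof -
  interpret prob_space M by fact
  have "indep_vars (\<lambda>i. PiM ({i} \<times> J) (\<lambda>_. borel)) (\<lambda>i \<omega>. restrict (\<lambda>q. Z q \<omega>) ({i} \<times> J)) I"
    by (intro indep_vars_restrict[OF indep]) (auto simp: disjoint_family_on_def)
  then have "indep_vars (\<lambda>_. PiM J (\<lambda>_. borel))
      (\<lambda>i \<omega>. (\<lambda>f. \<lambda>j\<in>J. f (i, j)) (restrict (\<lambda>q. Z q \<omega>) ({i} \<times> J))) I"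
    by (rule indep_vars_compose2)
       (intro measurable_restrict measurable_component_singleton, auto)
  moreover have "(\<lambda>f. \<lambda>j\<in>J. f (i, j)) (restrict (\<lambda>q. Z q \<omega>) ({i} \<times> J)) = (\<lambda>j\<in>J. Z (i, j) \<omega>)" for i \<omega>
    by (auto simp: fun_eq_iff)
  ultimately show ?thesis by simp
qed

context
  fixes M :: "'a measure" and p n :: nat and X :: "nat \<Rightarrow> nat \<Rightarrow> 'a \<Rightarrow> real"
    and N :: "'b measure" and \<xi> :: "'b \<Rightarrow> real" and D :: "real measure"
  assumes copies: "iid_copies M p n X N \<xi>"
    and D: "D = distr N borel \<xi>"
    and p: "0 < p" and n: "0 < n"
begin

lemma iid_row_law:
  assumes "i < p"
  shows "distr M (PiM {..<n} (\<lambda>_. borel)) (\<lambda>\<omega>. \<lambda>j\<in>{..<n}. X i j \<omega>) = PiM {..<n} (\<lambda>_. D)"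
proof -
  interpret prob_space M using copies by (simp add: iid_copies_def)
  have "indep_vars (\<lambda>_. borel) (\<lambda>(i, j). X i j) ({..<p} \<times> {..<n})"
    using copies by (simp add: iid_copies_def)
  from indep_vars_single_out[OF prob_space_axioms this, of i]
  have indep: "indep_vars (\<lambda>_. borel) (X i) {..<n}"
    using assms by simp
  then have "distr M (PiM {..<n} (\<lambda>_. borel)) (\<lambda>\<omega>. \<lambda>j\<in>{..<n}. X i j \<omega>) =
      PiM {..<n} (\<lambda>j. distr M borel (X i j))"
    using n by (subst indep_vars_iff_distr_eq_PiM'[symmetric]) (auto simp: indep_vars_def)
  also have "\<dots> = PiM {..<n} (\<lambda>_. D)"
    using copies assms by (intro PiM_cong refl) (simp add: iid_copies_def D)
  finally show ?thesis .
qed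

text \<open>The array of copies has the law of independent identically distributed rows, which reduces every
statement about \<open>M\<close> to a product measure that depends on \<open>N\<close> and \<open>\<xi>\<close> only through the entry law \<open>D\<close>.\<close>

lemma iid_array_law:
  "distr M (PiM {..<p} (\<lambda>_. PiM {..<n} (\<lambda>_. borel))) (\<lambda>\<omega>. \<lambda>i\<in>{..<p}. \<lambda>j\<in>{..<n}. X i j \<omega>) =
   PiM {..<p} (\<lambda>_. PiM {..<n} (\<lambda>_. D))"
proof -
  interpret prob_space M using copies by (simp add: iid_copies_def)
  have "indep_vars (\<lambda>_. borel) (\<lambda>(i, j). X i j) ({..<p} \<times> {..<n})"
    using copies by (simp add: iid_copies_def)
  from indep_vars_rows[OF prob_space_axioms this]
  have "indep_vars (\<lambda>_. PiM {..<n} (\<lambda>_. borel)) (\<lambda>i \<omega>. \<lambda>j\<in>{..<n}. X i j \<omega>) {..<p}"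
    by simp
  then have "distr M (PiM {..<p} (\<lambda>_. PiM {..<n} (\<lambda>_. borel))) (\<lambda>\<omega>. \<lambda>i\<in>{..<p}. \<lambda>j\<in>{..<n}. X i j \<omega>) =
      PiM {..<p} (\<lambda>i. distr M (PiM {..<n} (\<lambda>_. borel)) (\<lambda>\<omega>. \<lambda>j\<in>{..<n}. X i j \<omega>))"
    using p by (subst indep_vars_iff_distr_eq_PiM'[symmetric]) (auto simp: indep_vars_def)
  also have "\<dots> = PiM {..<p} (\<lambda>_. PiM {..<n} (\<lambda>_. D))"
    by (intro PiM_cong refl) (simp add: iid_row_law)
  finally show ?thesis .
qed

lemma iid_array_measurable:
  "(\<lambda>\<omega>. \<lambda>i\<in>{..<p}. \<lambda>j\<in>{..<n}. X i j \<omega>) \<in> measurable M (PiM {..<p} (\<lambda>_. PiM {..<n} (\<lambda>_. borel)))"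
proof -
  interpret prob_space M using copies by (simp add: iid_copies_def)
  have "X i j \<in> borel_measurable M" if "i < p" "j < n" for i j
    using copies that by (auto simp: iid_copies_def indep_vars_def)
  then show ?thesis
    by (intro measurable_restrict) auto
qed

lemma integral_iid_array:
  fixes f :: "(nat \<Rightarrow> nat \<Rightarrow> real) \<Rightarrow> real"
  assumes sets_D: "sets D = sets borel"
    and f: "f \<in> borel_measurable (PiM {..<p} (\<lambda>_. PiM {..<n} (\<lambda>_. D)))"
  shows "(\<integral>\<omega>. f (\<lambda>i\<in>{..<p}. \<lambda>j\<in>{..<n}. X i j \<omega>) \<partial>M) = (\<integral>y. f y \<partial>PiM {..<p} (\<lambda>_. PiM {..<n} (\<lambda>_. D)))"
proof -
  have "sets (PiM {..<p} (\<lambda>_. PiM {..<n} (\<lambda>_. D))) = sets (PiM {..<p} (\<lambda>_. PiM {..<n} (\<lambda>_. borel)))"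
    by (intro sets_PiM_cong refl sets_D)
  then have "f \<in> borel_measurable (PiM {..<p} (\<lambda>_. PiM {..<n} (\<lambda>_. borel)))"
    using f by (simp cong: measurable_cong_sets)
  from integral_distr[OF iid_array_measurable this] show ?thesis
    by (simp add: iid_array_law)
qed

end

context symmetric_entry_law
begin

lemma normalized_component_measurable:
  assumes "i < p" "j < n"
  shows "(\<lambda>y. normalized n (y i) j) \<in> borel_measurable (PiM {..<p} (\<lambda>_. row n))"
proof -
  have "(\<lambda>y. y i) \<in> measurable (PiM {..<p} (\<lambda>_. row n)) (row n)"
    using assms by (intro measurable_component_singleton) simp
  then show ?thesis
    by (rule measurable_compose) (rule normalized_measurable[OF assms(2)])
qed

lemma squared_correlation_sum_measurable:
  "squared_correlation_sum p n \<in> borel_measurable (PiM {..<p} (\<lambda>_. row n))"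
proof -
  show ?thesis
    unfolding squared_correlation_sum_def
    by (intro borel_measurable_sum borel_measurable_power borel_measurable_times
        normalized_component_measurable) auto
qed

text \<open>The second moment of \<open>corr_kernel n\<close>, see \<open>corr_kernel_second_moment\<close>.\<close>

definition kernel_variance :: "nat \<Rightarrow> real" where
  "kernel_variance n = real n * (beta n)\<^sup>2 + 3 * real n * (real n - 1) * (mixed n)\<^sup>2 - 1 / (real n)\<^sup>2"

text \<open>Almost surely all rows have norm one. Then the diagonal terms are one, and the others are \<open>1/n\<close> plus
the degenerate kernel.\<close>

proposition variance_squared_correlation_sum:
  fixes p n :: nat
  assumes n: "0 < n"
  defines "W \<equiv> PiM {..<p} (\<lambda>_. row n)"
  shows "(\<integral>y. (squared_correlation_sum p n y - (\<integral>y. squared_correlation_sum p n y \<partial>W))\<^sup>2 \<partial>W) =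
     2 * real p * (real p - 1) * kernel_variance n"
proof -
  interpret K: degenerate_kernel "row n" "corr_kernel n" "(real n)\<^sup>2 + 1"
    by (rule degenerate_corr_kernel[OF n])
  interpret W: prob_space W
    unfolding W_def by (rule K.prob_space_sample)
  let ?T = "squared_correlation_sum p n"
  let ?off = "K.off_diagonal p"
  define U where "U = (\<lambda>y. \<Sum>(i, k)\<in>?off. corr_kernel n (y i) (y k))"
  define c where "c = real p + real p * (real p - 1) / real n"
  have T_meas [measurable]: "?T \<in> borel_measurable W"
    unfolding W_def by (rule squared_correlation_sum_measurable)
  have U_int: "integrable W U"
    unfolding U_def W_def case_prod_beta
    by (intro Bochner_Integration.integrable_sum K.kernel_sample_integrable) (auto simp: K.off_diagonal_def)
  have [measurable]: "U \<in> borel_measurable W"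
    using U_int by simp
  have "AE y in W. \<forall>i\<in>{..<p}. (\<Sum>j<n. (normalized n (y i) j)\<^sup>2) = 1"
    unfolding W_def using AE_row_sum_normalized_squares[OF n]
    by (intro AE_finite_allI AE_PiM_component) (auto intro: K.prob_space_axioms)
  then have T_eq: "AE y in W. ?T y = c + U y"
  proof eventually_elim
    case (elim y)
    let ?F = "\<lambda>(i, k). (\<Sum>j<n. normalized n (y i) j * normalized n (y k) j)\<^sup>2"
    have diag: "?F (i, i) = 1" if "i < p" for i
      using elim that by (simp add: power2_eq_square)
    have off: "?F q = (case q of (i, k) \<Rightarrow> corr_kernel n (y i) (y k)) + 1 / real n" if "q \<in> ?off" for q
      using elim that by (auto simp: corr_kernel_def K.off_diagonal_def)
    have "?T y = (\<Sum>q\<in>{..<p} \<times> {..<p}. ?F q)"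
      by (simp add: squared_correlation_sum_def sum.cartesian_product)
    also have "\<dots> = (\<Sum>q\<in>?off. ?F q) + (\<Sum>q\<in>(\<lambda>i. (i, i)) ` {..<p}. ?F q)"
      unfolding K.off_diagonal_eq by (intro sum.subset_diff) auto
    also have "(\<Sum>q\<in>(\<lambda>i. (i, i)) ` {..<p}. ?F q) = real p"
      by (subst sum.reindex) (auto simp: inj_on_def diag[simplified])
    also have "(\<Sum>q\<in>?off. ?F q) = U y + real (card ?off) / real n"
      using off by (simp add: U_def sum.distrib)
    finally show ?case
      by (simp add: c_def K.card_off_diagonal)
  qed
  have U_mean: "(\<integral>y. U y \<partial>W) = 0"
    unfolding U_def W_def by (rule K.mean_off_diagonal_sum)
  have "(\<integral>y. ?T y \<partial>W) = (\<integral>y. c + U y \<partial>W)"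
    using T_eq by (intro integral_cong_AE) auto
  also have "\<dots> = c"
    using U_int U_mean by (simp add: W.prob_space)
  finally have mean: "(\<integral>y. ?T y \<partial>W) = c" .
  have "(\<integral>y. (?T y - c)\<^sup>2 \<partial>W) = (\<integral>y. (U y)\<^sup>2 \<partial>W)"
    using T_eq by (intro integral_cong_AE) auto
  also have "\<dots> = 2 * real p * (real p - 1) * (\<integral>x. (\<integral>y. (corr_kernel n x y)\<^sup>2 \<partial>row n) \<partial>row n)"
    unfolding U_def W_def by (rule K.second_moment_off_diagonal_sum)
  finally show ?thesis
    by (simp add: mean corr_kernel_second_moment[OF n] kernel_variance_def)
qed

lemma variance_trace:
  assumes copies: "iid_copies M p n X N \<xi>" and Q: "Q = distr N borel \<xi>"
    and p: "0 < p" and n: "0 < n"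
  shows "prob_space.variance M (\<lambda>\<omega>. matrix_trace (sample_correlation p n (\<lambda>i j. X i j \<omega>) ^\<^sub>m 2)) =
     2 * real p * (real p - 1) * kernel_variance n"
proof -
  let ?W = "PiM {..<p} (\<lambda>_. row n)"
  let ?T = "squared_correlation_sum p n"
  note integral = integral_iid_array[OF copies Q p n sets_Q]
  have mean: "(\<integral>\<omega>. ?T (\<lambda>i\<in>{..<p}. \<lambda>j\<in>{..<n}. X i j \<omega>) \<partial>M) = (\<integral>y. ?T y \<partial>?W)"
    by (intro integral squared_correlation_sum_measurable)
  have "(\<integral>\<omega>. (?T (\<lambda>i\<in>{..<p}. \<lambda>j\<in>{..<n}. X i j \<omega>) - (\<integral>y. ?T y \<partial>?W))\<^sup>2 \<partial>M) =
        (\<integral>y. (?T y - (\<integral>y. ?T y \<partial>?W))\<^sup>2 \<partial>?W)"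
    using squared_correlation_sum_measurable[of p n]
    by (intro integral[where f = "\<lambda>y. (?T y - (\<integral>y. ?T y \<partial>?W))\<^sup>2"]) auto
  then show ?thesis
    unfolding trace_eq_squared_correlation_sum mean by (simp only: variance_squared_correlation_sum[OF n])
qed

lemma beta4_eq_beta:
  assumes copies: "iid_copies M p n X N \<xi>" and Q: "Q = distr N borel \<xi>"
    and p: "0 < p" and n: "0 < n"
  shows "beta4 M n X = beta n"
proof -
  have meas: "(\<lambda>y. (normalized n (y 0) 0) ^ 4) \<in> borel_measurable (PiM {..<p} (\<lambda>_. row n))"
    using p n by (intro borel_measurable_power normalized_component_measurable)
  have "beta4 M n X = (\<integral>\<omega>. (normalized n ((\<lambda>i\<in>{..<p}. \<lambda>j\<in>{..<n}. X i j \<omega>) 0) 0) ^ 4 \<partial>M)"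
    using p n by (simp add: beta4_def self_normalized_eq_normalized normalized_restrict)
  also have "\<dots> = (\<integral>y. (normalized n (y 0) 0) ^ 4 \<partial>PiM {..<p} (\<lambda>_. row n))"
    by (rule integral_iid_array[OF copies Q p n sets_Q meas])
  also have "\<dots> = (\<integral>x. (normalized n x 0) ^ 4 \<partial>distr (PiM {..<p} (\<lambda>_. row n)) (row n) (\<lambda>y. y 0))"
    using p n normalized_measurable[of 0 n]
    by (subst integral_distr) (auto intro: measurable_component_singleton)
  also have "distr (PiM {..<p} (\<lambda>_. row n)) (row n) (\<lambda>y. y 0) = row n"
    using p prob_space_row by (intro distr_PiM_component) auto
  finally show ?thesis by (simp add: beta_def)
qed

section \<open>Asymptotics of the variance\<close>

text \<open>The factor of \<open>\<sigma>\<^sub>n\<^sup>2 = 2 p\<^sup>2 (n \<beta>\<^sup>2 + 2/n\<^sup>2)\<close> that does not involve \<open>p\<close>, up to the constant \<open>2\<close>.\<close>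

definition variance_proxy :: "nat \<Rightarrow> real" where
  "variance_proxy n = real n * (beta n)\<^sup>2 + 2 / (real n)\<^sup>2"

lemma variance_proxy_pos: "0 < n \<Longrightarrow> 0 < variance_proxy n"
  by (simp add: variance_proxy_def add_nonneg_pos)

lemma sigma_sq_eq:
  assumes "0 < n"
  shows "sigma_sq p n (beta n) = 2 * (real p)\<^sup>2 * variance_proxy n"
proof -
  have "real n powr (- 3) = 1 / real n ^ 3"
    by (simp add: powr_minus divide_inverse)
  moreover have "real n * (2 * (1 / real n ^ 3)) = 2 / (real n)\<^sup>2"
    using assms by (simp add: power2_eq_square power3_eq_cube)
  ultimately have "real n * ((beta n)\<^sup>2 + 2 * real n powr (- 3)) = variance_proxy n"
    by (simp only: distrib_left variance_proxy_def)
  then show ?thesis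
    by (simp only: sigma_sq_def mult.assoc)
qed

lemma kernel_variance_ratio:
  assumes n: "2 \<le> n"
  shows "\<bar>kernel_variance n / variance_proxy n - 1\<bar> \<le> 3 * (2 + sqrt (real n)) / (real n - 1)"
proof -
  define b where "b = beta n"
  define x where "x = real n"
  have x: "2 \<le> x" using n by (simp add: x_def)
  define D where "D = x * b\<^sup>2 + 2 / x\<^sup>2"
  have D: "0 < D" using x by (simp add: D_def add_nonneg_pos)
  have b: "0 \<le> b" by (simp add: b_def beta_nonneg)
  have diff: "kernel_variance n - D = 3 / (x - 1) * (x * b\<^sup>2 - 2 * b + 1 / x\<^sup>2)"
  proof -
    have "kernel_variance n = x * b\<^sup>2 + 3 * x * (x - 1) * ((1 / x - b) / (x - 1))\<^sup>2 - 1 / x\<^sup>2"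
      by (simp add: kernel_variance_def mixed_def b_def x_def)
    also have "3 * x * (x - 1) * ((1 / x - b) / (x - 1))\<^sup>2 = 3 / (x - 1) * (x * (1 / x - b)\<^sup>2)"
      using x by (simp add: power2_eq_square)
    also have "x * (1 / x - b)\<^sup>2 = 1 / x - 2 * b + x * b\<^sup>2"
      using x by (simp add: field_simps power2_eq_square)
    finally have "kernel_variance n - D = 3 / (x - 1) * (1 / x - 2 * b + x * b\<^sup>2) - 3 / x\<^sup>2"
      by (simp add: D_def)
    also have "3 / x\<^sup>2 = 3 / (x - 1) * (1 / x - 1 / x\<^sup>2)"
      using x by (simp add: divide_simps power2_eq_square)
    finally show ?thesis
      by (simp only: right_diff_distrib[symmetric]) (simp add: algebra_simps)
  qed
  define y where "y = sqrt x"
  have y: "0 < y" "x = y\<^sup>2" using x by (auto simp: y_def)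
  \<comment> \<open>arithmetic-geometric mean inequality for \<open>x b\<^sup>2\<close> and \<open>1/x\<^sup>2\<close>\<close>
  have "0 \<le> (y * b - 1 / y\<^sup>2)\<^sup>2" by simp
  also have "\<dots> = y\<^sup>2 * b\<^sup>2 - 2 * b / y + 1 / (y\<^sup>2)\<^sup>2"
    using y(1) by (simp add: field_simps power2_eq_square)
  finally have "2 * b / y \<le> x * b\<^sup>2 + 1 / x\<^sup>2"
    by (simp add: y(2))
  also have sum_le: "x * b\<^sup>2 + 1 / x\<^sup>2 \<le> D"
    by (simp add: D_def divide_right_mono)
  finally have "2 * b \<le> y * D"
    using y(1) by (simp add: divide_simps mult.commute)
  moreover have "0 \<le> x * b\<^sup>2 + 1 / x\<^sup>2" using x by simp
  moreover have "0 \<le> y * D" using y D by simp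
  ultimately have "\<bar>x * b\<^sup>2 - 2 * b + 1 / x\<^sup>2\<bar> \<le> 2 * D + y * D"
    using sum_le b D unfolding abs_le_iff by linarith
  then have "\<bar>kernel_variance n - D\<bar> \<le> 3 / (x - 1) * (2 * D + y * D)"
    unfolding diff abs_mult using x by (intro mult_mono) auto
  also have "\<dots> = 3 * (2 + y) / (x - 1) * D"
    by (simp add: algebra_simps add_divide_distrib)
  finally have "\<bar>kernel_variance n - D\<bar> / D \<le> 3 * (2 + y) / (x - 1)"
    using D by (simp add: pos_divide_le_eq)
  moreover have "\<bar>kernel_variance n / D - 1\<bar> = \<bar>kernel_variance n - D\<bar> / D"
  proof -
    have "kernel_variance n / D - 1 = (kernel_variance n - D) / D"
      using D by (simp add: diff_divide_distrib)
    then show ?thesis using D by (simp add: abs_divide)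
  qed
  ultimately have "\<bar>kernel_variance n / D - 1\<bar> \<le> 3 * (2 + sqrt x) / (x - 1)"
    by (simp add: y_def)
  then show ?thesis
    by (simp add: D_def variance_proxy_def x_def b_def)
qed

proposition variance_asymp_equiv:
  assumes p: "filterlim p at_top sequentially"
  shows "(\<lambda>n. 2 * real (p n) * (real (p n) - 1) * kernel_variance n) \<sim>[sequentially]
         (\<lambda>n. sigma_sq (p n) n (beta n))"
proof (rule asymp_equivI')
  have "(\<lambda>n. kernel_variance n / variance_proxy n - 1) \<longlonglongrightarrow> 0"
  proof (rule Lim_null_comparison)
    show "\<forall>\<^sub>F n in sequentially. norm (kernel_variance n / variance_proxy n - 1) \<le>
        3 * (2 + sqrt (real n)) / (real n - 1)"
      using eventually_ge_at_top[of 2] by eventually_elim (simp only: real_norm_def kernel_variance_ratio)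
    show "(\<lambda>n. 3 * (2 + sqrt (real n)) / (real n - 1)) \<longlonglongrightarrow> 0"
      by real_asymp
  qed
  then have ratio: "(\<lambda>n. kernel_variance n / variance_proxy n) \<longlonglongrightarrow> 1"
    by (rule LIM_zero_cancel)
  have "(\<lambda>m. (real m - 1) / real m) \<longlonglongrightarrow> 1"
    by real_asymp
  from filterlim_compose[OF this p] ratio
  have "(\<lambda>n. (real (p n) - 1) / real (p n) * (kernel_variance n / variance_proxy n)) \<longlonglongrightarrow> 1 * 1"
    by (rule tendsto_mult)
  moreover have "\<forall>\<^sub>F n in sequentially. (real (p n) - 1) / real (p n) * (kernel_variance n / variance_proxy n) =
      2 * real (p n) * (real (p n) - 1) * kernel_variance n / sigma_sq (p n) n (beta n)"
    using eventually_compose_filterlim[OF eventually_gt_at_top[of 0] p] eventually_gt_at_top[of 0]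
  proof eventually_elim
    case (elim n)
    then show ?case
      using variance_proxy_pos[of n] by (simp add: sigma_sq_eq power2_eq_square)
  qed
  ultimately show "(\<lambda>n. 2 * real (p n) * (real (p n) - 1) * kernel_variance n / sigma_sq (p n) n (beta n)) \<longlonglongrightarrow> 1"
    by (simp add: tendsto_cong)
qed

lemma sigma_sq_asymp_equivI:
  assumes p: "filterlim p at_top sequentially"
    and lim: "(\<lambda>n. variance_proxy n / g n) \<longlonglongrightarrow> 1"
    and h: "\<forall>\<^sub>F n in sequentially. h n = 2 * (real (p n))\<^sup>2 * g n"
  shows "(\<lambda>n. sigma_sq (p n) n (beta n)) \<sim>[sequentially] h"
proof (rule asymp_equivI')
  have "\<forall>\<^sub>F n in sequentially. variance_proxy n / g n = sigma_sq (p n) n (beta n) / h n"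
    using eventually_compose_filterlim[OF eventually_gt_at_top[of 0] p] eventually_gt_at_top[of 0] h
    by eventually_elim (simp add: sigma_sq_eq)
  with lim show "(\<lambda>n. sigma_sq (p n) n (beta n) / h n) \<longlonglongrightarrow> 1"
    by (rule Lim_transform_eventually)
qed

lemma power2_powr_three_halves: "(real n powr (3 / 2))\<^sup>2 = real n ^ 3"
proof (cases "n = 0")
  case False
  have "(real n powr (3 / 2))\<^sup>2 = real n powr (3 / 2 + 3 / 2)"
    by (simp only: power2_eq_square powr_add)
  also have "\<dots> = real n ^ 3"
    using False by (simp add: powr_numeral)
  finally show ?thesis .
qed simp

lemma variance_proxy_scaled:
  assumes "0 < n"
  shows "(real n)\<^sup>2 * variance_proxy n = (real n powr (3 / 2) * beta n)\<^sup>2 + 2"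
proof -
  have "(real n powr (3 / 2) * beta n)\<^sup>2 = real n ^ 3 * (beta n)\<^sup>2"
    by (simp only: power_mult_distrib power2_powr_three_halves)
  moreover have "(real n)\<^sup>2 * variance_proxy n = real n ^ 3 * (beta n)\<^sup>2 + 2"
    using assms by (simp add: variance_proxy_def distrib_left power2_eq_square power3_eq_cube)
  ultimately show ?thesis by simp
qed

lemma powr_neg_2: "real n powr (- 2) = 1 / (real n)\<^sup>2"
  by (simp add: powr_minus divide_inverse)

lemma sigma_sq_light:
  assumes p: "filterlim p at_top sequentially"
    and lim: "(\<lambda>n. real n powr (3 / 2) * beta n) \<longlonglongrightarrow> 0"
  shows "(\<lambda>n. sigma_sq (p n) n (beta n)) \<sim>[sequentially] (\<lambda>n. 4 * real (p n) ^ 2 * real n powr (- 2))"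
proof (rule sigma_sq_asymp_equivI[OF p])
  have "(\<lambda>n. ((real n powr (3 / 2) * beta n)\<^sup>2 + 2) / 2) \<longlonglongrightarrow> (0\<^sup>2 + 2) / 2"
    by (intro tendsto_intros lim) auto
  then have main: "(\<lambda>n. ((real n powr (3 / 2) * beta n)\<^sup>2 + 2) / 2) \<longlonglongrightarrow> 1"
    by simp
  have "\<forall>\<^sub>F n in sequentially. ((real n powr (3 / 2) * beta n)\<^sup>2 + 2) / 2 =
      variance_proxy n / (2 / (real n)\<^sup>2)"
    using eventually_gt_at_top[of 0]
  proof eventually_elim
    case (elim n)
    show ?case unfolding variance_proxy_scaled[OF elim, symmetric] by simp
  qed
  with main show "(\<lambda>n. variance_proxy n / (2 / (real n)\<^sup>2)) \<longlonglongrightarrow> 1"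
    by (rule Lim_transform_eventually)
  show "\<forall>\<^sub>F n in sequentially. 4 * real (p n) ^ 2 * real n powr (- 2) = 2 * (real (p n))\<^sup>2 * (2 / (real n)\<^sup>2)"
    by (simp add: powr_neg_2)
qed

text \<open>The factor \<open>l\<close> may oscillate between zero and infinity, so neither of the two summands can be dropped;
the relative error is at most \<open>|x\<^sup>2 - c\<^sup>2| / c\<^sup>2\<close> for the quotient \<open>x\<close> that tends to \<open>c\<close>.\<close>

lemma sigma_sq_critical:
  assumes p: "filterlim p at_top sequentially" and c: "0 < c"
    and l: "\<forall>\<^sub>F n in sequentially. 0 < l n"
    and lim: "(\<lambda>n. beta n / (real n powr (- 3 / 2) * l n)) \<longlonglongrightarrow> c"
  shows "(\<lambda>n. sigma_sq (p n) n (beta n)) \<sim>[sequentially]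
         (\<lambda>n. 2 * real (p n) ^ 2 * real n powr (- 2) * ((l n)\<^sup>2 * c\<^sup>2 + 2))"
proof (rule sigma_sq_asymp_equivI[OF p])
  define x where "x = (\<lambda>n. beta n / (real n powr (- 3 / 2) * l n))"
  define g where "g = (\<lambda>n. ((l n)\<^sup>2 * c\<^sup>2 + 2) / (real n)\<^sup>2)"
  have "(\<lambda>n. \<bar>(x n)\<^sup>2 - c\<^sup>2\<bar> / c\<^sup>2) \<longlonglongrightarrow> \<bar>c\<^sup>2 - c\<^sup>2\<bar> / c\<^sup>2"
    using c unfolding x_def by (intro tendsto_intros lim) auto
  then have null: "(\<lambda>n. \<bar>(x n)\<^sup>2 - c\<^sup>2\<bar> / c\<^sup>2) \<longlonglongrightarrow> 0" by simp
  have "(\<lambda>n. variance_proxy n / g n - 1) \<longlonglongrightarrow> 0"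
  proof (rule Lim_null_comparison[OF _ null])
    show "\<forall>\<^sub>F n in sequentially. norm (variance_proxy n / g n - 1) \<le> \<bar>(x n)\<^sup>2 - c\<^sup>2\<bar> / c\<^sup>2"
      using l eventually_gt_at_top[of 0]
    proof eventually_elim
      case (elim n)
      define L where "L = (l n)\<^sup>2"
      have L: "0 < L" using elim by (simp add: L_def)
      have den: "0 < L * c\<^sup>2 + 2" using L by (simp add: add_nonneg_pos)
      have "real n powr (3 / 2) * beta n = x n * l n"
        using elim by (simp add: x_def powr_minus divide_simps)
      then have "(real n)\<^sup>2 * variance_proxy n = (x n)\<^sup>2 * L + 2"
        using variance_proxy_scaled[of n] elim by (simp add: L_def power_mult_distrib)
      then have "variance_proxy n / g n = ((x n)\<^sup>2 * L + 2) / (L * c\<^sup>2 + 2)"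
        by (simp add: g_def L_def mult.commute)
      also have "(x n)\<^sup>2 * L + 2 = L * ((x n)\<^sup>2 - c\<^sup>2) + (L * c\<^sup>2 + 2)"
        by (simp add: algebra_simps)
      finally have expand: "variance_proxy n / g n =
          (L * ((x n)\<^sup>2 - c\<^sup>2) + (L * c\<^sup>2 + 2)) / (L * c\<^sup>2 + 2)" .
      have "variance_proxy n / g n - 1 = L * ((x n)\<^sup>2 - c\<^sup>2) / (L * c\<^sup>2 + 2)"
      proof -
        have one: "(L * c\<^sup>2 + 2) / (L * c\<^sup>2 + 2) = 1" using den by simp
        show ?thesis
          by (simp only: expand add_divide_distrib[of "L * ((x n)\<^sup>2 - c\<^sup>2)" "L * c\<^sup>2 + 2"] one add_diff_cancel_right')
      qed
      then have "norm (variance_proxy n / g n - 1) = L * \<bar>(x n)\<^sup>2 - c\<^sup>2\<bar> / (L * c\<^sup>2 + 2)"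
        using den L by (simp add: abs_mult)
      also have "\<dots> \<le> L * \<bar>(x n)\<^sup>2 - c\<^sup>2\<bar> / (L * c\<^sup>2)"
        using den L c by (intro divide_left_mono mult_pos_pos) auto
      also have "\<dots> = \<bar>(x n)\<^sup>2 - c\<^sup>2\<bar> / c\<^sup>2"
        using L by simp
      finally show ?case .
    qed
  qed
  then show "(\<lambda>n. variance_proxy n / g n) \<longlonglongrightarrow> 1"
    by (rule LIM_zero_cancel)
  show "\<forall>\<^sub>F n in sequentially. 2 * real (p n) ^ 2 * real n powr (- 2) * ((l n)\<^sup>2 * c\<^sup>2 + 2) =
      2 * (real (p n))\<^sup>2 * g n"
    by (simp add: powr_neg_2 g_def)
qed

text \<open>The condition on \<open>n\<^sup>3\<^sup>/\<^sup>2 t n\<close> says that \<open>n \<beta>\<^sup>2\<close> dominates \<open>2/n\<^sup>2\<close>.\<close>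

lemma sigma_sq_dominant:
  assumes p: "filterlim p at_top sequentially" and c: "0 < c"
    and t: "\<And>n. 0 < t n" "filterlim (\<lambda>n. real n powr (3 / 2) * t n) at_top sequentially"
    and lim: "(\<lambda>n. beta n / t n) \<longlonglongrightarrow> c"
    and h: "\<forall>\<^sub>F n in sequentially. h n = 2 * (real (p n))\<^sup>2 * (real n * (t n)\<^sup>2 * c\<^sup>2)"
  shows "(\<lambda>n. sigma_sq (p n) n (beta n)) \<sim>[sequentially] h"
proof (rule sigma_sq_asymp_equivI[OF p _ h])
  define T where "T = (\<lambda>n. real n powr (3 / 2) * t n)"
  have "(\<lambda>n. (beta n / t n)\<^sup>2 / c\<^sup>2 + 2 * (inverse (T n))\<^sup>2 / c\<^sup>2) \<longlonglongrightarrow> c\<^sup>2 / c\<^sup>2 + 2 * 0\<^sup>2 / c\<^sup>2"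
    using c unfolding T_def
    by (intro tendsto_intros lim tendsto_inverse_0_at_top t(2)) auto
  then have main: "(\<lambda>n. (beta n / t n)\<^sup>2 / c\<^sup>2 + 2 * (inverse (T n))\<^sup>2 / c\<^sup>2) \<longlonglongrightarrow> 1"
    using c by simp
  have "\<forall>\<^sub>F n in sequentially. (beta n / t n)\<^sup>2 / c\<^sup>2 + 2 * (inverse (T n))\<^sup>2 / c\<^sup>2 =
      variance_proxy n / (real n * (t n)\<^sup>2 * c\<^sup>2)"
    using eventually_gt_at_top[of 0]
  proof eventually_elim
    case (elim n)
    have "(T n)\<^sup>2 = real n ^ 3 * (t n)\<^sup>2"
      by (simp add: T_def power_mult_distrib power2_powr_three_halves)
    then have "(inverse (T n))\<^sup>2 = 1 / (real n ^ 3 * (t n)\<^sup>2)"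
      by (simp add: power_inverse divide_inverse)
    moreover have "variance_proxy n / (real n * (t n)\<^sup>2 * c\<^sup>2) =
        (beta n)\<^sup>2 / (t n)\<^sup>2 / c\<^sup>2 + 2 / (real n ^ 3 * (t n)\<^sup>2) / c\<^sup>2"
      using elim t(1)[of n] c
      by (simp add: variance_proxy_def add_divide_distrib power2_eq_square power3_eq_cube)
    ultimately show ?case
      by (simp add: power_divide)
  qed
  with main show "(\<lambda>n. variance_proxy n / (real n * (t n)\<^sup>2 * c\<^sup>2)) \<longlonglongrightarrow> 1"
    by (rule Lim_transform_eventually)
qed

lemma sigma_sq_heavy:
  assumes p: "filterlim p at_top sequentially" and c: "0 < c"
    and lim: "(\<lambda>n. real n * beta n) \<longlonglongrightarrow> c"
  shows "(\<lambda>n. sigma_sq (p n) n (beta n)) \<sim>[sequentially] (\<lambda>n. 2 * real (p n) ^ 2 * real n powr (- 1) * c\<^sup>2)"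
proof (rule sigma_sq_asymp_equivI[OF p])
  have "(\<lambda>n. ((real n * beta n)\<^sup>2 + 2 / real n) / c\<^sup>2) \<longlonglongrightarrow> (c\<^sup>2 + 0) / c\<^sup>2"
    using c by (intro tendsto_intros lim) (auto intro: lim_const_over_n)
  then have main: "(\<lambda>n. ((real n * beta n)\<^sup>2 + 2 / real n) / c\<^sup>2) \<longlonglongrightarrow> 1"
    using c by simp
  have "\<forall>\<^sub>F n in sequentially. ((real n * beta n)\<^sup>2 + 2 / real n) / c\<^sup>2 = variance_proxy n / (c\<^sup>2 / real n)"
    using eventually_gt_at_top[of 0]
    by eventually_elim (simp add: variance_proxy_def power2_eq_square distrib_right distrib_left)
  with main show "(\<lambda>n. variance_proxy n / (c\<^sup>2 / real n)) \<longlonglongrightarrow> 1"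
    by (rule Lim_transform_eventually)
  show "\<forall>\<^sub>F n in sequentially. 2 * real (p n) ^ 2 * real n powr (- 1) * c\<^sup>2 = 2 * (real (p n))\<^sup>2 * (c\<^sup>2 / real n)"
    by (simp add: powr_minus divide_inverse)
qed

end

lemma (in regularly_varying_law) power_times_tail_at_top:
  assumes "a < r"
  shows "filterlim (\<lambda>s. s powr r * tail s) at_top at_top"
proof -
  obtain q where q: "a < q" "q < r" using dense assms by blast
  obtain c where c: "0 < c" and ge: "\<forall>\<^sub>F s in at_top. c * s powr (- q) \<le> tail s"
    using tail_ge_power[OF q(1)] .
  have "filterlim (\<lambda>s. s powr (r - q)) at_top at_top"
    using q(2) by (intro real_powr_at_top) simp
  then have growth: "filterlim (\<lambda>s. c * s powr (r - q)) at_top at_top"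
    by (rule filterlim_tendsto_pos_mult_at_top[OF tendsto_const c])
  have "\<forall>\<^sub>F s in at_top. c * s powr (r - q) \<le> s powr r * tail s"
    using ge
  proof eventually_elim
    case (elim s)
    have "c * s powr (r - q) = s powr r * (c * s powr (- q))"
      by (simp add: powr_diff powr_minus divide_inverse)
    also have "\<dots> \<le> s powr r * tail s"
      using elim by (intro mult_left_mono) auto
    finally show ?case .
  qed
  with growth show ?thesis
    by (rule filterlim_at_top_mono)
qed

section \<open>Entries given as random variables\<close>

lemma symmetric_entry_law_distr:
  assumes "admissible_entry N \<xi>"
  shows "symmetric_entry_law (distr N borel \<xi>)"
proof -
  interpret prob_space N using assms by (simp add: admissible_entry_def)
  have [measurable]: "\<xi> \<in> borel_measurable N"
    and sym: "distr N borel \<xi> = distr N borel (\<lambda>\<omega>. - \<xi> \<omega>)"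
    and zero: "prob {\<omega> \<in> space N. \<xi> \<omega> = 0} = 0"
    using assms by (auto simp: admissible_entry_def)
  interpret D: prob_space "distr N borel \<xi>"
    by (rule prob_space_distr) simp
  show ?thesis
  proof
    show "sets (distr N borel \<xi>) = sets borel" by simp
    have "AE \<omega> in N. \<xi> \<omega> \<noteq> 0"
    proof (rule AE_I)
      show "emeasure N {\<omega> \<in> space N. \<xi> \<omega> = 0} = 0"
        using zero by (simp add: emeasure_eq_measure)
    qed auto
    then show "AE x in distr N borel \<xi>. x \<noteq> 0"
      by (simp add: AE_distr_iff)
    have "distr (distr N borel \<xi>) borel uminus = distr N borel (\<lambda>\<omega>. - \<xi> \<omega>)"
      by (subst distr_distr) (auto simp: comp_def)
    then show "distr (distr N borel \<xi>) borel uminus = distr N borel \<xi>"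
      by (simp add: sym)
  qed
qed

lemma tail_of_regularly_varying:
  assumes "entry_law (distr N borel \<xi>)" and \<xi>: "\<xi> \<in> borel_measurable N"
    and rv: "regularly_varying_rv N \<xi> \<alpha> L" and s: "0 < s"
  shows "entry_law.tail (distr N borel \<xi>) s = s powr (- (\<alpha> / 2)) * L (sqrt s)"
proof -
  interpret entry_law "distr N borel \<xi>" by fact
  have "s < x\<^sup>2 \<longleftrightarrow> sqrt s < \<bar>x\<bar>" for x :: real
    using real_sqrt_less_iff[of s "x\<^sup>2"] by (simp del: real_sqrt_less_iff)
  then have "tail s = measure N {\<omega> \<in> space N. sqrt s < \<bar>\<xi> \<omega>\<bar>}"
    unfolding tail_def using \<xi> by (subst measure_distr) (auto simp: vimage_def Int_def conj_commute)
  also have "\<dots> = sqrt s powr (- \<alpha>) * L (sqrt s)"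
    using rv s by (simp add: regularly_varying_rv_def)
  also have "sqrt s powr (- \<alpha>) = s powr (- (\<alpha> / 2))"
    using s by (simp add: powr_half_sqrt[symmetric] powr_powr)
  finally show ?thesis .
qed

lemma regularly_varying_law_distr:
  assumes law: "entry_law (distr N borel \<xi>)" and \<xi>: "\<xi> \<in> borel_measurable N"
    and rv: "regularly_varying_rv N \<xi> \<alpha> L" and \<alpha>: "0 < \<alpha>"
  shows "regularly_varying_law (distr N borel \<xi>) (\<alpha> / 2)"
proof -
  interpret entry_law "distr N borel \<xi>" by fact
  note tail = tail_of_regularly_varying[OF law \<xi> rv]
  have L_pos: "\<forall>\<^sub>F x in at_top. 0 < L x"
    and L_slow: "\<And>t. 0 < t \<Longrightarrow> ((\<lambda>x. L (t * x) / L x) \<longlongrightarrow> 1) at_top"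
    using rv by (auto simp: regularly_varying_rv_def slowly_varying_def)
  have L_sqrt_pos: "\<forall>\<^sub>F s in at_top. 0 < L (sqrt s)"
    using eventually_compose_filterlim[OF L_pos sqrt_at_top] .
  show ?thesis
  proof
    show "0 < \<alpha> / 2" using \<alpha> by simp
    show "0 < tail s" for s
    proof -
      obtain s' where s': "max 1 s \<le> s'" "0 < L (sqrt s')"
        using eventually_happens'[OF _ eventually_conj[OF eventually_ge_at_top[of "max 1 s"] L_sqrt_pos]]
        by auto
      then have "0 < tail s'" by (simp add: tail)
      also have "\<dots> \<le> tail s" using s' by (intro tail_antimono) simp
      finally show ?thesis .
    qed
    fix t :: real assume t: "0 < t"
    have "((\<lambda>s. L (sqrt t * sqrt s) / L (sqrt s)) \<longlongrightarrow> 1) at_top"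
      using t by (intro filterlim_compose[OF L_slow sqrt_at_top]) simp
    then have "((\<lambda>s. t powr (- (\<alpha> / 2)) * (L (sqrt t * sqrt s) / L (sqrt s))) \<longlongrightarrow> t powr (- (\<alpha> / 2)) * 1) at_top"
      by (intro tendsto_mult tendsto_const)
    moreover have "\<forall>\<^sub>F s in at_top. t powr (- (\<alpha> / 2)) * (L (sqrt t * sqrt s) / L (sqrt s)) = tail (t * s) / tail s"
      using eventually_gt_at_top[of 0]
      by eventually_elim (use t in \<open>simp add: tail real_sqrt_mult powr_mult\<close>)
    ultimately show "((\<lambda>s. tail (t * s) / tail s) \<longlongrightarrow> t powr (- (\<alpha> / 2))) at_top"
      by (simp add: tendsto_cong)
  qed
qed

section \<open>Variance of the trace of the squared sample correlation matrix\<close>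

theorem lemma2p5:
  fixes N :: "'b measure" and \<xi> :: "'b \<Rightarrow> real"
    and M :: "nat \<Rightarrow> 'a measure" and X :: "nat \<Rightarrow> nat \<Rightarrow> nat \<Rightarrow> 'a \<Rightarrow> real"
    and p :: "nat \<Rightarrow> nat"
  assumes "admissible_entry N \<xi>"
    and "\<And>n. iid_copies (M n) (p n) n (X n) N \<xi>"
    and "filterlim p at_top sequentially"
  shows
    "(\<lambda>n. prob_space.variance (M n)
        (\<lambda>\<omega>. matrix_trace (sample_correlation (p n) n (\<lambda>i j. X n i j \<omega>) ^\<^sub>m 2)))
       \<sim>[sequentially] (\<lambda>n. sigma_sq (p n) n (beta4 (M n) n (X n)))
     \<and> (integrable N (\<lambda>\<omega>. \<xi> \<omega> ^ 4) \<or>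
          (\<exists>\<alpha> L. 3 < \<alpha> \<and> \<alpha> < 4 \<and> regularly_varying_rv N \<xi> \<alpha> L) \<longrightarrow>
        (\<lambda>n. sigma_sq (p n) n (beta4 (M n) n (X n)))
          \<sim>[sequentially] (\<lambda>n. 4 * real (p n) ^ 2 * real n powr (-2)))
     \<and> (\<forall>\<alpha> L. regularly_varying_rv N \<xi> \<alpha> L \<longrightarrow>
          (\<alpha> = 3 \<longrightarrow>
            (\<lambda>n. sigma_sq (p n) n (beta4 (M n) n (X n)))
              \<sim>[sequentially]
            (\<lambda>n. 2 * real (p n) ^ 2 * real n powr (-2) * ((L (sqrt (real n)))\<^sup>2 * (c2 \<alpha>)\<^sup>2 + 2))) \<and>
          (2 \<le> \<alpha> \<and> \<alpha> < 3 \<and> integrable N (\<lambda>\<omega>. (\<xi> \<omega>)\<^sup>2) \<and>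
             prob_space.expectation N (\<lambda>\<omega>. (\<xi> \<omega>)\<^sup>2) = 1 \<longrightarrow>
            (\<lambda>n. sigma_sq (p n) n (beta4 (M n) n (X n)))
              \<sim>[sequentially]
            (\<lambda>n. 2 * real (p n) ^ 2 * real n powr (1 - \<alpha>) * (L (sqrt (real n)))\<^sup>2 * (c2 \<alpha>)\<^sup>2)) \<and>
          (0 < \<alpha> \<and> \<alpha> < 2 \<longrightarrow>
            (\<lambda>n. sigma_sq (p n) n (beta4 (M n) n (X n)))
              \<sim>[sequentially]
            (\<lambda>n. 2 * real (p n) ^ 2 * real n powr (-1) * (1 - \<alpha> / 2)\<^sup>2)))"
proof -
  define D where "D = distr N borel \<xi>"
  have \<xi> [measurable]: "\<xi> \<in> borel_measurable N"
    using assms(1) by (simp add: admissible_entry_def)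
  interpret symmetric_entry_law D
    unfolding D_def by (rule symmetric_entry_law_distr[OF assms(1)])
  note p = assms(3)
  have pos: "\<forall>\<^sub>F n in sequentially. 0 < p n \<and> 0 < n"
    by (intro eventually_conj eventually_compose_filterlim[OF eventually_gt_at_top p] eventually_gt_at_top)
  have beta4: "\<forall>\<^sub>F n in sequentially. beta4 (M n) n (X n) = beta n"
    using pos by eventually_elim (rule beta4_eq_beta[OF assms(2) D_def]; simp)
  then have sigma: "\<forall>\<^sub>F n in sequentially. sigma_sq (p n) n (beta n) = sigma_sq (p n) n (beta4 (M n) n (X n))"
    by eventually_elim simp
  have transfer: "(\<lambda>n. sigma_sq (p n) n (beta4 (M n) n (X n))) \<sim>[sequentially] h"
    if "(\<lambda>n. sigma_sq (p n) n (beta n)) \<sim>[sequentially] h" for h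
    using that asymp_equiv_cong[OF sigma, of h h] by simp
  have power_int: "integrable D (\<lambda>x. x ^ k) \<longleftrightarrow> integrable N (\<lambda>\<omega>. \<xi> \<omega> ^ k)" for k
    unfolding D_def by (rule integrable_distr_eq) auto
  have square_mean: "(\<integral>x. x\<^sup>2 \<partial>D) = (\<integral>\<omega>. (\<xi> \<omega>)\<^sup>2 \<partial>N)"
    unfolding D_def by (rule integral_distr) auto
  have rv_law: "regularly_varying_law D (\<alpha> / 2)"
    if "0 < \<alpha>" "regularly_varying_rv N \<xi> \<alpha> L" for \<alpha> L
    unfolding D_def
    using regularly_varying_law_distr[OF _ \<xi> that(2,1)] entry_law_axioms by (simp add: D_def)
  have rv_tail: "tail (real n) = real n powr (- (\<alpha> / 2)) * L (sqrt (real n))"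
    if "0 < n" "regularly_varying_rv N \<xi> \<alpha> L" for n \<alpha> L
    using tail_of_regularly_varying[OF _ \<xi> that(2), of "real n"] entry_law_axioms that(1)
    by (simp add: D_def)
  have variance: "(\<lambda>n. prob_space.variance (M n)
        (\<lambda>\<omega>. matrix_trace (sample_correlation (p n) n (\<lambda>i j. X n i j \<omega>) ^\<^sub>m 2)))
       \<sim>[sequentially] (\<lambda>n. sigma_sq (p n) n (beta4 (M n) n (X n)))" (is "?V \<sim>[sequentially] _")
  proof -
    have "\<forall>\<^sub>F n in sequentially. 2 * real (p n) * (real (p n) - 1) * kernel_variance n = ?V n"
      using pos by eventually_elim (rule variance_trace[OF assms(2) D_def, symmetric]; simp)
    from asymp_equiv_cong[OF this sigma] show ?thesis
      using variance_asymp_equiv[OF p] by simp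
  qed
  have light: "(\<lambda>n. sigma_sq (p n) n (beta4 (M n) n (X n)))
          \<sim>[sequentially] (\<lambda>n. 4 * real (p n) ^ 2 * real n powr (-2))"
    if "integrable N (\<lambda>\<omega>. \<xi> \<omega> ^ 4) \<or>
          (\<exists>\<alpha> L. 3 < \<alpha> \<and> \<alpha> < 4 \<and> regularly_varying_rv N \<xi> \<alpha> L)"
    using that
  proof
    assume "integrable N (\<lambda>\<omega>. \<xi> \<omega> ^ 4)"
    then show ?thesis
      by (intro transfer sigma_sq_light[OF p] beta_small_of_fourth_moment) (simp add: power_int)
  next
    assume "\<exists>\<alpha> L. 3 < \<alpha> \<and> \<alpha> < 4 \<and> regularly_varying_rv N \<xi> \<alpha> L"
    then obtain \<alpha> L where \<alpha>: "3 < \<alpha>" "\<alpha> < 4" "regularly_varying_rv N \<xi> \<alpha> L" by blast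
    then show ?thesis
      using regularly_varying_law.beta_small_of_index[OF rv_law[of \<alpha> L]]
      by (intro transfer sigma_sq_light[OF p]) auto
  qed
  have critical: "(\<lambda>n. sigma_sq (p n) n (beta4 (M n) n (X n)))
              \<sim>[sequentially]
            (\<lambda>n. 2 * real (p n) ^ 2 * real n powr (-2) * ((L (sqrt (real n)))\<^sup>2 * (c2 3)\<^sup>2 + 2))"
    if rv: "regularly_varying_rv N \<xi> 3 L" for L
  proof (intro transfer sigma_sq_critical p)
    interpret R: regularly_varying_law D "3 / 2" using rv_law[OF _ rv] by simp
    have int: "integrable D (\<lambda>x. x\<^sup>2)"
      by (rule R.second_moment_finite) simp
    then have mean: "(\<integral>x. x\<^sup>2 \<partial>D) = 1"
      using assms(1) by (simp add: admissible_entry_def square_mean power_int)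
    show "0 < c2 3" by (rule c2_pos) auto
    have "\<forall>\<^sub>F x in at_top. 0 < L x"
      using rv by (auto simp: regularly_varying_rv_def slowly_varying_def)
    moreover have "filterlim (\<lambda>n. sqrt (real n)) at_top sequentially"
      by real_asymp
    ultimately show "\<forall>\<^sub>F n in sequentially. 0 < L (sqrt (real n))"
      by (rule eventually_compose_filterlim)
    have "(\<lambda>n. beta n / tail (real n)) \<longlonglongrightarrow> c2 3"
      using R.beta_tail_limit[OF _ int mean] by simp
    moreover have "\<forall>\<^sub>F n in sequentially. beta n / tail (real n) =
        beta n / (real n powr (- 3 / 2) * L (sqrt (real n)))"
      using eventually_gt_at_top[of 0] by eventually_elim (simp add: rv_tail[OF _ rv])
    ultimately show "(\<lambda>n. beta n / (real n powr (- 3 / 2) * L (sqrt (real n)))) \<longlonglongrightarrow> c2 3"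
      by (rule Lim_transform_eventually)
  qed
  have dominant: "(\<lambda>n. sigma_sq (p n) n (beta4 (M n) n (X n)))
              \<sim>[sequentially]
            (\<lambda>n. 2 * real (p n) ^ 2 * real n powr (1 - \<alpha>) * (L (sqrt (real n)))\<^sup>2 * (c2 \<alpha>)\<^sup>2)"
    if rv: "regularly_varying_rv N \<xi> \<alpha> L" and \<alpha>: "2 \<le> \<alpha>" "\<alpha> < 3"
      and int: "integrable N (\<lambda>\<omega>. (\<xi> \<omega>)\<^sup>2)" and mean: "(\<integral>\<omega>. (\<xi> \<omega>)\<^sup>2 \<partial>N) = 1" for \<alpha> L
  proof (intro transfer sigma_sq_dominant[where t = "\<lambda>n. tail (real n)"] p)
    interpret R: regularly_varying_law D "\<alpha> / 2" using rv_law[OF _ rv] \<alpha> by simp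
    show "0 < c2 \<alpha>" using \<alpha> by (intro c2_pos) auto
    show "0 < tail (real n)" for n by (rule R.tail_pos)
    show "(\<lambda>n. beta n / tail (real n)) \<longlonglongrightarrow> c2 \<alpha>"
      using R.beta_tail_limit \<alpha> int mean by (simp add: power_int square_mean)
    have "\<alpha> / 2 < 3 / 2" using \<alpha> by simp
    from filterlim_compose[OF R.power_times_tail_at_top[OF this] filterlim_real_sequentially]
    show "filterlim (\<lambda>n. real n powr (3 / 2) * tail (real n)) at_top sequentially" .
    show "\<forall>\<^sub>F n in sequentially. 2 * real (p n) ^ 2 * real n powr (1 - \<alpha>) * (L (sqrt (real n)))\<^sup>2 * (c2 \<alpha>)\<^sup>2 =
        2 * (real (p n))\<^sup>2 * (real n * (tail (real n))\<^sup>2 * (c2 \<alpha>)\<^sup>2)"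
      using eventually_gt_at_top[of 0]
    proof eventually_elim
      case (elim n)
      have "real n * (real n powr (- (\<alpha> / 2)))\<^sup>2 = real n powr 1 * (real n powr (- (\<alpha> / 2) + - (\<alpha> / 2)))"
        using elim by (simp only: power2_eq_square powr_add) simp
      also have "\<dots> = real n powr (1 - \<alpha>)"
        by (simp only: powr_add[symmetric]) simp
      finally have "real n * (tail (real n))\<^sup>2 = real n powr (1 - \<alpha>) * (L (sqrt (real n)))\<^sup>2"
        by (simp add: rv_tail[OF elim rv] power_mult_distrib mult.assoc[symmetric])
      then show ?case by (simp add: mult.assoc)
    qed
  qed
  have heavy: "(\<lambda>n. sigma_sq (p n) n (beta4 (M n) n (X n)))
              \<sim>[sequentially]
            (\<lambda>n. 2 * real (p n) ^ 2 * real n powr (-1) * (1 - \<alpha> / 2)\<^sup>2)"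
    if rv: "regularly_varying_rv N \<xi> \<alpha> L" and \<alpha>: "0 < \<alpha>" "\<alpha> < 2" for \<alpha> L
    using regularly_varying_law.scaled_beta_limit_heavy[OF rv_law[OF \<alpha>(1) rv]] \<alpha>
    by (intro transfer sigma_sq_heavy p) auto
  show ?thesis
    using variance light critical dominant heavy by blast
qed

end
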